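(* Let $\Omega$ be a compact smooth manifold with boundary and $g_P,g_S$ Riemannian metrics on $\Omega$ such that $\partial\Omega$ is strictly convex with respect to both metrics and all geodesics of both metrics are non-trapping. If $g_P$ is a priori known and $g_S^{-1}|_{\partial T^*\Omega}$ is known, then $g_S$ is determined by the directional collision relation $R$ of the pair $(g_P,g_S)$. Explicitly: if $g_P$, $g_S$ and $\tilde g_S$ are Riemannian metrics on $\Omega$ such that $\partial\Omega$ is strictly convex with respect to each of them and all geodesics of each of them are non-trapping, if $g_S^{-1}=\tilde g_S^{-1}$ on $\partial T^*\Omega$, and if the pairs $(g_P,g_S)$ and $(g_P,\tilde g_S)$ have the same directional collision relation, then $g_S=\tilde g_S$ on $\Omega$.
   Context: $\partial T^*\Omega$ denotes $T^*\Omega|_{\partial\Omega}$. For $*=P,S$, $H_*$ is the Hamiltonian vector field on $T^*\Omega$ of $g_*^{-1}(\xi,\xi)$, and $\varphi_*(x,\xi,\ell)$ (for $\xi\ne0$, and for $\ell$ such that the flow stays over $\Omega$) is the corresponding Hamiltonian flow, reparametrized by the length $\ell$, with respect to $g_*$, of the projected curve in $\Omega$. A tuple $(x_P,\xi_P,\ell_P;x_S,\xi_S,\ell_S)$ with $(x_P,\xi_P),(x_S,\xi_S)\in\partial T^*\Omega$ (nonzero covectors) is called a directional collision relation of $(g_P,g_S)$ if $$\varphi_P(x_P,\xi_P,\ell_P)=\varphi_S(x_S,\xi_S,\ell_S)$$ as elements of $T^*\Omega$ (same point and same covector). $R$ denotes the set of all such tuples. Non-trapping means every maximal geodesic exits $\Omega$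 in finite time in both directions. *)

theory Defs
  imports "HOL-Analysis.Analysis"
begin

section \<open>Smooth maps\<close>

primrec C_k_on :: "nat \<Rightarrow> 'e::euclidean_space set \<Rightarrow> ('e \<Rightarrow> 'f::real_normed_vector) \<Rightarrow> bool" where
  "C_k_on 0 S f \<longleftrightarrow> continuous_on S f"
| "C_k_on (Suc m) S f \<longleftrightarrow>
     (\<exists>f'. (\<forall>x\<in>S. (f has_derivative f' x) (at x)) \<and> (\<forall>v. C_k_on m S (\<lambda>x. f' x v)))"

text \<open>On a set that need not be open (such as a relatively open subset of a half-space),
  smoothness means the existence of local smooth extensions to open sets.\<close>

definition smooth_on :: "'e::euclidean_space set \<Rightarrow> ('e \<Rightarrow> 'f::real_normed_vector) \<Rightarrow> bool" where
  "smooth_on S f \<longleftrightarrow>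
     (\<forall>x\<in>S. \<exists>U F. open U \<and> x \<in> U \<and> (\<forall>m. C_k_on m U F) \<and> (\<forall>y\<in>U \<inter> S. F y = f y))"


section \<open>Smooth manifolds with boundary\<close>

text \<open>A chart is a pair of its domain and its coordinate map; the model space is the closed
  half-space in which the coordinate number \<open>k\<close> is nonnegative.\<close>

type_synonym ('a, 'n) chart = "'a set \<times> ('a \<Rightarrow> real ^ 'n)"

definition half_space :: "'n \<Rightarrow> (real ^ 'n::finite) set" where
  "half_space k = {y. 0 \<le> y $ k}"

definition is_chart :: "'a topology \<Rightarrow> 'n \<Rightarrow> ('a, 'n::finite) chart \<Rightarrow> bool" where
  "is_chart M k c \<longleftrightarrow> openin M (fst c) \<and>
     openin (top_of_set (half_space k)) (snd c ` fst c) \<and>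
     homeomorphic_map (subtopology M (fst c)) (top_of_set (snd c ` fst c)) (snd c)"

abbreviation param :: "('a, 'n::finite) chart \<Rightarrow> real ^ 'n \<Rightarrow> 'a" where
  "param c \<equiv> inv_into (fst c) (snd c)"

definition transition :: "('a, 'n::finite) chart \<Rightarrow> ('a, 'n) chart \<Rightarrow> real ^ 'n \<Rightarrow> real ^ 'n" where
  "transition c d = snd d \<circ> param c"

text \<open>The atlas need not be maximal.\<close>

definition smooth_manifold_with_boundary ::
    "'a topology \<Rightarrow> 'n \<Rightarrow> ('a, 'n::finite) chart set \<Rightarrow> bool" where
  "smooth_manifold_with_boundary M k A \<longleftrightarrow>
     Hausdorff_space M \<and> second_countable M \<and>
     (\<forall>c\<in>A. is_chart M k c) \<and> topspace M = (\<Union>c\<in>A. fst c) \<and>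
     (\<forall>c\<in>A. \<forall>d\<in>A. smooth_on (snd c ` (fst c \<inter> fst d)) (transition c d))"

definition manifold_boundary :: "'n \<Rightarrow> ('a, 'n::finite) chart set \<Rightarrow> 'a set" where
  "manifold_boundary k A = {x. \<exists>c\<in>A. x \<in> fst c \<and> snd c x $ k = 0}"

text \<open>Derivatives in a chart are taken within the chart image. It is relatively open in the
  half-space, so they are uniquely determined at boundary points as well.\<close>

definition jacobian_at :: "('a, 'n::finite) chart \<Rightarrow> ('a, 'n) chart \<Rightarrow> 'a \<Rightarrow> real ^ 'n ^ 'n" where
  "jacobian_at c d x =
     matrix (frechet_derivative (transition c d) (at (snd c x) within snd c ` (fst c \<inter> fst d)))"

definition partial_at :: "('a, 'n::finite) chart \<Rightarrow> ('a \<Rightarrow> real) \<Rightarrow> 'n \<Rightarrow> 'a \<Rightarrow> real" where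
  "partial_at c f i x =
     frechet_derivative (f \<circ> param c) (at (snd c x) within snd c ` fst c) (axis i 1)"


section \<open>The cotangent bundle\<close>

text \<open>A covector at \<open>x\<close> is the family of its component vectors in the charts around \<open>x\<close>, subject
  to the covariant transformation law. Components in irrelevant charts are set to zero, so that
  equality of covectors is equality of families.\<close>

type_synonym ('a, 'n) covector = "('a, 'n) chart \<Rightarrow> real ^ 'n"

definition cotangent_space :: "('a, 'n::finite) chart set \<Rightarrow> 'a \<Rightarrow> ('a, 'n) covector set" where
  "cotangent_space A x = {\<xi>.
     (\<forall>c\<in>A. \<forall>d\<in>A. x \<in> fst c \<inter> fst d \<longrightarrow> \<xi> c = transpose (jacobian_at c d x) *v \<xi> d) \<and>
     (\<forall>c. c \<notin> A \<or> x \<notin> fst c \<longrightarrow> \<xi> c = 0)}"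

definition cotangent_bundle ::
    "'a topology \<Rightarrow> ('a, 'n::finite) chart set \<Rightarrow> ('a \<times> ('a, 'n) covector) set" where
  "cotangent_bundle M A = (SIGMA x:topspace M. cotangent_space A x)"

definition boundary_cotangent_nonzero ::
    "'n \<Rightarrow> ('a, 'n::finite) chart set \<Rightarrow> ('a \<times> ('a, 'n) covector) set" where
  "boundary_cotangent_nonzero k A =
     (SIGMA x:manifold_boundary k A. cotangent_space A x - {\<lambda>_. 0})"


section \<open>Riemannian metrics\<close>

text \<open>A metric is given by its matrix in each chart, as a function of the point of the chart
  domain; values at points outside the chart domain are irrelevant.\<close>

type_synonym ('a, 'n) metric_tensor = "('a, 'n) chart \<Rightarrow> 'a \<Rightarrow> real ^ 'n ^ 'n"

definition riemannian_metric ::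
    "('a, 'n::finite) chart set \<Rightarrow> ('a, 'n) metric_tensor \<Rightarrow> bool" where
  "riemannian_metric A g \<longleftrightarrow>
     (\<forall>c\<in>A. smooth_on (snd c ` fst c) (g c \<circ> param c)) \<and>
     (\<forall>c\<in>A. \<forall>x\<in>fst c. transpose (g c x) = g c x \<and> (\<forall>v. v \<noteq> 0 \<longrightarrow> 0 < v \<bullet> (g c x *v v))) \<and>
     (\<forall>c\<in>A. \<forall>d\<in>A. \<forall>x\<in>fst c \<inter> fst d.
        g c x = transpose (jacobian_at c d x) ** g d x ** jacobian_at c d x)"

abbreviation inverse_metric ::
    "('a, 'n::finite) metric_tensor \<Rightarrow> ('a, 'n) chart \<Rightarrow> 'a \<Rightarrow> real ^ 'n ^ 'n" where
  "inverse_metric g c x \<equiv> matrix_inv (g c x)"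

definition christoffel ::
    "('a, 'n::finite) metric_tensor \<Rightarrow> ('a, 'n) chart \<Rightarrow> 'a \<Rightarrow> 'n \<Rightarrow> 'n \<Rightarrow> 'n \<Rightarrow> real" where
  "christoffel g c x l i j = (\<Sum>m\<in>UNIV. inverse_metric g c x $ l $ m *
     (partial_at c (\<lambda>z. g c z $ j $ m) i x + partial_at c (\<lambda>z. g c z $ i $ m) j x
       - partial_at c (\<lambda>z. g c z $ i $ j) m x)) / 2"

definition christoffel_form ::
    "('a, 'n::finite) metric_tensor \<Rightarrow> ('a, 'n) chart \<Rightarrow> 'a \<Rightarrow> real ^ 'n \<Rightarrow> real ^ 'n \<Rightarrow> real ^ 'n" where
  "christoffel_form g c x v w =
     (\<chi> l. \<Sum>i\<in>UNIV. \<Sum>j\<in>UNIV. christoffel g c x l i j * v $ i * w $ j)"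


subsection \<open>Strict convexity of the boundary\<close>

text \<open>The boundary defining coordinate \<open>y $ k\<close> grows inwards, so the normalized gradient of that
  coordinate is the inward unit normal.\<close>

definition inward_normal ::
    "'n \<Rightarrow> ('a, 'n::finite) metric_tensor \<Rightarrow> ('a, 'n) chart \<Rightarrow> 'a \<Rightarrow> real ^ 'n" where
  "inward_normal k g c x =
     (\<chi> i. inverse_metric g c x $ i $ k) /\<^sub>R sqrt (inverse_metric g c x $ k $ k)"

text \<open>For \<open>v\<close>, \<open>w\<close> tangent to the boundary this is the inner product of \<open>\<nabla>\<^sub>v w\<close> with the inward
  unit normal, where \<open>w\<close> is extended with constant components (which stays tangent to the
  boundary). With this sign the round ball has a positive definite form.\<close>

definition second_fundamental_form ::
    "'n \<Rightarrow> ('a, 'n::finite) metric_tensor \<Rightarrow> ('a, 'n) chart \<Rightarrow> 'a \<Rightarrow> real ^ 'n \<Rightarrow> real ^ 'n \<Rightarrow> real" where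
  "second_fundamental_form k g c x v w =
     (g c x *v christoffel_form g c x v w) \<bullet> inward_normal k g c x"

definition strictly_convex_boundary ::
    "'n \<Rightarrow> ('a, 'n::finite) chart set \<Rightarrow> ('a, 'n) metric_tensor \<Rightarrow> bool" where
  "strictly_convex_boundary k A g \<longleftrightarrow>
     (\<forall>c\<in>A. \<forall>x\<in>fst c. snd c x $ k = 0 \<longrightarrow>
        (\<forall>v. v \<noteq> 0 \<and> v $ k = 0 \<longrightarrow> 0 < second_fundamental_form k g c x v v))"


subsection \<open>Geodesics and the non-trapping condition\<close>

definition geodesic_on ::
    "'a topology \<Rightarrow> ('a, 'n::finite) chart set \<Rightarrow> ('a, 'n) metric_tensor \<Rightarrow>
      real set \<Rightarrow> (real \<Rightarrow> 'a) \<Rightarrow> bool" where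
  "geodesic_on M A g I x \<longleftrightarrow>
     is_interval I \<and> continuous_map (top_of_set I) M x \<and>
     (\<exists>v. \<forall>c\<in>A. \<forall>t\<in>I. x t \<in> fst c \<longrightarrow>
        ((\<lambda>s. snd c (x s)) has_vector_derivative v c t) (at t within I) \<and>
        (v c has_vector_derivative - christoffel_form g c (x t) (v c t) (v c t)) (at t within I))"

definition maximal_geodesic_on ::
    "'a topology \<Rightarrow> ('a, 'n::finite) chart set \<Rightarrow> ('a, 'n) metric_tensor \<Rightarrow>
      real set \<Rightarrow> (real \<Rightarrow> 'a) \<Rightarrow> bool" where
  "maximal_geodesic_on M A g I x \<longleftrightarrow>
     geodesic_on M A g I x \<and>
     (\<forall>J y. geodesic_on M A g J y \<and> I \<subseteq> J \<and> (\<forall>t\<in>I. y t = x t) \<longrightarrow> J = I)"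

text \<open>Constant curves satisfy the geodesic equation but do not count as geodesics here.\<close>

definition non_trapping ::
    "'a topology \<Rightarrow> 'n \<Rightarrow> ('a, 'n::finite) chart set \<Rightarrow> ('a, 'n) metric_tensor \<Rightarrow> bool" where
  "non_trapping M k A g \<longleftrightarrow>
     (\<forall>I x. maximal_geodesic_on M A g I x \<and> \<not> x constant_on I \<longrightarrow>
        (\<exists>a b. I = {a..b} \<and> x a \<in> manifold_boundary k A \<and> x b \<in> manifold_boundary k A))"


section \<open>The Hamiltonian flow\<close>

definition hamiltonian ::
    "('a, 'n::finite) metric_tensor \<Rightarrow> ('a, 'n) chart \<Rightarrow> real ^ 'n \<Rightarrow> real ^ 'n \<Rightarrow> real" where
  "hamiltonian g c y p = p \<bullet> (inverse_metric g c (param c y) *v p)"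

definition hamiltonian_field ::
    "('a, 'n::finite) metric_tensor \<Rightarrow> ('a, 'n) chart \<Rightarrow> real ^ 'n \<Rightarrow> real ^ 'n \<Rightarrow>
      (real ^ 'n) \<times> (real ^ 'n)" where
  "hamiltonian_field g c y p =
     (\<chi> i. frechet_derivative (\<lambda>q. hamiltonian g c y q) (at p) (axis i 1),
      \<chi> i. - frechet_derivative (\<lambda>z. hamiltonian g c z p) (at y within snd c ` fst c) (axis i 1))"

definition hamiltonian_curve_on ::
    "'a topology \<Rightarrow> ('a, 'n::finite) chart set \<Rightarrow> ('a, 'n) metric_tensor \<Rightarrow>
      real set \<Rightarrow> (real \<Rightarrow> 'a \<times> ('a, 'n) covector) \<Rightarrow> bool" where
  "hamiltonian_curve_on M A g I \<gamma> \<longleftrightarrow>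
     is_interval I \<and> continuous_map (top_of_set I) M (fst \<circ> \<gamma>) \<and>
     (\<forall>t\<in>I. \<gamma> t \<in> cotangent_bundle M A) \<and>
     (\<forall>c\<in>A. \<forall>t\<in>I. fst (\<gamma> t) \<in> fst c \<longrightarrow>
        ((\<lambda>s. (snd c (fst (\<gamma> s)), snd (\<gamma> s) c)) has_vector_derivative
           hamiltonian_field g c (snd c (fst (\<gamma> t))) (snd (\<gamma> t) c)) (at t within I))"

text \<open>The speed does not depend on the chart chosen around the point.\<close>

definition curve_speed ::
    "('a, 'n::finite) chart set \<Rightarrow> ('a, 'n) metric_tensor \<Rightarrow> real set \<Rightarrow> (real \<Rightarrow> 'a) \<Rightarrow> real \<Rightarrow> real" where
  "curve_speed A g I x t =
     (let c = (SOME c. c \<in> A \<and> x t \<in> fst c);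
          v = vector_derivative (snd c \<circ> x) (at t within I)
      in sqrt (v \<bullet> (g c (x t) *v v)))"

definition curve_length ::
    "('a, 'n::finite) chart set \<Rightarrow> ('a, 'n) metric_tensor \<Rightarrow> real set \<Rightarrow> (real \<Rightarrow> 'a) \<Rightarrow> real" where
  "curve_length A g I x = integral I (curve_speed A g I x)"

text \<open>\<open>flows_to M A g p l q\<close>: following the Hamiltonian flow from \<open>p\<close> until the projected curve has
  length \<open>l\<close> leads to \<open>q\<close>. Negative \<open>l\<close> corresponds to following the flow backwards.\<close>

definition flows_to ::
    "'a topology \<Rightarrow> ('a, 'n::finite) chart set \<Rightarrow> ('a, 'n) metric_tensor \<Rightarrow>
      'a \<times> ('a, 'n) covector \<Rightarrow> real \<Rightarrow> 'a \<times> ('a, 'n) covector \<Rightarrow> bool" where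
  "flows_to M A g p l q \<longleftrightarrow>
     (\<exists>t \<gamma>. hamiltonian_curve_on M A g (closed_segment 0 t) \<gamma> \<and> \<gamma> 0 = p \<and> \<gamma> t = q \<and>
        l = sgn t * curve_length A g (closed_segment 0 t) (fst \<circ> \<gamma>))"

definition flow_domain ::
    "'a topology \<Rightarrow> ('a, 'n::finite) chart set \<Rightarrow> ('a, 'n) metric_tensor \<Rightarrow>
      'a \<times> ('a, 'n) covector \<Rightarrow> real set" where
  "flow_domain M A g p = {l. \<exists>q. flows_to M A g p l q}"

definition length_flow ::
    "'a topology \<Rightarrow> ('a, 'n::finite) chart set \<Rightarrow> ('a, 'n) metric_tensor \<Rightarrow>
      'a \<times> ('a, 'n) covector \<Rightarrow> real \<Rightarrow> 'a \<times> ('a, 'n) covector" where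
  "length_flow M A g p l = (THE q. flows_to M A g p l q)"

definition directional_collision_relation ::
    "'a topology \<Rightarrow> 'n \<Rightarrow> ('a, 'n::finite) chart set \<Rightarrow> ('a, 'n) metric_tensor \<Rightarrow>
      ('a, 'n) metric_tensor \<Rightarrow>
      ('a \<times> ('a, 'n) covector \<times> real \<times> 'a \<times> ('a, 'n) covector \<times> real) set" where
  "directional_collision_relation M k A gP gS = {(xP, \<xi>P, lP, xS, \<xi>S, lS).
     (xP, \<xi>P) \<in> boundary_cotangent_nonzero k A \<and> (xS, \<xi>S) \<in> boundary_cotangent_nonzero k A \<and>
     lP \<in> flow_domain M A gP (xP, \<xi>P) \<and> lS \<in> flow_domain M A gS (xS, \<xi>S) \<and>
     length_flow M A gP (xP, \<xi>P) lP = length_flow M A gS (xS, \<xi>S) lS}"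

end

theory Submission
  imports Defs
begin

text \<open>Let \<open>x\<close> be an interior point and \<open>\<xi>\<close> a nonzero covector at \<open>x\<close>. As both metrics are
  non-trapping, the \<open>g\<^sub>P\<close>- and the \<open>g\<^sub>S\<close>-geodesic with initial covector \<open>\<xi>\<close> reach the boundary, so
  \<open>(x, \<xi>)\<close> is the common value of the two flows for some element of the collision relation. That
  element also belongs to the relation of \<open>(g\<^sub>P, g\<^sub>S')\<close>; since \<open>g\<^sub>P\<close> is the same, the \<open>g\<^sub>S'\<close>-flow
  started at the same boundary covector \<open>(x\<^sub>S, \<xi>\<^sub>S)\<close> passes through \<open>(x, \<xi>)\<close> as well. Each
  Hamiltonian is conserved along its flow and the two agree at \<open>(x\<^sub>S, \<xi>\<^sub>S)\<close>, hence they agree at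
  \<open>(x, \<xi>)\<close>, and the quadratic form on the covectors determines the metric at \<open>x\<close>.

  The analytic content is that the flows exist up to the boundary and are functions: local existence
  and uniqueness for ordinary differential equations, the coordinate invariance of the geodesic
  equation, maximal extension of geodesics, and the lift \<open>\<xi> = g(v, \<cdot>) / 2\<close> of a geodesic to
  a Hamiltonian curve. Along a Hamiltonian curve the speed is \<open>2 \<surd>H\<close>, so the length determines
  the time.\<close>

section \<open>Local Lipschitz continuity\<close>

text \<open>The boundary shapes the analysis. Solutions are constructed only near interior points,
  where the image of a chart is open in the whole space; that they run up to the boundary is
  supplied by non-trapping, which makes the domain of a nonconstant maximal geodesic a closed
  interval with both ends on the boundary. Uniqueness must hold at boundary points as well, so
  derivatives are taken within relatively open subsets of a half-space, and Lipschitz bounds are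
  relative to such sets. Non-trapping speaks of geodesics and the relation of Hamiltonian curves, so
  a geodesic is constructed and then lifted. Its equation is demanded in every chart at once but
  solved in one; this is where second derivatives of the transition maps enter. Finally,
  \<open>length_flow\<close> is a definite description: only membership in
  \<open>flow_domain\<close> together with uniqueness turns an equation about its value into a curve
  that joins two covectors.\<close>

definition loc_lipschitz_on :: "'a::metric_space set \<Rightarrow> ('a \<Rightarrow> 'b::metric_space) \<Rightarrow> bool" where
  "loc_lipschitz_on S f \<longleftrightarrow> (\<forall>x\<in>S. \<exists>e>0. \<exists>L. L-lipschitz_on (ball x e \<inter> S) f)"

lemma loc_lipschitz_on_cong:
  assumes "loc_lipschitz_on S f" "\<And>x. x \<in> S \<Longrightarrow> f x = g x"
  shows "loc_lipschitz_on S g"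
proof -
  have "L-lipschitz_on (ball x e \<inter> S) f \<longleftrightarrow> L-lipschitz_on (ball x e \<inter> S) g" for L x e
    by (rule lipschitz_on_cong) (auto simp: assms(2))
  then show ?thesis using assms(1) by (simp add: loc_lipschitz_on_def)
qed

text \<open>Matches the definition of \<open>smooth_on\<close>, where a smooth extension exists only
  near each point.\<close>

lemma loc_lipschitz_on_local:
  assumes "\<And>x. x \<in> S \<Longrightarrow> \<exists>U. open U \<and> x \<in> U \<and> loc_lipschitz_on (U \<inter> S) f"
  shows "loc_lipschitz_on S f"
  unfolding loc_lipschitz_on_def
proof
  fix x assume x: "x \<in> S"
  then obtain U where U: "open U" "x \<in> U" "loc_lipschitz_on (U \<inter> S) f" using assms by blast
  then obtain e L where e: "e > 0" "L-lipschitz_on (ball x e \<inter> (U \<inter> S)) f"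
    using x unfolding loc_lipschitz_on_def by blast
  obtain r where r: "r > 0" "ball x r \<subseteq> U" using U open_contains_ball by blast
  have "L-lipschitz_on (ball x (min e r) \<inter> S) f"
    by (rule lipschitz_on_subset[OF e(2)]) (use r in auto)
  then show "\<exists>e>0. \<exists>L. L-lipschitz_on (ball x e \<inter> S) f" using e r by (metis min_less_iff_conj)
qed

named_theorems loc_lipschitz_intros

lemma loc_lipschitz_on_compose:
  assumes f: "loc_lipschitz_on S f" and g: "loc_lipschitz_on T g" and fS: "f ` S \<subseteq> T"
  shows "loc_lipschitz_on S (\<lambda>x. g (f x))"
  unfolding loc_lipschitz_on_def
proof
  fix x assume x: "x \<in> S"
  obtain e1 L1 where e1: "e1 > 0" and L1: "L1-lipschitz_on (ball x e1 \<inter> S) f"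
    using f x unfolding loc_lipschitz_on_def by blast
  obtain e2 L2 where e2: "e2 > 0" and L2: "L2-lipschitz_on (ball (f x) e2 \<inter> T) g"
    using g x fS unfolding loc_lipschitz_on_def by blast
  have L10: "L1 \<ge> 0" using L1 by (rule lipschitz_on_nonneg)
  \<comment> \<open>The second bound keeps the image of the ball inside
    \<open>ball (f x) e2\<close>; adding 1 to \<open>L1\<close> excludes a division by zero.\<close>
  define e where "e = min e1 (e2 / (L1 + 1))"
  have e: "e > 0" "e \<le> e1" using e1 e2 L10 by (auto simp: e_def)
  have "e \<le> e2 / (L1 + 1)" by (simp add: e_def)
  then have e': "e * (L1 + 1) \<le> e2" using L10 by (simp add: le_divide_eq)
  have img: "f ` (ball x e \<inter> S) \<subseteq> ball (f x) e2 \<inter> T"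
  proof clarify
    fix y assume y: "y \<in> ball x e" "y \<in> S"
    have "dist (f x) (f y) \<le> L1 * dist x y"
      using y e x by (intro lipschitz_onD[OF L1]) auto
    also have "\<dots> \<le> (L1 + 1) * dist x y" by (simp add: algebra_simps)
    also have "\<dots> < (L1 + 1) * e" using y L10 by (intro mult_strict_left_mono) auto
    also have "\<dots> \<le> e2" using e' by (simp add: mult.commute)
    finally show "f y \<in> ball (f x) e2 \<inter> T" using y fS by auto
  qed
  have "(L2 * L1)-lipschitz_on (ball x e \<inter> S) (\<lambda>x. g (f x))"
    using img e by (intro lipschitz_on_compose2 lipschitz_on_subset[OF L1] lipschitz_on_subset[OF L2]) auto
  then show "\<exists>e>0. \<exists>L. L-lipschitz_on (ball x e \<inter> S) (\<lambda>x. g (f x))"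
    using e by blast
qed

lemma loc_lipschitz_on_lipschitz: "L-lipschitz_on S f \<Longrightarrow> loc_lipschitz_on S f"
  unfolding loc_lipschitz_on_def
  by (meson Int_lower2 lipschitz_on_subset zero_less_one)

lemma loc_lipschitz_on_subset: "loc_lipschitz_on S f \<Longrightarrow> T \<subseteq> S \<Longrightarrow> loc_lipschitz_on T f"
  unfolding loc_lipschitz_on_def
  by (meson Int_mono equalityE lipschitz_on_subset subsetD)

lemma loc_lipschitz_on_bounded_linear: "bounded_linear f \<Longrightarrow> loc_lipschitz_on S f"
  by (metis bounded_linear.lipschitz_boundE loc_lipschitz_on_lipschitz)

lemma loc_lipschitz_on_const [loc_lipschitz_intros]: "loc_lipschitz_on S (\<lambda>x. c)"
  by (rule loc_lipschitz_on_lipschitz[OF lipschitz_on_constant])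

lemma loc_lipschitz_on_linear_compose:
  assumes "bounded_linear h" "loc_lipschitz_on S f"
  shows "loc_lipschitz_on S (\<lambda>x. h (f x))"
  using loc_lipschitz_on_compose[OF assms(2) loc_lipschitz_on_bounded_linear[OF assms(1), of UNIV]] by simp

lemma loc_lipschitz_on_Pair [loc_lipschitz_intros]:
  assumes f: "loc_lipschitz_on S f" and g: "loc_lipschitz_on S g"
  shows "loc_lipschitz_on S (\<lambda>x. (f x, g x))"
  unfolding loc_lipschitz_on_def
proof
  fix x assume x: "x \<in> S"
  obtain e1 L1 where e1: "e1 > 0" and L1: "L1-lipschitz_on (ball x e1 \<inter> S) f"
    using f x unfolding loc_lipschitz_on_def by blast
  obtain e2 L2 where e2: "e2 > 0" and L2: "L2-lipschitz_on (ball x e2 \<inter> S) g"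
    using g x unfolding loc_lipschitz_on_def by blast
  have "(sqrt (L1\<^sup>2 + L2\<^sup>2))-lipschitz_on (ball x (min e1 e2) \<inter> S) (\<lambda>x. (f x, g x))"
    by (intro lipschitz_on_Pair lipschitz_on_subset[OF L1] lipschitz_on_subset[OF L2]) auto
  then show "\<exists>e>0. \<exists>L. L-lipschitz_on (ball x e \<inter> S) (\<lambda>x. (f x, g x))"
    using e1 e2 by (metis min_less_iff_conj)
qed

lemma loc_lipschitz_on_add [loc_lipschitz_intros]:
  fixes f g :: "_ \<Rightarrow> 'b::real_normed_vector"
  assumes "loc_lipschitz_on S f" "loc_lipschitz_on S g"
  shows "loc_lipschitz_on S (\<lambda>x. f x + g x)"
  using loc_lipschitz_on_linear_compose[OF bounded_linear_add[OF bounded_linear_fst bounded_linear_snd]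
      loc_lipschitz_on_Pair[OF assms]] by simp

lemma loc_lipschitz_on_minus [loc_lipschitz_intros]:
  fixes f :: "_ \<Rightarrow> 'b::real_normed_vector"
  assumes "loc_lipschitz_on S f"
  shows "loc_lipschitz_on S (\<lambda>x. - f x)"
  using loc_lipschitz_on_linear_compose[OF bounded_linear_minus[OF bounded_linear_ident] assms] by simp

lemma loc_lipschitz_on_diff [loc_lipschitz_intros]:
  fixes f g :: "_ \<Rightarrow> 'b::real_normed_vector"
  assumes "loc_lipschitz_on S f" "loc_lipschitz_on S g"
  shows "loc_lipschitz_on S (\<lambda>x. f x - g x)"
  using loc_lipschitz_on_add[OF assms(1) loc_lipschitz_on_minus[OF assms(2)]] by simp

lemma loc_lipschitz_on_mult [loc_lipschitz_intros]:
  fixes f g :: "_ \<Rightarrow> real"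
  assumes "loc_lipschitz_on S f" "loc_lipschitz_on S g"
  shows "loc_lipschitz_on S (\<lambda>x. f x * g x)"
proof -
  have "loc_lipschitz_on UNIV (\<lambda>z::real \<times> real. fst z * snd z)"
    unfolding loc_lipschitz_on_def
  proof
    fix z :: "real \<times> real"
    \<comment> \<open>On the unit ball around \<open>z\<close> the factors are bounded by
      \<open>\<bar>fst z\<bar> + 1\<close> and \<open>\<bar>snd z\<bar> + 1\<close>; the constant is
      the sum of these bounds.\<close>
    have "(\<bar>fst z\<bar> + \<bar>snd z\<bar> + 2)-lipschitz_on (ball z 1 \<inter> UNIV) (\<lambda>z::real \<times> real. fst z * snd z)"
    proof (rule lipschitz_onI)
      fix u w assume u: "u \<in> ball z 1 \<inter> UNIV" and w: "w \<in> ball z 1 \<inter> UNIV"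
      have a: "\<bar>fst u\<bar> \<le> \<bar>fst z\<bar> + 1"
        using dist_fst_le[of z u] u by (auto simp: dist_real_def)
      have b: "\<bar>snd w\<bar> \<le> \<bar>snd z\<bar> + 1"
        using dist_snd_le[of z w] w by (auto simp: dist_real_def)
      have "fst u * snd u - fst w * snd w = fst u * (snd u - snd w) + snd w * (fst u - fst w)"
        by (simp add: algebra_simps)
      then have "dist (fst u * snd u) (fst w * snd w)
          \<le> \<bar>fst u\<bar> * dist (snd u) (snd w) + \<bar>snd w\<bar> * dist (fst u) (fst w)"
        using abs_triangle_ineq[of "fst u * (snd u - snd w)" "snd w * (fst u - fst w)"]
        by (simp add: dist_real_def abs_mult)
      also have "\<dots> \<le> (\<bar>fst z\<bar> + 1) * dist u w + (\<bar>snd z\<bar> + 1) * dist u w"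
        using a b by (intro add_mono mult_mono dist_fst_le dist_snd_le) auto
      finally show "dist (fst u * snd u) (fst w * snd w) \<le> (\<bar>fst z\<bar> + \<bar>snd z\<bar> + 2) * dist u w"
        by (simp add: algebra_simps)
    qed auto
    then show "\<exists>e>0. \<exists>L. L-lipschitz_on (ball z e \<inter> UNIV) (\<lambda>z::real \<times> real. fst z * snd z)"
      using zero_less_one by blast
  qed
  from loc_lipschitz_on_compose[OF loc_lipschitz_on_Pair[OF assms] this] show ?thesis by simp
qed

lemma loc_lipschitz_on_inverse:
  fixes f :: "_ \<Rightarrow> real"
  assumes "loc_lipschitz_on S f" and nz: "\<And>x. x \<in> S \<Longrightarrow> f x \<noteq> 0"
  shows "loc_lipschitz_on S (\<lambda>x. inverse (f x))"
proof -
  have "loc_lipschitz_on (- {0}) (inverse :: real \<Rightarrow> real)"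
    unfolding loc_lipschitz_on_def
  proof
    fix a :: real assume "a \<in> - {0}"
    then have a: "\<bar>a\<bar> > 0" by auto
    \<comment> \<open>Within distance |a|/2 of a both arguments have modulus at least |a|/2, and 1/x
      - 1/y = (y - x)/(xy).\<close>
    have "(4 / a\<^sup>2)-lipschitz_on (ball a (\<bar>a\<bar>/2) \<inter> - {0}) inverse"
    proof (rule lipschitz_onI)
      fix x y assume x: "x \<in> ball a (\<bar>a\<bar>/2) \<inter> - {0}" and y: "y \<in> ball a (\<bar>a\<bar>/2) \<inter> - {0}"
      have xa: "\<bar>a\<bar>/2 \<le> \<bar>x\<bar>" and ya: "\<bar>a\<bar>/2 \<le> \<bar>y\<bar>" using x y unfolding Int_iff mem_ball dist_real_def by linarith+
      have xy: "(\<bar>a\<bar>/2) * (\<bar>a\<bar>/2) \<le> \<bar>x\<bar> * \<bar>y\<bar>" using xa ya by (intro mult_mono) auto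
      have "inverse x - inverse y = (y - x) / (x * y)" using x y by (simp add: field_simps)
      then have "dist (inverse x) (inverse y) = dist x y / (\<bar>x\<bar> * \<bar>y\<bar>)"
        by (simp add: dist_real_def abs_mult abs_minus_commute)
      also have "\<dots> \<le> dist x y / ((\<bar>a\<bar>/2) * (\<bar>a\<bar>/2))"
        using a xy by (intro divide_left_mono mult_pos_pos less_le_trans[OF _ xy]) simp_all
      also have "\<dots> = 4 / a\<^sup>2 * dist x y" by (simp add: power2_eq_square field_simps)
      finally show "dist (inverse x) (inverse y) \<le> 4 / a\<^sup>2 * dist x y" .
    qed auto
    then show "\<exists>e>0. \<exists>L. L-lipschitz_on (ball a e \<inter> - {0}) inverse" using a half_gt_zero by blast
  qed
  from loc_lipschitz_on_compose[OF assms(1) this] nz show ?thesis by force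
qed

lemma loc_lipschitz_on_sum [loc_lipschitz_intros]:
  fixes f :: "_ \<Rightarrow> _ \<Rightarrow> 'b::real_normed_vector"
  assumes "\<And>i. i \<in> I \<Longrightarrow> loc_lipschitz_on S (f i)"
  shows "loc_lipschitz_on S (\<lambda>x. \<Sum>i\<in>I. f i x)"
  using assms by (induction I rule: infinite_finite_induct) (auto intro: loc_lipschitz_intros)

lemma loc_lipschitz_on_prod [loc_lipschitz_intros]:
  fixes f :: "_ \<Rightarrow> _ \<Rightarrow> real"
  assumes "\<And>i. i \<in> I \<Longrightarrow> loc_lipschitz_on S (f i)"
  shows "loc_lipschitz_on S (\<lambda>x. \<Prod>i\<in>I. f i x)"
  using assms by (induction I rule: infinite_finite_induct) (auto intro: loc_lipschitz_intros)

lemma loc_lipschitz_on_nth [loc_lipschitz_intros]: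
  fixes f :: "_ \<Rightarrow> 'b::real_normed_vector ^ 'n::finite"
  shows "loc_lipschitz_on S f \<Longrightarrow> loc_lipschitz_on S (\<lambda>x. f x $ i)"
  by (rule loc_lipschitz_on_linear_compose[OF bounded_linear_vec_nth])

lemma loc_lipschitz_on_vec_lambda [loc_lipschitz_intros]:
  fixes f :: "'n::finite \<Rightarrow> _ \<Rightarrow> real"
  assumes "\<And>i. loc_lipschitz_on S (f i)"
  shows "loc_lipschitz_on S (\<lambda>x. \<chi> i. f i x)"
proof -
  have "loc_lipschitz_on S (\<lambda>x. \<Sum>i\<in>UNIV. f i x *\<^sub>R (axis i 1 :: real^'n))"
    using assms by (intro loc_lipschitz_on_sum
        loc_lipschitz_on_linear_compose[OF bounded_linear_scaleR_left])
  moreover have "(\<Sum>i\<in>UNIV. f i x *\<^sub>R (axis i 1 :: real^'n)) = (\<chi> i. f i x)" for x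
    by (simp add: vec_eq_iff axis_def if_distrib cong: if_cong)
  ultimately show ?thesis by simp
qed

lemma loc_lipschitz_on_fst: "loc_lipschitz_on S f \<Longrightarrow> loc_lipschitz_on (S \<times> T) (\<lambda>z. f (fst z))"
  by (rule loc_lipschitz_on_compose[where f=fst and T=S])
     (auto intro!: loc_lipschitz_on_lipschitz[of 1] lipschitz_onI simp: dist_Pair_Pair)

lemma loc_lipschitz_on_snd: "loc_lipschitz_on S (snd :: 'b::real_normed_vector \<times> 'c::real_normed_vector \<Rightarrow> 'c)"
  by (rule loc_lipschitz_on_bounded_linear[OF bounded_linear_snd])

lemma loc_lipschitz_on_det:
  fixes B :: "_ \<Rightarrow> real ^ 'n ^ 'n::finite"
  assumes "\<And>i j. loc_lipschitz_on S (\<lambda>x. B x $ i $ j)"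
  shows "loc_lipschitz_on S (\<lambda>x. det (B x))"
  unfolding det_def by (intro loc_lipschitz_intros assms)

text \<open>\<open>C_k_on\<close> gives continuity of the derivative one direction at a time;
  finitely many directions suffice to control its operator norm.\<close>

lemma onorm_le_sum_Basis:
  fixes f :: "'a::euclidean_space \<Rightarrow> 'b::real_normed_vector"
  assumes "bounded_linear f"
  shows "onorm f \<le> (\<Sum>b\<in>Basis. norm (f b))"
proof (rule onorm_bound)
  fix x
  interpret bounded_linear f by fact
  have "f x = f (\<Sum>b\<in>Basis. (x \<bullet> b) *\<^sub>R b)" by (simp add: euclidean_representation)
  also have "\<dots> = (\<Sum>b\<in>Basis. (x \<bullet> b) *\<^sub>R f b)" by (simp add: sum scale)
  finally have "norm (f x) \<le> (\<Sum>b\<in>Basis. \<bar>x \<bullet> b\<bar> * norm (f b))"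
    by (metis (no_types, lifting) norm_scaleR norm_sum sum.cong)
  also have "\<dots> \<le> (\<Sum>b\<in>Basis. norm x * norm (f b))"
    by (intro sum_mono mult_right_mono) (auto intro: Basis_le_norm)
  finally show "norm (f x) \<le> (\<Sum>b\<in>Basis. norm (f b)) * norm x"
    by (simp add: sum_distrib_left mult.commute)
qed (auto intro: sum_nonneg)

text \<open>On a compact ball the derivative is bounded in each basis direction, hence in operator
  norm, and the ball is convex, so the mean value inequality applies.\<close>

lemma C_1_imp_loc_lipschitz_on:
  fixes f :: "'a::euclidean_space \<Rightarrow> 'b::real_normed_vector"
  assumes U: "open U" and f: "C_k_on (Suc 0) U f"
  shows "loc_lipschitz_on U f"
  unfolding loc_lipschitz_on_def
proof
  fix x assume x: "x \<in> U"
  obtain f' where f': "\<And>x. x \<in> U \<Longrightarrow> (f has_derivative f' x) (at x)"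
    and c: "\<And>v. continuous_on U (\<lambda>x. f' x v)" using f by auto
  obtain e where e: "e > 0" "cball x e \<subseteq> U" using U x open_contains_cball by blast
  have "\<exists>B. \<forall>y\<in>cball x e. norm (f' y b) \<le> B" for b
  proof -
    have "compact ((\<lambda>y. f' y b) ` cball x e)"
      by (intro compact_continuous_image continuous_on_subset[OF c e(2)]) auto
    then show ?thesis using compact_imp_bounded by (fastforce simp: bounded_iff)
  qed
  then obtain B where B: "\<And>b y. y \<in> cball x e \<Longrightarrow> norm (f' y b) \<le> B b" by metis
  have "(max 0 (\<Sum>b\<in>Basis. B b))-lipschitz_on (cball x e) f"
  proof (rule bounded_derivative_imp_lipschitz)
    fix y assume y: "y \<in> cball x e"
    show "(f has_derivative f' y) (at y within cball x e)"
      using y e by (intro has_derivative_at_withinI[OF f']) auto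
    have "onorm (f' y) \<le> (\<Sum>b\<in>Basis. norm (f' y b))"
      using f'[of y] y e by (intro onorm_le_sum_Basis has_derivative_bounded_linear) auto
    also have "\<dots> \<le> (\<Sum>b\<in>Basis. B b)" using B y by (intro sum_mono) auto
    finally show "onorm (f' y) \<le> max 0 (\<Sum>b\<in>Basis. B b)" by simp
  qed auto
  then have "(max 0 (\<Sum>b\<in>Basis. B b))-lipschitz_on (ball x e \<inter> U) f"
    by (rule lipschitz_on_subset) auto
  then show "\<exists>e>0. \<exists>L. L-lipschitz_on (ball x e \<inter> U) f" using e by blast
qed

section \<open>Ordinary differential equations\<close>

text \<open>Banach's fixed point theorem for the integral operator, on bounded continuous functions
  over the whole real line. Two devices make the operator total: the field is precomposed with the
  nearest-point projection \<open>P\<close> onto a closed ball, and time is clamped to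
  \<open>{0..h}\<close> by \<open>cl\<close>. The fixed point never leaves the ball, so both devices
  disappear from the equation it satisfies on \<open>{0..h}\<close>.\<close>

theorem picard_local_existence:
  fixes F :: "'a::euclidean_space \<Rightarrow> 'a"
  assumes "open W" "z0 \<in> W" "loc_lipschitz_on W F"
  obtains h z where "h > 0" "z 0 = z0"
    "\<And>t. t \<in> {0..h} \<Longrightarrow> z t \<in> W \<and> (z has_vector_derivative F (z t)) (at t within {0..h})"
proof -
  obtain e L where e: "e > 0" and L: "L-lipschitz_on (ball z0 e \<inter> W) F"
    using assms unfolding loc_lipschitz_on_def by blast
  have "open (ball z0 e \<inter> W)" using assms by auto
  then obtain r where r: "r > 0" "cball z0 r \<subseteq> ball z0 e \<inter> W"
    using assms e by (metis Int_iff centre_in_ball open_contains_cball)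
  let ?K = "cball z0 r"
  have K: "convex ?K" "closed ?K" "?K \<noteq> {}" using r by auto
  have LK: "L-lipschitz_on ?K F" using L r(2) lipschitz_on_subset by blast
  have L0: "L \<ge> 0" using LK lipschitz_on_nonneg by blast
  have "compact (F ` ?K)" 
    by (intro compact_continuous_image lipschitz_on_continuous_on[OF LK]) auto
  then obtain B where B: "\<And>z. z \<in> ?K \<Longrightarrow> norm (F z) \<le> B"
    using compact_imp_bounded by (fastforce simp: bounded_iff)
  have B0: "B \<ge> 0" using B[of z0] r by (meson centre_in_cball less_imp_le norm_ge_zero order_trans)
  define P where "P = closest_point ?K"
  have PK: "P z \<in> ?K" for z unfolding P_def using K by (intro closest_point_in_set)
  have Pid: "P z = z" if "z \<in> ?K" for z unfolding P_def using that by (rule closest_point_self)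
  have F': "dist (F (P a)) (F (P b)) \<le> L * dist a b" for a b
  proof -
    have "dist (F (P a)) (F (P b)) \<le> L * dist (P a) (P b)" using PK by (intro lipschitz_onD[OF LK])
    also have "\<dots> \<le> L * dist a b" unfolding P_def
      using L0 K by (intro mult_left_mono closest_point_lipschitz)
    finally show ?thesis .
  qed
  have contF: "continuous_on UNIV (\<lambda>z. F (P z))"
    using F' L0 by (intro lipschitz_on_continuous_on[of L] lipschitz_onI) auto
  \<comment> \<open>The first bound keeps a path of speed at most \<open>B\<close> inside the ball
    of radius \<open>r\<close>, the second makes the operator a contraction with factor 1/2.\<close>
  define h where "h = min (r / (B + 1)) (1 / (2 * (L + 1)))"
  have h: "h > 0" "B * h \<le> r" "L * h \<le> 1/2"
  proof -
    show "h > 0" using r B0 L0 by (auto simp: h_def)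
    have "B * h \<le> B * (r / (B + 1))" using B0 by (intro mult_left_mono) (auto simp: h_def)
    also have "\<dots> \<le> r" using B0 r by (auto simp: field_simps)
    finally show "B * h \<le> r" .
    have "L * h \<le> L * (1 / (2 * (L + 1)))" using L0 by (intro mult_left_mono) (auto simp: h_def)
    also have "\<dots> \<le> 1/2" using L0 by (auto simp: field_simps)
    finally show "L * h \<le> 1/2" .
  qed
  define cl where "cl t = max 0 (min h t)" for t
  have cl: "cl t \<in> {0..h}" for t using h by (auto simp: cl_def)
  have clid: "cl t = t" if "t \<in> {0..h}" for t using that by (auto simp: cl_def)
  have cont_comp: "continuous_on X (\<lambda>s. F (P (apply_bcontfun \<phi> s)))" for \<phi> :: "real \<Rightarrow>\<^sub>C 'a" and X
    by (rule continuous_on_compose2[OF contF]) auto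
  define T where "T \<phi> t = z0 + integral {0..cl t} (\<lambda>s. F (P (apply_bcontfun \<phi> s)))" for \<phi> t
  have bnd: "norm (integral {0..cl t} (\<lambda>s. F (P (apply_bcontfun \<phi> s)))) \<le> B * h" for \<phi> t
  proof -
    have "norm (integral {0..cl t} (\<lambda>s. F (P (apply_bcontfun \<phi> s)))) \<le> B * (cl t - 0)"
      using cl[of t] B PK by (intro integral_bound cont_comp) auto
    also have "\<dots> \<le> B * h" using B0 cl[of t] by (intro mult_left_mono) auto
    finally show ?thesis .
  qed
  have Tb: "T \<phi> \<in> bcontfun" for \<phi>
  proof (rule bcontfun_normI)
    have "continuous_on {0..h} (\<lambda>x. integral {0..x} (\<lambda>s. F (P (apply_bcontfun \<phi> s))))"
      by (intro indefinite_integral_continuous_1 integrable_continuous_real cont_comp)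
    then have "continuous_on UNIV (\<lambda>t. integral {0..cl t} (\<lambda>s. F (P (apply_bcontfun \<phi> s))))"
      by (rule continuous_on_compose2) (use cl in \<open>auto simp: cl_def intro!: continuous_intros\<close>)
    then show "continuous_on UNIV (T \<phi>)" unfolding T_def by (intro continuous_intros)
    show "norm (T \<phi> t) \<le> norm z0 + B * h" for t
      unfolding T_def using bnd[where \<phi>=\<phi> and t=t] norm_triangle_le add_left_mono by blast
  qed
  have Tapp: "apply_bcontfun (Bcontfun (T \<phi>)) = T \<phi>" for \<phi>
    by (rule Bcontfun_inverse[OF Tb])
  have "\<exists>!\<phi>. Bcontfun (T \<phi>) = \<phi>"
  proof (rule banach_fix_type[of "1/2"]; (intro allI)?)
    fix \<phi> \<psi> :: "real \<Rightarrow>\<^sub>C 'a"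
    show "dist (Bcontfun (T \<phi>)) (Bcontfun (T \<psi>)) \<le> 1/2 * dist \<phi> \<psi>"
    proof (rule dist_bound)
      fix t
      have "dist (T \<phi> t) (T \<psi> t) = norm (integral {0..cl t} (\<lambda>s. F (P (apply_bcontfun \<phi> s)))
          - integral {0..cl t} (\<lambda>s. F (P (apply_bcontfun \<psi> s))))"
        by (simp add: T_def dist_norm)
      also have "\<dots> = norm (integral {0..cl t} (\<lambda>s. F (P (apply_bcontfun \<phi> s)) - F (P (apply_bcontfun \<psi> s))))"
        by (subst Henstock_Kurzweil_Integration.integral_diff)
           (auto intro!: integrable_continuous_real cont_comp)
      also have "\<dots> \<le> (L * dist \<phi> \<psi>) * (cl t - 0)"
      proof (rule integral_bound)
        fix s
        have "norm (F (P (apply_bcontfun \<phi> s)) - F (P (apply_bcontfun \<psi> s)))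
            \<le> L * dist (apply_bcontfun \<phi> s) (apply_bcontfun \<psi> s)"
          using F' by (simp add: dist_norm)
        also have "\<dots> \<le> L * dist \<phi> \<psi>" using L0 by (intro mult_left_mono dist_bounded)
        finally show "norm (F (P (apply_bcontfun \<phi> s)) - F (P (apply_bcontfun \<psi> s))) \<le> L * dist \<phi> \<psi>" .
      qed (use cl[of t] in \<open>auto intro!: continuous_intros cont_comp\<close>)
      also have "\<dots> \<le> (L * dist \<phi> \<psi>) * h" using L0 cl[of t] by (intro mult_left_mono) auto
      also have "\<dots> = (L * h) * dist \<phi> \<psi>" by simp
      also have "\<dots> \<le> 1/2 * dist \<phi> \<psi>" using h by (intro mult_right_mono) auto
      finally show "dist (apply_bcontfun (Bcontfun (T \<phi>)) t) (apply_bcontfun (Bcontfun (T \<psi>)) t)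
          \<le> 1/2 * dist \<phi> \<psi>" by (simp add: Tapp)
    qed
  qed auto
  then obtain \<phi> where "Bcontfun (T \<phi>) = \<phi>" by blast
  then have fix\<phi>: "apply_bcontfun \<phi> = T \<phi>" using Tapp by metis
  have inK: "T \<phi> t \<in> ?K" for t
    using bnd[where \<phi>=\<phi> and t=t] h(2) by (auto simp: T_def dist_norm)
  show ?thesis
  proof (rule that[of h "T \<phi>"])
    show "T \<phi> 0 = z0" using h by (simp add: T_def cl_def)
    fix t assume t: "t \<in> {0..h}"
    have "((\<lambda>u. z0 + integral {0..u} (\<lambda>s. F (P (apply_bcontfun \<phi> s)))) has_vector_derivative
        0 + F (P (apply_bcontfun \<phi> t))) (at t within {0..h})"
      by (intro has_vector_derivative_add integral_has_vector_derivative t cont_comp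
          has_vector_derivative_const)
    then have "(T \<phi> has_vector_derivative F (P (apply_bcontfun \<phi> t))) (at t within {0..h})"
      using t by (subst has_vector_derivative_cong_ev[where g="\<lambda>u. z0 + integral {0..u} (\<lambda>s. F (P (apply_bcontfun \<phi> s)))"])
        (auto simp: T_def clid)
    then show "T \<phi> t \<in> W \<and> (T \<phi> has_vector_derivative F (T \<phi> t)) (at t within {0..h})"
      using inK[of t] r(2) Pid[OF inK] by (auto simp: fix\<phi>)
  qed (use h in auto)
qed

text \<open>The set \<open>S\<close> need not be open and \<open>s0\<close> may be an endpoint of
  \<open>I\<close>, so this applies to curves that start on the boundary. On a short segment the
  difference of the solutions attains its largest norm, and the mean value inequality bounds that
  maximum by a proper fraction of itself.\<close>

lemma ode_local_uniqueness:
  fixes F :: "'a::real_normed_vector \<Rightarrow> 'a"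
  assumes I: "is_interval I" "s0 \<in> I" and F: "loc_lipschitz_on S F"
    and z1: "\<forall>\<^sub>F s in at s0 within I. z1 s \<in> S \<and> (z1 has_vector_derivative F (z1 s)) (at s within I)"
    and z2: "\<forall>\<^sub>F s in at s0 within I. z2 s \<in> S \<and> (z2 has_vector_derivative F (z2 s)) (at s within I)"
    and z10: "z1 s0 \<in> S" "(z1 has_vector_derivative F (z1 s0)) (at s0 within I)"
    and z20: "(z2 has_vector_derivative F (z2 s0)) (at s0 within I)"
    and eq: "z1 s0 = z2 s0"
  shows "\<forall>\<^sub>F s in at s0 within I. z1 s = z2 s"
proof -
  obtain e L where e: "e > 0" and L: "L-lipschitz_on (ball (z1 s0) e \<inter> S) F"
    using F z10 unfolding loc_lipschitz_on_def by blast
  have L0: "L \<ge> 0" using L lipschitz_on_nonneg by blast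
  have "(z1 \<longlongrightarrow> z1 s0) (at s0 within I)" "(z2 \<longlongrightarrow> z1 s0) (at s0 within I)"
    using has_vector_derivative_continuous[OF z10(2)] has_vector_derivative_continuous[OF z20] eq
    by (auto simp: continuous_within)
  then have "\<forall>\<^sub>F s in at s0 within I. dist (z1 s) (z1 s0) < e" "\<forall>\<^sub>F s in at s0 within I. dist (z2 s) (z1 s0) < e"
    using e by (auto simp: tendsto_iff)
  with z1 z2 have "\<forall>\<^sub>F s in at s0 within I.
     z1 s \<in> ball (z1 s0) e \<inter> S \<and> (z1 has_vector_derivative F (z1 s)) (at s within I) \<and>
     z2 s \<in> ball (z1 s0) e \<inter> S \<and> (z2 has_vector_derivative F (z2 s)) (at s within I)"
    by eventually_elim (auto simp: dist_commute)
  then obtain d where d: "d > 0" and D0: "\<And>s. s \<in> I \<Longrightarrow> s \<noteq> s0 \<Longrightarrow> dist s s0 < d \<Longrightarrow>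
     z1 s \<in> ball (z1 s0) e \<inter> S \<and> (z1 has_vector_derivative F (z1 s)) (at s within I) \<and>
     z2 s \<in> ball (z1 s0) e \<inter> S \<and> (z2 has_vector_derivative F (z2 s)) (at s within I)"
    unfolding eventually_at by blast
  \<comment> \<open>The filter \<open>at s0 within I\<close> omits \<open>s0\<close>; there the
    facts come from the separate hypotheses.\<close>
  have D: "z1 s \<in> ball (z1 s0) e \<inter> S \<and> (z1 has_vector_derivative F (z1 s)) (at s within I) \<and>
     z2 s \<in> ball (z1 s0) e \<inter> S \<and> (z2 has_vector_derivative F (z2 s)) (at s within I)"
    if "s \<in> I" "dist s s0 < d" for s
    using D0[OF that(1) _ that(2)] z10 z20 eq e by (cases "s = s0") auto
  \<comment> \<open>The second bound yields \<open>L * \<epsilon> < 1\<close>, the fraction that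
    forces the maximum of the difference to vanish.\<close>
  define \<epsilon> where "\<epsilon> = min d (1 / (L + 1))"
  have \<epsilon>: "\<epsilon> > 0" "\<epsilon> \<le> d" "L * \<epsilon> < 1"
  proof -
    show "\<epsilon> > 0" using d L0 by (auto simp: \<epsilon>_def)
    have "L * \<epsilon> \<le> L * (1 / (L + 1))" using L0 by (intro mult_left_mono) (auto simp: \<epsilon>_def)
    also have "\<dots> < 1" using L0 by (auto simp: field_simps)
    finally show "L * \<epsilon> < 1" .
  qed (simp add: \<epsilon>_def)
  have "z1 s = z2 s" if s: "s \<in> I" "dist s s0 < \<epsilon>" for s
  proof -
    let ?K = "closed_segment s0 s"
    have KI: "?K \<subseteq> I" using I s by (simp add: closed_segment_subset is_interval_convex)
    have Kd: "dist r s0 < \<epsilon>" if "r \<in> ?K" for r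
      using segment_bound(1)[OF that] s(2) by (simp add: dist_norm norm_minus_commute)
    note DK = D[OF subsetD[OF KI] less_le_trans[OF Kd \<epsilon>(2)]]
    let ?w = "\<lambda>r. z1 r - z2 r"
    have der: "(?w has_vector_derivative (F (z1 r) - F (z2 r))) (at r within ?K)" if "r \<in> ?K" for r
      using DK[OF that that] KI by (intro has_vector_derivative_diff) (auto intro: has_vector_derivative_within_subset)
    have "continuous_on ?K (\<lambda>r. norm (?w r))"
      using der by (intro continuous_on_norm) (auto simp: continuous_on_eq_continuous_within intro: has_vector_derivative_continuous)
    then obtain m where m: "m \<in> ?K" "\<And>r. r \<in> ?K \<Longrightarrow> norm (?w r) \<le> norm (?w m)"
      using continuous_attains_sup[of ?K "\<lambda>r. norm (?w r)"] by auto
    have "norm (?w m - ?w s0) \<le> (L * norm (?w m)) * norm (m - s0)"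
    proof (rule differentiable_bound[where S = "?K" and f' = "\<lambda>r x. x *\<^sub>R (F (z1 r) - F (z2 r))"])
      fix r assume r: "r \<in> ?K"
      show "(?w has_derivative (\<lambda>x. x *\<^sub>R (F (z1 r) - F (z2 r)))) (at r within ?K)"
        using der[OF r] by (simp add: has_vector_derivative_def)
      show "onorm (\<lambda>x. x *\<^sub>R (F (z1 r) - F (z2 r))) \<le> L * norm (?w m)"
      proof (rule onorm_bound)
        fix x :: real
        have "norm (F (z1 r) - F (z2 r)) \<le> L * norm (z1 r - z2 r)"
          using DK[OF r r] lipschitz_onD(1)[OF L] by (auto simp: dist_norm)
        also have "\<dots> \<le> L * norm (?w m)" using m r L0 by (intro mult_left_mono) auto
        finally show "norm (x *\<^sub>R (F (z1 r) - F (z2 r))) \<le> L * norm (?w m) * norm x"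
          by (simp add: mult.commute mult_left_mono)
      qed (use L0 in auto)
    qed (use m in auto)
    also have "\<dots> \<le> (L * norm (?w m)) * \<epsilon>"
      using Kd[OF m(1)] L0 by (intro mult_left_mono) (auto simp: dist_norm)
    finally have "norm (?w m) \<le> (L * \<epsilon>) * norm (?w m)" using eq by (simp add: mult_ac)
    then have "(1 - L * \<epsilon>) * norm (?w m) \<le> 0" by (simp add: algebra_simps)
    then have "norm (?w m) \<le> 0" using \<epsilon>(3) by (simp add: mult_le_0_iff)
    then have "norm (?w s) \<le> 0" using m(2)[of s] by (meson ends_in_segment(2) order_trans)
    then show ?thesis by simp
  qed
  then show ?thesis using \<epsilon> unfolding eventually_at by blast
qed

section \<open>Symmetry of second derivatives\<close>

text \<open>The mean value theorem is applied twice: to the increment in direction \<open>w\<close>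
  as a function of the step along \<open>v\<close>, then to the derivative \<open>d\<close> in
  direction \<open>v\<close> along \<open>w\<close>.\<close>

lemma second_difference_mean_value:
  fixes \<phi> :: "'a::real_normed_vector \<Rightarrow> real"
  assumes h: "h > 0"
    and B: "\<And>s t. s \<in> {0..h} \<Longrightarrow> t \<in> {0..h} \<Longrightarrow> x + s *\<^sub>R v + t *\<^sub>R w \<in> U"
    and d1: "\<And>x. x \<in> U \<Longrightarrow> (\<phi> has_derivative d x) (at x)"
    and d2: "\<And>x. x \<in> U \<Longrightarrow> ((\<lambda>x. d x v) has_derivative D x) (at x)"
  obtains s t where "s \<in> {0..h}" "t \<in> {0..h}"
    "\<phi> (x + h *\<^sub>R v + h *\<^sub>R w) - \<phi> (x + h *\<^sub>R v) - \<phi> (x + h *\<^sub>R w) + \<phi> x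
       = h * h * D (x + s *\<^sub>R v + t *\<^sub>R w) w"
proof -
  have chain: "((\<lambda>s. f (a + s *\<^sub>R u)) has_real_derivative f' u) (at s)"
    if "(f has_derivative f') (at (a + s *\<^sub>R u))" for f :: "'a \<Rightarrow> real" and f' a s u
  proof -
    have "((\<lambda>s. f (a + s *\<^sub>R u)) has_derivative (\<lambda>t. f' (t *\<^sub>R u))) (at s)"
      by (rule has_derivative_compose[where f="\<lambda>s. a + s *\<^sub>R u", OF _ that])
         (auto intro!: derivative_eq_intros)
    moreover have "(\<lambda>t. f' (t *\<^sub>R u)) = (*) (f' u)"
      using has_derivative_linear[OF that] by (auto simp: linear_scale)
    ultimately show ?thesis by (simp add: has_field_derivative_def)
  qed
  let ?p = "\<lambda>s. \<phi> ((x + h *\<^sub>R w) + s *\<^sub>R v) - \<phi> (x + s *\<^sub>R v)"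
  have "\<exists>z>0. z < h \<and> ?p h - ?p 0 = (h - 0) * (d ((x + h *\<^sub>R w) + z *\<^sub>R v) v - d (x + z *\<^sub>R v) v)"
  proof (rule MVT2[OF h])
    fix s assume s: "0 \<le> s" "s \<le> h"
    show "(?p has_real_derivative d ((x + h *\<^sub>R w) + s *\<^sub>R v) v - d (x + s *\<^sub>R v) v) (at s)"
      using B[of s h] B[of s 0] s h
      by (intro DERIV_diff chain d1) (auto simp: algebra_simps)
  qed
  then obtain s where s: "0 < s" "s < h"
    "?p h - ?p 0 = h * (d ((x + h *\<^sub>R w) + s *\<^sub>R v) v - d (x + s *\<^sub>R v) v)" by auto
  let ?q = "\<lambda>t. d ((x + s *\<^sub>R v) + t *\<^sub>R w) v"
  have "\<exists>z>0. z < h \<and> ?q h - ?q 0 = (h - 0) * D ((x + s *\<^sub>R v) + z *\<^sub>R w) w"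
  proof (rule MVT2[OF h])
    fix t assume t: "0 \<le> t" "t \<le> h"
    show "(?q has_real_derivative D ((x + s *\<^sub>R v) + t *\<^sub>R w) w) (at t)"
      using B[of s t] s t by (intro chain d2) auto
  qed
  then obtain t where t: "0 < t" "t < h" "?q h - ?q 0 = h * D (x + s *\<^sub>R v + t *\<^sub>R w) w" by auto
  show ?thesis
    by (rule that[of s t]) (use s t in \<open>auto simp: algebra_simps\<close>)
qed

text \<open>Schwarz's theorem. The second difference is symmetric in \<open>v\<close> and
  \<open>w\<close>, so the two mixed derivatives agree at two points of an arbitrarily small
  parallelogram, and continuity carries this to \<open>x\<close>. Continuity is assumed for fixed
  directions, as \<open>C_k_on\<close> provides it.\<close>

lemma symmetric_second_derivative_real:
  fixes \<phi> :: "'a::real_normed_vector \<Rightarrow> real"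
  assumes U: "open U" "x \<in> U"
    and d1: "\<And>x. x \<in> U \<Longrightarrow> (\<phi> has_derivative d x) (at x)"
    and d2: "\<And>x v. x \<in> U \<Longrightarrow> ((\<lambda>x. d x v) has_derivative D v x) (at x)"
    and c: "\<And>v w. continuous_on U (\<lambda>x. D v x w)"
  shows "D v x w = D w x v"
proof (rule ccontr)
  assume neq: "D v x w \<noteq> D w x v"
  define \<epsilon> where "\<epsilon> = \<bar>D v x w - D w x v\<bar> / 2"
  have \<epsilon>: "\<epsilon> > 0" using neq by (simp add: \<epsilon>_def)
  obtain r where r: "r > 0" "ball x r \<subseteq> U" using U open_contains_ball by blast
  have "isCont (\<lambda>x. D v x w) x" "isCont (\<lambda>x. D w x v) x"
    using c U by (auto simp: continuous_on_eq_continuous_at)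
  then obtain d1' d2' where d': "d1' > 0" "d2' > 0"
    "\<And>y. dist y x < d1' \<Longrightarrow> dist (D v y w) (D v x w) < \<epsilon>"
    "\<And>y. dist y x < d2' \<Longrightarrow> dist (D w y v) (D w x v) < \<epsilon>"
    unfolding continuous_at_eps_delta using \<epsilon> by metis
  define \<delta> where "\<delta> = min r (min d1' d2')"
  have \<delta>: "\<delta> > 0" "\<delta> \<le> r" "\<delta> \<le> d1'" "\<delta> \<le> d2'" using r d' by (auto simp: \<delta>_def)
  \<comment> \<open>With this side length every point of the parallelogram spanned by
    \<open>h\<close> times \<open>v\<close> and \<open>w\<close> is closer than
    \<open>\<delta>\<close> to \<open>x\<close>.\<close>
  define h where "h = \<delta> / (norm v + norm w + 1)"
  have np: "norm v + norm w + 1 > 0" by (simp add: add_nonneg_pos)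
  have h: "h > 0" using \<delta> np by (simp add: h_def)
  have near: "dist (x + s *\<^sub>R v + t *\<^sub>R w) x < \<delta>" if "s \<in> {0..h}" "t \<in> {0..h}" for s t
  proof -
    have "dist (x + s *\<^sub>R v + t *\<^sub>R w) x = norm (s *\<^sub>R v + t *\<^sub>R w)" by (simp add: dist_norm)
    also have "\<dots> \<le> s * norm v + t * norm w"
      using that norm_triangle_ineq[of "s *\<^sub>R v" "t *\<^sub>R w"] by auto
    also have "\<dots> \<le> h * norm v + h * norm w" using that by (intro add_mono mult_right_mono) auto
    also have "\<dots> < h * (norm v + norm w + 1)" using h by (simp add: algebra_simps)
    also have "\<dots> = \<delta>" using np by (simp add: h_def)
    finally show ?thesis .
  qed
  have inU: "x + s *\<^sub>R v + t *\<^sub>R w \<in> U" if "s \<in> {0..h}" "t \<in> {0..h}" for s t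
    using near[OF that] \<delta> r by (auto simp: dist_commute subset_iff)
  obtain s t where st: "s \<in> {0..h}" "t \<in> {0..h}"
    "\<phi> (x + h *\<^sub>R v + h *\<^sub>R w) - \<phi> (x + h *\<^sub>R v) - \<phi> (x + h *\<^sub>R w) + \<phi> x
       = h * h * D v (x + s *\<^sub>R v + t *\<^sub>R w) w"
    by (rule second_difference_mean_value[OF h inU d1 d2])
  have inU': "x + s *\<^sub>R w + t *\<^sub>R v \<in> U" if "s \<in> {0..h}" "t \<in> {0..h}" for s t
    using inU[OF that(2,1)] by (simp add: algebra_simps)
  obtain s' t' where st': "s' \<in> {0..h}" "t' \<in> {0..h}"
    "\<phi> (x + h *\<^sub>R w + h *\<^sub>R v) - \<phi> (x + h *\<^sub>R w) - \<phi> (x + h *\<^sub>R v) + \<phi> x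
       = h * h * D w (x + s' *\<^sub>R w + t' *\<^sub>R v) v"
    by (rule second_difference_mean_value[OF h inU' d1 d2])
  have "h * h * D v (x + s *\<^sub>R v + t *\<^sub>R w) w = h * h * D w (x + s' *\<^sub>R w + t' *\<^sub>R v) v"
    using st(3) st'(3) by (simp add: algebra_simps)
  then have eq: "D v (x + s *\<^sub>R v + t *\<^sub>R w) w = D w (x + s' *\<^sub>R w + t' *\<^sub>R v) v" using h by simp
  have "dist (D v (x + s *\<^sub>R v + t *\<^sub>R w) w) (D v x w) < \<epsilon>"
    using near[OF st(1,2)] \<delta> by (intro d') auto
  moreover have "dist (D w (x + s' *\<^sub>R w + t' *\<^sub>R v) v) (D w x v) < \<epsilon>"
    using near[OF st'(2,1)] \<delta> by (intro d') (auto simp: algebra_simps)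
  ultimately have "\<bar>D v x w - D w x v\<bar> < 2 * \<epsilon>"
    using eq by (auto simp: dist_real_def)
  then show False by (simp add: \<epsilon>_def)
qed

lemma symmetric_second_derivative:
  fixes f :: "'a::real_normed_vector \<Rightarrow> 'b::euclidean_space"
  assumes U: "open U" "x \<in> U"
    and d1: "\<And>x. x \<in> U \<Longrightarrow> (f has_derivative d x) (at x)"
    and d2: "\<And>x v. x \<in> U \<Longrightarrow> ((\<lambda>x. d x v) has_derivative D v x) (at x)"
    and c: "\<And>v w. continuous_on U (\<lambda>x. D v x w)"
  shows "D v x w = D w x v"
proof (rule euclidean_eqI)
  fix b :: 'b assume "b \<in> Basis"
  show "D v x w \<bullet> b = D w x v \<bullet> b"
    by (rule symmetric_second_derivative_real[where \<phi>="\<lambda>x. f x \<bullet> b" and d="\<lambda>x v. d x v \<bullet> b"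
          and D="\<lambda>v x w. D v x w \<bullet> b", OF U])
       (auto intro!: has_derivative_inner_left d1 d2 continuous_intros c)
qed

section \<open>Matrices\<close>

lemma bounded_bilinear_matrix_vector_mult:
  "bounded_bilinear ((*v) :: real^'n::finite^'m::finite \<Rightarrow> real^'n \<Rightarrow> real^'m)"
  unfolding bilinear_conv_bounded_bilinear[symmetric] bilinear_def
  by (auto intro!: linearI simp: matrix_vector_mult_add_rdistrib matrix_vector_right_distrib
      scaleR_matrix_vector_assoc matrix_vector_mult_scaleR)

lemma inner_matrix_transpose: "x \<bullet> (B *v y) = (transpose B *v x) \<bullet> (y :: real^'n::finite)"
  by (metis dot_lmul_matrix transpose_matrix_vector)

lemma symmetric_matrix_inner_commute:
  "transpose B = B \<Longrightarrow> x \<bullet> (B *v y) = y \<bullet> (B *v (x :: real^'n::finite))"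
  using inner_matrix_transpose[of x B y] by (simp add: inner_commute)

lemma positive_definite_invertible:
  fixes B :: "real^'n^'n::finite"
  assumes "\<And>v. v \<noteq> 0 \<Longrightarrow> 0 < v \<bullet> (B *v v)"
  shows "invertible B"
proof -
  have "inj ((*v) B)"
  proof (rule injI)
    fix x y assume "B *v x = B *v y"
    then have "(x - y) \<bullet> (B *v (x - y)) = 0" by (simp add: matrix_vector_mult_diff_distrib)
    then show "x = y" using assms[of "x - y"] by auto
  qed
  then show ?thesis
    by (simp add: invertible_left_inverse matrix_left_invertible_injective)
qed

lemma matrix_inv_mult:
  assumes "invertible B"
  shows "B ** matrix_inv B = mat 1" "matrix_inv B ** B = mat 1"
  using someI_ex[OF assms[unfolded invertible_def]] by (auto simp: matrix_inv_def)

lemma matrix_inv_vector_mult: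
  fixes B :: "real^'n^'n::finite"
  assumes "invertible B"
  shows "B *v (matrix_inv B *v x) = x" "matrix_inv B *v (B *v x) = x"
  using matrix_inv_mult[OF assms] by (simp_all add: matrix_vector_mul_assoc)

lemma matrix_inv_symmetric:
  fixes B :: "real^'n^'n::finite"
  assumes "invertible B" "transpose B = B"
  shows "transpose (matrix_inv B) = matrix_inv B"
proof -
  have "transpose (matrix_inv B) ** B = mat 1"
    using matrix_inv_mult(1)[OF assms(1)] assms(2) by (metis matrix_transpose_mul transpose_mat)
  then have "transpose (matrix_inv B) ** B ** matrix_inv B = matrix_inv B" by simp
  then show ?thesis
    using matrix_inv_mult(1)[OF assms(1)] by (simp flip: matrix_mul_assoc)
qed

text \<open>Polarization: expanding the quadratic form at \<open>v + w\<close> recovers the bilinear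
  form.\<close>

lemma symmetric_matrix_eqI:
  fixes B C :: "real^'n^'n::finite"
  assumes "transpose B = B" "transpose C = C" and q: "\<And>v. v \<bullet> (B *v v) = v \<bullet> (C *v v)"
  shows "B = C"
proof -
  have "v \<bullet> (B *v w) = v \<bullet> (C *v w)" for v w
    using q[of "v + w"] q[of v] q[of w] 
      symmetric_matrix_inner_commute[OF assms(1), of v w] symmetric_matrix_inner_commute[OF assms(2), of v w]
    by (simp add: matrix_vector_right_distrib inner_add_left inner_add_right)
  then have "B *v w = C *v w" for w by (metis vector_eq_rdot inner_commute)
  then show ?thesis by (simp add: matrix_eq)
qed

text \<open>Cramer's rule. It exhibits the entries of the inverse as quotients of determinants, so
  that regularity of the inverse follows from regularity of the entries.\<close>

lemma matrix_inv_nth: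
  fixes B :: "real^'n^'n::finite"
  assumes "invertible B"
  shows "matrix_inv B $ i $ j = det (\<chi> r s. if s = i then (axis j 1 :: real^'n) $ r else B $ r $ s) * inverse (det B)"
proof -
  have d: "det B \<noteq> 0" using assms by (simp add: invertible_det_nz)
  have "B *v (matrix_inv B *v axis j 1) = axis j 1" by (rule matrix_inv_vector_mult[OF assms])
  then have "matrix_inv B *v axis j 1 = (\<chi> k. det (\<chi> r s. if s = k then (axis j 1 :: real^'n) $ r else B $ r $ s) / det B)"
    using cramer[OF d] by blast
  then have "(matrix_inv B *v axis j 1) $ i = det (\<chi> r s. if s = i then (axis j 1 :: real^'n) $ r else B $ r $ s) / det B"
    by simp
  then show ?thesis by (simp add: matrix_vector_mul_component inner_axis divide_inverse)
qed

lemma loc_lipschitz_on_matrix_inv: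
  fixes B :: "_ \<Rightarrow> real^'n^'n::finite"
  assumes B: "\<And>i j. loc_lipschitz_on S (\<lambda>x. B x $ i $ j)" and inv: "\<And>x. x \<in> S \<Longrightarrow> invertible (B x)"
  shows "loc_lipschitz_on S (\<lambda>x. matrix_inv (B x) $ i $ j)"
proof -
  have e: "loc_lipschitz_on S (\<lambda>x. if s = i then (axis j 1 :: real^'n) $ r else B x $ r $ s)" for r s
    by (cases "s = i") (auto intro: B loc_lipschitz_intros)
  have "loc_lipschitz_on S (\<lambda>x. det (\<chi> r s. if s = i then (axis j 1 :: real^'n) $ r else B x $ r $ s) * inverse (det (B x)))"
    using inv by (intro loc_lipschitz_on_mult loc_lipschitz_on_det loc_lipschitz_on_inverse B)
      (auto simp: invertible_det_nz intro: e)
  then show ?thesis by (rule loc_lipschitz_on_cong) (simp add: matrix_inv_nth inv)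
qed

lemma differentiable_det:
  fixes B :: "'a::real_normed_vector \<Rightarrow> real^'n^'n::finite"
  assumes "\<And>i j. (\<lambda>x. B x $ i $ j) differentiable (at x within S)"
  shows "(\<lambda>x. det (B x)) differentiable (at x within S)"
proof -
  obtain D where "\<And>i j. ((\<lambda>x. B x $ i $ j) has_derivative D i j) (at x within S)"
    using assms unfolding differentiable_def by metis
  then have "(\<lambda>x. of_int (sign p) * (\<Prod>i\<in>UNIV. B x $ i $ p i)) differentiable (at x within S)" for p
    by (intro differentiable_mult differentiable_const)
       (rule differentiableI[OF has_derivative_prod[where f'="\<lambda>i. D i (p i)"]])
  then show ?thesis unfolding det_def by (intro differentiable_sum) (auto simp: finite_permutations)
qed

lemma differentiable_matrixI:
  fixes B :: "'a::real_normed_vector \<Rightarrow> real^'n::finite^'m::finite"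
  assumes "\<And>i j. (\<lambda>x. B x $ i $ j) differentiable (at x within S)"
  shows "B differentiable (at x within S)"
  using assms by (subst differentiable_componentwise_within) (auto simp: Basis_vec_def inner_axis)

text \<open>Only the existence of a derivative is taken from Cramer's rule; its value is found later
  by differentiating the identity that defines the inverse.\<close>

lemma differentiable_matrix_inv:
  fixes B :: "'a::real_normed_vector \<Rightarrow> real^'n^'n::finite"
  assumes B: "B differentiable (at x within S)" and inv: "\<And>x. x \<in> S \<Longrightarrow> invertible (B x)" and x: "x \<in> S"
  shows "(\<lambda>x. matrix_inv (B x)) differentiable (at x within S)"
proof (rule differentiable_matrixI)
  fix i j
  have Bij: "(\<lambda>x. B x $ i $ j) differentiable (at x within S)" for i j
  proof -
    obtain D where "(B has_derivative D) (at x within S)" using B by (auto simp: differentiable_def)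
    then show ?thesis
      by (intro differentiableI[OF bounded_linear.has_derivative[OF bounded_linear_vec_nth
            bounded_linear.has_derivative[OF bounded_linear_vec_nth]]])
  qed
  have "(\<lambda>x. det (\<chi> r s. if s = i then (axis j 1 :: real^'n) $ r else B x $ r $ s) * inverse (det (B x))) differentiable (at x within S)"
  proof (rule differentiable_mult)
    have "(\<lambda>x. if s = i then (axis j 1 :: real^'n) $ r else B x $ r $ s) differentiable (at x within S)" for r s
      by (cases "s = i") (simp_all add: Bij)
    then show "(\<lambda>x. det (\<chi> r s. if s = i then (axis j 1 :: real^'n) $ r else B x $ r $ s)) differentiable (at x within S)"
      by (intro differentiable_det) simp
    have "det (B x) \<noteq> 0" using inv[OF x] by (simp add: invertible_det_nz)
    then show "(\<lambda>x. inverse (det (B x))) differentiable (at x within S)"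
      by (rule differentiable_inverse[OF differentiable_det[OF Bij]])
  qed
  then show "(\<lambda>x. matrix_inv (B x) $ i $ j) differentiable (at x within S)"
    by (rule differentiable_transform_within[OF _ zero_less_one x]) (simp add: matrix_inv_nth inv)
qed

section \<open>Differentiation in relatively open subsets of a half-space\<close>

text \<open>Even at a boundary point one can move a little in the positive sense of every coordinate
  axis without leaving \<open>S\<close>, and this determines a linear map.\<close>

lemma half_space_derivative_unique:
  fixes f :: "real^'n::finite \<Rightarrow> 'b::real_normed_vector"
  assumes S: "openin (top_of_set (half_space k)) S" and x: "x \<in> S"
    and f: "(f has_derivative f') (at x within S)" "(f has_derivative f'') (at x within S)"
  shows "f' = f''"
proof (rule frechet_derivative_unique_within[OF f])
  fix i :: "real^'n" and e :: real assume i: "i \<in> Basis" and e: "e > 0"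
  obtain W where W: "open W" "S = half_space k \<inter> W" using S by (auto simp: openin_open)
  obtain r where r: "r > 0" "ball x r \<subseteq> W" using W x open_contains_ball by blast
  obtain j where j: "i = axis j 1" using i by (auto simp: Basis_vec_def)
  \<comment> \<open>The step is positive, so coordinate \<open>k\<close> does not decrease and the
    point remains in the half-space.\<close>
  define d where "d = min e r / 2"
  have d: "d > 0" "d < e" "d < r" using e r by (auto simp: d_def)
  have "x + d *\<^sub>R i \<in> W" using r d i by (auto simp: dist_norm subset_iff)
  moreover have "x + d *\<^sub>R i \<in> half_space k" using x W d by (auto simp: half_space_def j axis_def)
  ultimately show "\<exists>d. 0 < \<bar>d\<bar> \<and> \<bar>d\<bar> < e \<and> x + d *\<^sub>R i \<in> S" using d W by (intro exI[of _ d]) auto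
qed

lemma half_space_frechet_derivative:
  fixes f :: "real^'n::finite \<Rightarrow> 'b::real_normed_vector"
  assumes "openin (top_of_set (half_space k)) S" "x \<in> S" "(f has_derivative f') (at x within S)"
  shows "frechet_derivative f (at x within S) = f'"
  using half_space_derivative_unique[OF assms(1,2) _ assms(3)] assms(3)
  by (metis differentiableI frechet_derivative_works)

section \<open>Smooth functions on relatively open sets and their derivatives within these
  sets\<close>

lemma smooth_on_local_extension:
  fixes f :: "'a::euclidean_space \<Rightarrow> 'b::real_normed_vector"
  assumes "smooth_on S f" "x \<in> S"
  obtains U F F' where "open U" "x \<in> U" "\<And>m. C_k_on m U F" "\<And>y. y \<in> U \<inter> S \<Longrightarrow> F y = f y"
    "\<And>y. y \<in> U \<Longrightarrow> (F has_derivative F' y) (at y)" "\<And>w. C_k_on (Suc 0) U (\<lambda>y. F' y w)"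
    "\<And>y. y \<in> U \<inter> S \<Longrightarrow> (f has_derivative F' y) (at y within S)"
proof -
  obtain U F where U: "open U" "x \<in> U" "\<And>m. C_k_on m U F" "\<And>y. y \<in> U \<inter> S \<Longrightarrow> F y = f y"
    using assms unfolding smooth_on_def by metis
  obtain F' where F': "\<And>y. y \<in> U \<Longrightarrow> (F has_derivative F' y) (at y)" "\<And>w. C_k_on (Suc 0) U (\<lambda>y. F' y w)"
    using U(3)[of "Suc (Suc 0)"] unfolding C_k_on.simps(2)[of "Suc 0"] by blast
  have "(f has_derivative F' y) (at y within S)" if y: "y \<in> U \<inter> S" for y
  proof (rule has_derivative_transform_eventually)
    show "(F has_derivative F' y) (at y within S)" by (rule has_derivative_at_withinI[OF F'(1)]) (use y in auto)
    show "\<forall>\<^sub>F z in at y within S. F z = f z"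
      using U y by (auto simp: eventually_at_topological)
  qed (use U y in auto)
  then show ?thesis using U F' that by blast
qed

text \<open>The extensions vary from point to point, but the derivative within \<open>S\<close> is
  unique and therefore equals the derivative of any extension; it inherits the Lipschitz bounds of
  the latter.\<close>

lemma smooth_on_half_space:
  fixes f :: "real^'n::finite \<Rightarrow> 'b::real_normed_vector"
  assumes f: "smooth_on S f" and S: "openin (top_of_set (half_space k)) S"
  shows smooth_on_has_derivative:
      "x \<in> S \<Longrightarrow> (f has_derivative frechet_derivative f (at x within S)) (at x within S)"
    and smooth_on_loc_lipschitz: "loc_lipschitz_on S f"
    and smooth_on_loc_lipschitz_derivative: "loc_lipschitz_on S (\<lambda>x. frechet_derivative f (at x within S) w)"
proof -
  show "(f has_derivative frechet_derivative f (at x within S)) (at x within S)" if x: "x \<in> S" for x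
  proof -
    obtain U F F' where "x \<in> U" "\<And>y. y \<in> U \<inter> S \<Longrightarrow> (f has_derivative F' y) (at y within S)"
      by (rule smooth_on_local_extension[OF f x]) blast
    then show ?thesis using x differentiableI frechet_derivative_works by blast
  qed
  show "loc_lipschitz_on S f"
  proof (rule loc_lipschitz_on_local)
    fix x assume x: "x \<in> S"
    obtain U F F' where U: "open U" "x \<in> U" "\<And>m. C_k_on m U F" "\<And>y. y \<in> U \<inter> S \<Longrightarrow> F y = f y"
      by (rule smooth_on_local_extension[OF f x]) blast
    have "loc_lipschitz_on U F" by (rule C_1_imp_loc_lipschitz_on[OF U(1,3)])
    then have "loc_lipschitz_on (U \<inter> S) f" 
      by (intro loc_lipschitz_on_cong[OF loc_lipschitz_on_subset[OF _ Int_lower1] U(4)]) auto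
    then show "\<exists>U. open U \<and> x \<in> U \<and> loc_lipschitz_on (U \<inter> S) f" using U by blast
  qed
  show "loc_lipschitz_on S (\<lambda>x. frechet_derivative f (at x within S) w)"
  proof (rule loc_lipschitz_on_local)
    fix x assume x: "x \<in> S"
    obtain U F F' where U: "open U" "x \<in> U" "\<And>w. C_k_on (Suc 0) U (\<lambda>y. F' y w)"
      "\<And>y. y \<in> U \<inter> S \<Longrightarrow> (f has_derivative F' y) (at y within S)"
      by (rule smooth_on_local_extension[OF f x]) blast
    have "loc_lipschitz_on U (\<lambda>y. F' y w)" by (rule C_1_imp_loc_lipschitz_on[OF U(1,3)])
    then have "loc_lipschitz_on (U \<inter> S) (\<lambda>y. F' y w)" by (rule loc_lipschitz_on_subset) auto
    then have "loc_lipschitz_on (U \<inter> S) (\<lambda>x. frechet_derivative f (at x within S) w)"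

      by (rule loc_lipschitz_on_cong) (use half_space_frechet_derivative[OF S _ U(4)] in auto)
    then show "\<exists>U. open U \<and> x \<in> U \<and> loc_lipschitz_on (U \<inter> S) (\<lambda>x. frechet_derivative f (at x within S) w)"
      using U by blast
  qed
qed

section \<open>Charts\<close>

locale manifold_with_boundary =
  fixes M :: "'a topology" and k :: "'n::finite" and A :: "('a, 'n) chart set"
  assumes smooth_manifold: "smooth_manifold_with_boundary M k A"
begin

lemma chart: "c \<in> A \<Longrightarrow> is_chart M k c"
  using smooth_manifold by (auto simp: smooth_manifold_with_boundary_def)

lemma chart_cover: "x \<in> topspace M \<Longrightarrow> \<exists>c\<in>A. x \<in> fst c"
  using smooth_manifold by (auto simp: smooth_manifold_with_boundary_def)

lemma Hausdorff: "Hausdorff_space M"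
  using smooth_manifold by (auto simp: smooth_manifold_with_boundary_def)

lemma chart_open: "c \<in> A \<Longrightarrow> openin M (fst c)"
  using chart by (auto simp: is_chart_def)

lemma chart_topspace: "c \<in> A \<Longrightarrow> x \<in> fst c \<Longrightarrow> x \<in> topspace M"
  using chart_open openin_subset by blast

lemma chart_image_open: "c \<in> A \<Longrightarrow> openin (top_of_set (half_space k)) (snd c ` fst c)"
  using chart by (auto simp: is_chart_def)

lemma chart_homeomorphic:
  "c \<in> A \<Longrightarrow> homeomorphic_map (subtopology M (fst c)) (top_of_set (snd c ` fst c)) (snd c)"
  using chart by (auto simp: is_chart_def)

lemma chart_inj: "c \<in> A \<Longrightarrow> inj_on (snd c) (fst c)"
  using homeomorphic_imp_injective_map[OF chart_homeomorphic] openin_subset[OF chart_open]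
  by (simp add: Int_absorb1)

lemma param_chart [simp]: "c \<in> A \<Longrightarrow> x \<in> fst c \<Longrightarrow> param c (snd c x) = x"
  using chart_inj by simp

lemma chart_param: "y \<in> snd c ` fst c \<Longrightarrow> param c y \<in> fst c \<and> snd c (param c y) = y"
  by (simp add: f_inv_into_f inv_into_into)

lemma chart_subset_image_open:
  assumes c: "c \<in> A" and U: "openin M U" "U \<subseteq> fst c"
  shows "openin (top_of_set (half_space k)) (snd c ` U)"
proof -
  have "openin (subtopology M (fst c)) U" using U by (metis inf.absorb_iff2 inf_commute openin_subtopology)
  then have "openin (top_of_set (snd c ` fst c)) (snd c ` U)"
    using homeomorphic_map_openness[OF chart_homeomorphic[OF c], of U] openin_subset by blast
  then show ?thesis using chart_image_open[OF c] openin_trans by blast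
qed

lemma overlap_image_open:
  "c \<in> A \<Longrightarrow> d \<in> A \<Longrightarrow> openin (top_of_set (half_space k)) (snd c ` (fst c \<inter> fst d))"
  by (intro chart_subset_image_open openin_Int chart_open) auto

lemma transition_smooth: "c \<in> A \<Longrightarrow> d \<in> A \<Longrightarrow> smooth_on (snd c ` (fst c \<inter> fst d)) (transition c d)"
  using smooth_manifold by (auto simp: smooth_manifold_with_boundary_def)

lemma transition_chart: "c \<in> A \<Longrightarrow> x \<in> fst c \<Longrightarrow> transition c d (snd c x) = snd d x"
  by (simp add: transition_def)

lemma transition_has_derivative:
  assumes "c \<in> A" "d \<in> A" "x \<in> fst c \<inter> fst d"
  shows "(transition c d has_derivative (*v) (jacobian_at c d x))
    (at (snd c x) within snd c ` (fst c \<inter> fst d))"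
proof -
  have "(transition c d has_derivative frechet_derivative (transition c d) (at (snd c x) within snd c ` (fst c \<inter> fst d)))
      (at (snd c x) within snd c ` (fst c \<inter> fst d))"
    using assms by (intro smooth_on_has_derivative[where k=k] transition_smooth overlap_image_open) auto
  moreover from has_derivative_bounded_linear[OF this]
  have "frechet_derivative (transition c d) (at (snd c x) within snd c ` (fst c \<inter> fst d)) = (*v) (jacobian_at c d x)"
    by (simp add: jacobian_at_def)
  ultimately show ?thesis by simp
qed

lemma jacobian_refl:
  assumes "c \<in> A" "x \<in> fst c"
  shows "jacobian_at c c x = mat 1"
proof -
  have S: "openin (top_of_set (half_space k)) (snd c ` fst c)" by (rule chart_image_open[OF assms(1)])
  have "((\<lambda>y. y) has_derivative (*v) (jacobian_at c c x)) (at (snd c x) within snd c ` fst c)"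
    by (rule has_derivative_transform[where f="transition c c"])
       (use assms transition_has_derivative[OF assms(1,1), of x] in \<open>auto simp: transition_chart\<close>)
  then have "(*v) (jacobian_at c c x) = (\<lambda>y. y)"
    using assms by (intro half_space_derivative_unique[OF S]) auto
  then show ?thesis by (metis matrix_eq matrix_vector_mul_lid)
qed

text \<open>The chain rule on the triple overlap, which is relatively open, so that derivatives
  within it are unique.\<close>

lemma jacobian_cocycle:
  assumes cde: "c \<in> A" "d \<in> A" "e \<in> A" and x: "x \<in> fst c" "x \<in> fst d" "x \<in> fst e"
  shows "jacobian_at c e x = jacobian_at d e x ** jacobian_at c d x"
proof -
  let ?S = "snd c ` (fst c \<inter> fst d \<inter> fst e)"
  have S: "openin (top_of_set (half_space k)) ?S"
    using cde by (intro chart_subset_image_open openin_Int chart_open) auto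
  have 1: "(transition c d has_derivative (*v) (jacobian_at c d x)) (at (snd c x) within ?S)"
    by (rule has_derivative_subset[OF transition_has_derivative]) (use assms in auto)
  have 2: "(transition d e has_derivative (*v) (jacobian_at d e x)) (at (transition c d (snd c x)) within transition c d ` ?S)"
    using has_derivative_subset[OF transition_has_derivative[of d e x], of "transition c d ` ?S"] assms
    by (auto simp: transition_chart image_image)
  have "(transition d e \<circ> transition c d has_derivative (*v) (jacobian_at d e x) \<circ> (*v) (jacobian_at c d x)) (at (snd c x) within ?S)"
    by (rule diff_chain_within[OF 1 2])
  moreover have "(transition d e \<circ> transition c d) y = transition c e y" if "y \<in> ?S" for y
    using that cde by (auto simp: transition_chart)
  ultimately have "(transition c e has_derivative (*v) (jacobian_at d e x) \<circ> (*v) (jacobian_at c d x)) (at (snd c x) within ?S)"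
    using x by (intro has_derivative_transform[where f="transition d e \<circ> transition c d" and g="transition c e"]) auto
  moreover have "(transition c e has_derivative (*v) (jacobian_at c e x)) (at (snd c x) within ?S)"
    by (rule has_derivative_subset[OF transition_has_derivative]) (use assms in auto)
  ultimately have "(*v) (jacobian_at d e x) \<circ> (*v) (jacobian_at c d x) = (*v) (jacobian_at c e x)"
    using x by (intro half_space_derivative_unique[OF S]) auto
  then show ?thesis by (metis comp_apply matrix_eq matrix_vector_mul_assoc)
qed

section \<open>Covectors and their components in a single chart\<close>

lemma covector_transform:
  assumes "\<xi> \<in> cotangent_space A x" "c \<in> A" "d \<in> A" "x \<in> fst c" "x \<in> fst d"
  shows "\<xi> c = transpose (jacobian_at c d x) *v \<xi> d"
  using assms(1)[unfolded cotangent_space_def mem_Collect_eq, THEN conjunct1] assms(2-5) by blast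

lemma covector_outside:
  assumes "\<xi> \<in> cotangent_space A x" "c \<notin> A \<or> x \<notin> fst c"
  shows "\<xi> c = 0"
  using assms(1)[unfolded cotangent_space_def mem_Collect_eq, THEN conjunct2, THEN spec, THEN mp, OF assms(2)] .

text \<open>The transformation law fixes the components in the other charts around \<open>x\<close>;
  the convention of zeros fixes those in all remaining charts.\<close>

lemma covector_eqI:
  assumes "\<xi> \<in> cotangent_space A x" "\<eta> \<in> cotangent_space A x" "c \<in> A" "x \<in> fst c" "\<xi> c = \<eta> c"
  shows "\<xi> = \<eta>"
proof
  fix d
  show "\<xi> d = \<eta> d"
  proof (cases "d \<in> A \<and> x \<in> fst d")
    case True
    then show ?thesis using covector_transform[OF assms(1), of d c] covector_transform[OF assms(2), of d c] assms(3-5)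
      by simp
  next
    case False

    then have "\<xi> d = 0" "\<eta> d = 0" by (auto intro!: covector_outside[OF assms(1)] covector_outside[OF assms(2)])
    then show ?thesis by simp
  qed
qed

lemma zero_covector: "(\<lambda>_. 0) \<in> cotangent_space A x"
  by (simp add: cotangent_space_def)

lemma covector_nonzero:
  assumes "\<xi> \<in> cotangent_space A x" "\<xi> \<noteq> (\<lambda>_. 0)" "c \<in> A" "x \<in> fst c"
  shows "\<xi> c \<noteq> 0"
  using covector_eqI[OF assms(1) zero_covector assms(3,4)] assms(2) by auto

text \<open>Components prescribed in one chart are carried to the others by the Jacobians; the
  cocycle identity makes the resulting family consistent.\<close>

lemma covector_exists:
  assumes c: "c \<in> A" "x \<in> fst c"
  obtains \<xi> where "\<xi> \<in> cotangent_space A x" "\<xi> c = p"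
proof -
  define \<xi> where "\<xi> d = (if d \<in> A \<and> x \<in> fst d then transpose (jacobian_at d c x) *v p else 0)" for d
  have \<xi>A: "\<xi> d = transpose (jacobian_at d c x) *v p" if "d \<in> A" "x \<in> fst d" for d
    using that by (simp only: \<xi>_def simp_thms if_True)
  have "\<xi> d = transpose (jacobian_at d e x) *v \<xi> e"
    if "d \<in> A" "e \<in> A" "x \<in> fst d" "x \<in> fst e" for d e
    by (simp only: \<xi>A[OF that(1,3)] \<xi>A[OF that(2,4)] jacobian_cocycle[OF that(1,2) c(1) that(3,4) c(2)]
        matrix_transpose_mul matrix_vector_mul_assoc)
  moreover have "\<xi> d = 0" if "d \<notin> A \<or> x \<notin> fst d" for d using that by (auto simp: \<xi>_def)
  ultimately have "\<xi> \<in> cotangent_space A x"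
    unfolding cotangent_space_def mem_Collect_eq by blast
  moreover have "\<xi> c = p" using \<xi>A[OF c] by (simp add: jacobian_refl c)
  ultimately show ?thesis by (rule that)
qed

end

section \<open>Curves in charts\<close>

text \<open>A connected set with two points has no isolated point. This makes vector derivatives
  within an interval unique, at its endpoints as well.\<close>

lemma at_within_interval_neq_bot:
  fixes t :: real
  assumes "is_interval I" "t \<in> I" "\<exists>a\<in>I. \<exists>b\<in>I. a \<noteq> b"
  shows "at t within I \<noteq> bot"
proof -
  obtain s where "s \<in> I" "s \<noteq> t" using assms by metis
  then show ?thesis
    using connected_imp_perfect[of I t] assms
    by (auto simp: trivial_limit_within is_interval_connected)
qed

text \<open>Serves the connectedness argument for uniqueness of curves and the continuity of glued
  curves, where openness is checked point by point.\<close>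

lemma openin_eventually_at:
  fixes E :: "'a::topological_space set"
  assumes "E \<subseteq> I" "\<And>t. t \<in> E \<Longrightarrow> \<forall>\<^sub>F s in at t within I. s \<in> E"
  shows "openin (top_of_set I) E"
proof (subst openin_subopen, intro ballI)
  fix t assume t: "t \<in> E"
  obtain W where "open W" "t \<in> W" "\<And>s. s \<in> W \<Longrightarrow> s \<noteq> t \<Longrightarrow> s \<in> I \<Longrightarrow> s \<in> E"
    using assms(2)[OF t] unfolding eventually_at_topological by blast
  then show "\<exists>T. openin (top_of_set I) T \<and> t \<in> T \<and> T \<subseteq> E"
    using t assms(1) by (intro exI[of _ "I \<inter> W"]) auto
qed

lemma eventually_continuous_map_at:
  assumes x: "continuous_map (top_of_set I) M x" and t: "t \<in> I" and U: "openin M U" "x t \<in> U"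
  shows "\<forall>\<^sub>F s in at t within I. x s \<in> U"
proof -
  have "openin (top_of_set I) {s \<in> topspace (top_of_set I). x s \<in> U}"
    by (rule openin_continuous_map_preimage[OF x U(1)])
  then obtain W where W: "open W" "{s \<in> I. x s \<in> U} = I \<inter> W" by (auto simp: openin_open)
  then show ?thesis unfolding eventually_at_topological using t U(2) by (intro exI[of _ W]) blast
qed

lemma continuous_map_at_withinI:
  assumes M: "\<And>t. t \<in> I \<Longrightarrow> x t \<in> topspace M"
    and ev: "\<And>t U. t \<in> I \<Longrightarrow> openin M U \<Longrightarrow> x t \<in> U \<Longrightarrow> \<forall>\<^sub>F s in at t within I. x s \<in> U"
  shows "continuous_map (top_of_set I) M x"
  unfolding continuous_map_def
proof (intro conjI allI impI)
  show "x \<in> topspace (top_of_set I) \<rightarrow> topspace M" using M by auto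
  fix U assume U: "openin M U"
  have "openin (top_of_set I) {s \<in> I. x s \<in> U}"
  proof (rule openin_eventually_at)
    fix t assume "t \<in> {s \<in> I. x s \<in> U}"
    then have "\<forall>\<^sub>F s in at t within I. x s \<in> U" using ev[of t U] U by blast
    moreover have "\<forall>\<^sub>F s in at t within I. s \<in> I" by (simp add: eventually_at_topological) blast
    ultimately show "\<forall>\<^sub>F s in at t within I. s \<in> {s \<in> I. x s \<in> U}" by eventually_elim auto
  qed auto
  then show "openin (top_of_set I) {s \<in> topspace (top_of_set I). x s \<in> U}" by simp
qed

text \<open>A curve stays in the domain of a chart only for parameters near \<open>t\<close>;
  shrinking \<open>I\<close> to a neighbourhood of \<open>t\<close> leaves the filter
  unchanged.\<close>

lemma has_derivative_compose_eventually:
  assumes f: "(f has_derivative f') (at t within I)" and h: "(h has_derivative h') (at (f t) within S)"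
    and ev: "\<forall>\<^sub>F s in at t within I. f s \<in> S" and t: "t \<in> I" "f t \<in> S"
  shows "((\<lambda>s. h (f s)) has_derivative (\<lambda>w. h' (f' w))) (at t within I)"
proof -
  obtain W where W: "open W" "t \<in> W" "\<And>s. s \<in> W \<Longrightarrow> s \<noteq> t \<Longrightarrow> s \<in> I \<Longrightarrow> f s \<in> S"
    using ev unfolding eventually_at_topological by blast
  have eq: "at t within I = at t within (I \<inter> W)" by (rule at_within_nhd[OF W(2,1)]) auto
  have "f ` (I \<inter> W) \<subseteq> S" using W t by auto
  then have "(h \<circ> f has_derivative h' \<circ> f') (at t within (I \<inter> W))"
    using f h unfolding eq by (intro diff_chain_within) (auto intro: has_derivative_subset)
  then show ?thesis by (simp add: eq o_def)
qed

lemma has_vector_derivative_compose_eventually: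
  assumes f: "(f has_vector_derivative v) (at t within I)" and h: "(h has_derivative h') (at (f t) within S)"
    and ev: "\<forall>\<^sub>F s in at t within I. f s \<in> S" and t: "t \<in> I" "f t \<in> S"
  shows "((\<lambda>s. h (f s)) has_vector_derivative h' v) (at t within I)"
proof -
  have "((\<lambda>s. h (f s)) has_derivative (\<lambda>w. h' (w *\<^sub>R v))) (at t within I)"
    by (rule has_derivative_compose_eventually[OF f[unfolded has_vector_derivative_def] h ev t])
  moreover have "(\<lambda>w. h' (w *\<^sub>R v)) = (\<lambda>w. w *\<^sub>R h' v)"
    using has_derivative_linear[OF h] by (simp add: linear_scale)
  ultimately show ?thesis by (simp add: has_vector_derivative_def)
qed

lemma has_vector_derivative_matrix_vector_mult:
  fixes B :: "real \<Rightarrow> real^'n::finite^'m::finite"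
  assumes "(B has_vector_derivative B') (at t within I)" "(u has_vector_derivative u') (at t within I)"
  shows "((\<lambda>s. B s *v u s) has_vector_derivative (B' *v u t + B t *v u')) (at t within I)"
  using bounded_bilinear.has_vector_derivative[OF bounded_bilinear_matrix_vector_mult assms]
  by (simp add: add.commute)

context manifold_with_boundary
begin

lemma eventually_in_chart:
  assumes "continuous_map (top_of_set I) M x" "t \<in> I" "c \<in> A" "x t \<in> fst c"
  shows "\<forall>\<^sub>F s in at t within I. x s \<in> fst c"
  by (rule eventually_continuous_map_at[OF assms(1,2) chart_open[OF assms(3)] assms(4)])

lemma chart_change_velocity:
  assumes x: "continuous_map (top_of_set I) M x" and t: "t \<in> I" and c: "c \<in> A" "x t \<in> fst c"
    and d: "d \<in> A" "x t \<in> fst d" and v: "((\<lambda>s. snd c (x s)) has_vector_derivative v) (at t within I)"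
  shows "((\<lambda>s. snd d (x s)) has_vector_derivative jacobian_at c d (x t) *v v) (at t within I)"
proof -
  have ev: "\<forall>\<^sub>F s in at t within I. x s \<in> fst c \<inter> fst d"
    using eventually_in_chart[OF x t c] eventually_in_chart[OF x t d] by eventually_elim auto
  have "((\<lambda>s. transition c d (snd c (x s))) has_vector_derivative jacobian_at c d (x t) *v v) (at t within I)"
  proof (rule has_vector_derivative_compose_eventually[OF v transition_has_derivative[OF c(1) d(1)]])
    show "\<forall>\<^sub>F s in at t within I. snd c (x s) \<in> snd c ` (fst c \<inter> fst d)"
      using ev by eventually_elim auto
  qed (use t c d in auto)
  moreover have "\<forall>\<^sub>F s in at t within I. transition c d (snd c (x s)) = snd d (x s)"
    using ev by eventually_elim (auto simp: transition_chart c)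
  ultimately show ?thesis
    unfolding has_vector_derivative_def
    by (rule has_derivative_transform_eventually) (use t c in \<open>auto simp: transition_chart\<close>)
qed

lemma jacobian_inverse:
  assumes "c \<in> A" "d \<in> A" "x \<in> fst c" "x \<in> fst d"
  shows "jacobian_at d c x ** jacobian_at c d x = mat 1"
  using jacobian_cocycle[of c d c x] jacobian_refl[of c x] assms by simp

end

section \<open>Calculus of a Riemannian metric in charts\<close>

lemma inner_matrix_vector_sum:
  "v \<bullet> (B *v w) = (\<Sum>j\<in>UNIV. \<Sum>m\<in>UNIV. v $ j * w $ m * B $ j $ m)" for v w :: "real^'n::finite"
  by (simp add: inner_vec_def matrix_vector_mult_def sum_distrib_left mult_ac)

lemma linear_real_expansion:
  fixes f :: "real^'n::finite \<Rightarrow> real"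
  assumes "linear f"
  shows "(\<chi> i. f (axis i 1)) \<bullet> w = f w"
proof -
  have "f w = f (\<Sum>i\<in>UNIV. w $ i *\<^sub>R axis i 1)"
    by (simp add: basis_expansion flip: scalar_mult_eq_scaleR)
  also have "\<dots> = (\<Sum>i\<in>UNIV. w $ i * f (axis i 1))"
    by (simp add: linear_sum[OF assms] linear_scale[OF assms])
  finally show ?thesis by (simp add: inner_vec_def mult.commute)
qed

lemma linear_matrix_expansion:
  fixes D :: "real^'n::finite \<Rightarrow> real^'m::finite^'l::finite"
  assumes "linear D"
  shows "D u $ a $ b = (\<Sum>i\<in>UNIV. u $ i * D (axis i 1) $ a $ b)"
proof -
  have "D u = D (\<Sum>i\<in>UNIV. u $ i *\<^sub>R axis i 1)"
    by (simp add: basis_expansion flip: scalar_mult_eq_scaleR)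
  also have "\<dots> = (\<Sum>i\<in>UNIV. u $ i *\<^sub>R D (axis i 1))" by (simp add: linear_sum[OF assms] linear_scale[OF assms])
  finally show ?thesis by simp
qed

lemma sum_rotate:
  "(\<Sum>a\<in>X. \<Sum>b\<in>Y. \<Sum>c\<in>Z. f a b c) = (\<Sum>c\<in>Z. \<Sum>a\<in>X. \<Sum>b\<in>Y. f a b c)"
proof -
  have "(\<Sum>a\<in>X. \<Sum>b\<in>Y. \<Sum>c\<in>Z. f a b c) = (\<Sum>a\<in>X. \<Sum>c\<in>Z. \<Sum>b\<in>Y. f a b c)"
    by (intro sum.cong refl sum.swap)
  also have "\<dots> = (\<Sum>c\<in>Z. \<Sum>a\<in>X. \<Sum>b\<in>Y. f a b c)" by (rule sum.swap)
  finally show ?thesis .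
qed

locale riemannian_manifold = manifold_with_boundary M k A
  for M :: "'a topology" and k :: "'n::finite" and A :: "('a, 'n) chart set" +
  fixes g :: "('a, 'n) metric_tensor"
  assumes riemannian: "riemannian_metric A g"
begin

definition coord_metric :: "('a, 'n) chart \<Rightarrow> real^'n \<Rightarrow> real^'n^'n" where
  "coord_metric c y = g c (param c y)"

text \<open>The last argument is the direction; the value is the matrix of the derivatives of the
  metric coefficients along it.\<close>

definition coord_metric_deriv :: "('a, 'n) chart \<Rightarrow> real^'n \<Rightarrow> real^'n \<Rightarrow> real^'n^'n" where
  "coord_metric_deriv c y = frechet_derivative (coord_metric c) (at y within snd c ` fst c)"

lemma coord_metric_chart: "c \<in> A \<Longrightarrow> x \<in> fst c \<Longrightarrow> coord_metric c (snd c x) = g c x"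
  by (simp add: coord_metric_def)

lemma metric_smooth: "c \<in> A \<Longrightarrow> smooth_on (snd c ` fst c) (coord_metric c)"
  using riemannian[unfolded riemannian_metric_def o_def, THEN conjunct1] by (simp add: coord_metric_def[abs_def])

lemma metric_symmetric: "c \<in> A \<Longrightarrow> x \<in> fst c \<Longrightarrow> transpose (g c x) = g c x"
  using riemannian[unfolded riemannian_metric_def, THEN conjunct2, THEN conjunct1] by blast

lemma metric_pos: "c \<in> A \<Longrightarrow> x \<in> fst c \<Longrightarrow> v \<noteq> 0 \<Longrightarrow> 0 < v \<bullet> (g c x *v v)"
  using riemannian[unfolded riemannian_metric_def, THEN conjunct2, THEN conjunct1] by blast

lemma metric_transform:
  "c \<in> A \<Longrightarrow> d \<in> A \<Longrightarrow> x \<in> fst c \<Longrightarrow> x \<in> fst d \<Longrightarrow>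
    g c x = transpose (jacobian_at c d x) ** g d x ** jacobian_at c d x"
  using riemannian[unfolded riemannian_metric_def, THEN conjunct2, THEN conjunct2] by blast

lemma metric_transform_inner:
  assumes "c \<in> A" "d \<in> A" "x \<in> fst c" "x \<in> fst d"
  shows "a \<bullet> (g c x *v b) = (jacobian_at c d x *v a) \<bullet> (g d x *v (jacobian_at c d x *v b))"
proof -
  have "g c x *v b = transpose (jacobian_at c d x) *v (g d x *v (jacobian_at c d x *v b))"
    by (simp only: metric_transform[OF assms] matrix_vector_mul_assoc matrix_mul_assoc)
  then show ?thesis by (simp only: inner_matrix_transpose transpose_transpose)
qed

lemma metric_invertible: "c \<in> A \<Longrightarrow> x \<in> fst c \<Longrightarrow> invertible (g c x)"
  by (intro positive_definite_invertible metric_pos)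

lemma metric_inner_commute: "c \<in> A \<Longrightarrow> x \<in> fst c \<Longrightarrow> a \<bullet> (g c x *v b) = b \<bullet> (g c x *v a)"
  by (rule symmetric_matrix_inner_commute[OF metric_symmetric])

lemma inverse_metric_inner_commute:
  assumes "c \<in> A" "x \<in> fst c"
  shows "a \<bullet> (inverse_metric g c x *v b) = b \<bullet> (inverse_metric g c x *v a)"
  by (rule symmetric_matrix_inner_commute[OF
        matrix_inv_symmetric[OF metric_invertible[OF assms] metric_symmetric[OF assms]]])

lemma coord_metric_invertible: "c \<in> A \<Longrightarrow> y \<in> snd c ` fst c \<Longrightarrow> invertible (coord_metric c y)"
  using chart_param[of y c] by (auto simp: coord_metric_chart metric_invertible)

lemma coord_metric_has_derivative:
  "c \<in> A \<Longrightarrow> y \<in> snd c ` fst c \<Longrightarrow>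
    (coord_metric c has_derivative coord_metric_deriv c y) (at y within snd c ` fst c)"
  unfolding coord_metric_deriv_def
  by (rule smooth_on_has_derivative[OF metric_smooth chart_image_open])

lemma coord_metric_deriv_linear: "c \<in> A \<Longrightarrow> y \<in> snd c ` fst c \<Longrightarrow> linear (coord_metric_deriv c y)"
  using coord_metric_has_derivative has_derivative_linear by blast

lemma loc_lipschitz_on_coord_metric: "c \<in> A \<Longrightarrow> loc_lipschitz_on (snd c ` fst c) (coord_metric c)"
  by (rule smooth_on_loc_lipschitz[OF metric_smooth chart_image_open])

lemma loc_lipschitz_on_coord_metric_deriv:
  "c \<in> A \<Longrightarrow> loc_lipschitz_on (snd c ` fst c) (\<lambda>y. coord_metric_deriv c y w)"
  unfolding coord_metric_deriv_def
  by (rule smooth_on_loc_lipschitz_derivative[OF metric_smooth chart_image_open])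

lemma coord_metric_deriv_inner:
  assumes "c \<in> A" "y \<in> snd c ` fst c"
  shows "((\<lambda>z. v \<bullet> (coord_metric c z *v u)) has_derivative (\<lambda>w. v \<bullet> (coord_metric_deriv c y w *v u)))
    (at y within snd c ` fst c)"
  by (intro has_derivative_inner_right
      bounded_linear.has_derivative[OF bounded_bilinear.bounded_linear_left[OF bounded_bilinear_matrix_vector_mult]]
      coord_metric_has_derivative assms)

lemma coord_metric_deriv_commute:
  assumes c: "c \<in> A" and y: "y \<in> snd c ` fst c"
  shows "v \<bullet> (coord_metric_deriv c y w *v u) = u \<bullet> (coord_metric_deriv c y w *v v)"
proof -
  have "v \<bullet> (coord_metric c z *v u) = u \<bullet> (coord_metric c z *v v)" if "z \<in> snd c ` fst c" for z
    using metric_inner_commute[OF c, of "param c z" v u] chart_param[OF that] by (simp add: coord_metric_def)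
  then have "((\<lambda>z. v \<bullet> (coord_metric c z *v u)) has_derivative (\<lambda>w. u \<bullet> (coord_metric_deriv c y w *v v)))
      (at y within snd c ` fst c)"
    by (intro has_derivative_transform[OF y _ coord_metric_deriv_inner[OF c y]]) auto
  from half_space_derivative_unique[OF chart_image_open[OF c] y coord_metric_deriv_inner[OF c y] this]
  show ?thesis by metis
qed

lemma partial_metric:
  assumes c: "c \<in> A" "x \<in> fst c"
  shows "partial_at c (\<lambda>z. g c z $ i $ j) m x = coord_metric_deriv c (snd c x) (axis m 1) $ i $ j"
proof -
  have y: "snd c x \<in> snd c ` fst c" using c by auto
  have "((\<lambda>y. coord_metric c y $ i $ j) has_derivative (\<lambda>w. coord_metric_deriv c (snd c x) w $ i $ j))
      (at (snd c x) within snd c ` fst c)"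
    by (intro bounded_linear.has_derivative[OF bounded_linear_vec_nth] coord_metric_has_derivative c y)
  from half_space_frechet_derivative[OF chart_image_open[OF c(1)] y this]
  show ?thesis by (simp add: partial_at_def coord_metric_def o_def)
qed

text \<open>The Koszul formula in coordinates. Pairing with the metric cancels the inverse metric
  inside the Christoffel symbols and leaves only first derivatives of the metric; both the lift of
  geodesics and the change of charts are computed in this form.\<close>

lemma christoffel_form_inner:
  fixes u v w :: "real^'n"
  assumes c: "c \<in> A" "x \<in> fst c"
  defines "D \<equiv> coord_metric_deriv c (snd c x)"
  shows "w \<bullet> (g c x *v christoffel_form g c x u v) =
    (v \<bullet> (D u *v w) + u \<bullet> (D v *v w) - u \<bullet> (D w *v v)) / 2"
proof -
  let ?N = "inverse_metric g c x"
  let ?T = "\<lambda>i j m. D (axis i 1) $ j $ m + D (axis j 1) $ i $ m - D (axis m 1) $ i $ j"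
  \<comment> \<open>The Christoffel symbols of the first kind contracted with \<open>u\<close> and
    \<open>v\<close>; the inverse metric raises the free index.\<close>
  define q :: "real^'n" where "q = (\<chi> m. (\<Sum>i\<in>UNIV. \<Sum>j\<in>UNIV. ?T i j m * u $ i * v $ j) / 2)"
  have D: "linear D" unfolding D_def using c by (intro coord_metric_deriv_linear) auto
  have "christoffel_form g c x u v $ l = (?N *v q) $ l" for l
  proof -
    have "christoffel_form g c x u v $ l =
        (\<Sum>i\<in>UNIV. \<Sum>j\<in>UNIV. \<Sum>m\<in>UNIV. ?N $ l $ m * (?T i j m * u $ i * v $ j / 2))"
      by (simp add: christoffel_form_def christoffel_def partial_metric[OF c] D_def
          sum_distrib_left sum_distrib_right sum_divide_distrib mult_ac)
    also have "\<dots> = (\<Sum>m\<in>UNIV. \<Sum>i\<in>UNIV. \<Sum>j\<in>UNIV. ?N $ l $ m * (?T i j m * u $ i * v $ j / 2))"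
      by (rule sum_rotate)
    also have "\<dots> = (?N *v q) $ l"
      by (simp add: matrix_vector_mult_def q_def sum_distrib_left sum_divide_distrib)
    finally show ?thesis .
  qed
  then have "christoffel_form g c x u v = ?N *v q" by (simp add: vec_eq_iff)
  then have "w \<bullet> (g c x *v christoffel_form g c x u v) = w \<bullet> q"
    by (simp add: matrix_inv_vector_mult[OF metric_invertible[OF c]])
  also have "\<dots> = (\<Sum>m\<in>UNIV. \<Sum>i\<in>UNIV. \<Sum>j\<in>UNIV. u $ i * v $ j * w $ m * ?T i j m / 2)"
    by (simp add: inner_vec_def q_def sum_distrib_left sum_divide_distrib mult_ac)
  also have "\<dots> = (\<Sum>i\<in>UNIV. \<Sum>j\<in>UNIV. \<Sum>m\<in>UNIV. u $ i * v $ j * w $ m * ?T i j m / 2)"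
    by (rule sum_rotate[symmetric])
  also have "\<dots> = ((\<Sum>i\<in>UNIV. \<Sum>j\<in>UNIV. \<Sum>m\<in>UNIV. u $ i * v $ j * w $ m * D (axis i 1) $ j $ m)
      + (\<Sum>i\<in>UNIV. \<Sum>j\<in>UNIV. \<Sum>m\<in>UNIV. u $ i * v $ j * w $ m * D (axis j 1) $ i $ m)
      - (\<Sum>i\<in>UNIV. \<Sum>j\<in>UNIV. \<Sum>m\<in>UNIV. u $ i * v $ j * w $ m * D (axis m 1) $ i $ j)) / 2"
    unfolding sum.distrib[symmetric] sum_subtractf[symmetric] sum_divide_distrib
    by (intro sum.cong refl) (simp add: algebra_simps)
  also have "(\<Sum>i\<in>UNIV. \<Sum>j\<in>UNIV. \<Sum>m\<in>UNIV. u $ i * v $ j * w $ m * D (axis i 1) $ j $ m) = v \<bullet> (D u *v w)"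
    unfolding inner_matrix_vector_sum linear_matrix_expansion[OF D, of u] sum_distrib_left
    by (subst sum_rotate) (simp add: mult_ac)
  also have "(\<Sum>i\<in>UNIV. \<Sum>j\<in>UNIV. \<Sum>m\<in>UNIV. u $ i * v $ j * w $ m * D (axis j 1) $ i $ m) = u \<bullet> (D v *v w)"
    unfolding inner_matrix_vector_sum linear_matrix_expansion[OF D, of v] sum_distrib_left
    by (rule sum.cong[OF refl], subst sum.swap) (simp add: mult_ac)
  also have "(\<Sum>i\<in>UNIV. \<Sum>j\<in>UNIV. \<Sum>m\<in>UNIV. u $ i * v $ j * w $ m * D (axis m 1) $ i $ j) = u \<bullet> (D w *v v)"
    unfolding inner_matrix_vector_sum linear_matrix_expansion[OF D, of w] sum_distrib_left
    by (simp add: mult_ac)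
  finally show ?thesis .
qed

section \<open>The inverse metric and the Hamiltonian vector field\<close>

lemma inverse_coord_metric_differentiable:
  assumes "c \<in> A" "y \<in> snd c ` fst c"
  obtains N' where "((\<lambda>z. matrix_inv (coord_metric c z)) has_derivative N') (at y within snd c ` fst c)"
proof -
  have "coord_metric c differentiable (at y within snd c ` fst c)"
    using coord_metric_has_derivative[OF assms] differentiableI by blast
  from differentiable_matrix_inv[OF this coord_metric_invertible[OF assms(1)] assms(2)]
  show ?thesis using that by (auto simp: differentiable_def)
qed

text \<open>Differentiating G (G^{-1} p) = p at \<open>y\<close> gives G (dG^{-1} p) = - dG u with u
  = G^{-1} p; pairing with \<open>u\<close> and using the symmetry of G gives the formula.\<close>

lemma inverse_coord_metric_form_has_derivative:
  fixes p :: "real^'n"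
  assumes c: "c \<in> A" and y: "y \<in> snd c ` fst c"
  defines "u \<equiv> matrix_inv (coord_metric c y) *v p"
  shows "((\<lambda>z. p \<bullet> (matrix_inv (coord_metric c z) *v p)) has_derivative
    (\<lambda>w. - (u \<bullet> (coord_metric_deriv c y w *v u)))) (at y within snd c ` fst c)"
proof -
  let ?S = "snd c ` fst c" and ?G = "coord_metric c" and ?D = "coord_metric_deriv c y"
  obtain N' where N': "((\<lambda>z. matrix_inv (?G z)) has_derivative N') (at y within ?S)"
    by (rule inverse_coord_metric_differentiable[OF c y])
  have u: "((\<lambda>z. matrix_inv (?G z) *v p) has_derivative (\<lambda>w. N' w *v p)) (at y within ?S)"
    by (rule bounded_linear.has_derivative[OF
          bounded_bilinear.bounded_linear_left[OF bounded_bilinear_matrix_vector_mult] N'])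
  have "((\<lambda>z. ?G z *v (matrix_inv (?G z) *v p)) has_derivative (\<lambda>w. ?G y *v (N' w *v p) + ?D w *v u)) (at y within ?S)"
    unfolding u_def
    by (rule bounded_bilinear.FDERIV[OF bounded_bilinear_matrix_vector_mult coord_metric_has_derivative[OF c y] u])
  \<comment> \<open>The differentiated product is the constant \<open>p\<close>, so its derivative
    must be zero.\<close>
  then have "((\<lambda>z. p) has_derivative (\<lambda>w. ?G y *v (N' w *v p) + ?D w *v u)) (at y within ?S)"
    by (rule has_derivative_transform[OF y, rotated])
       (simp add: matrix_inv_vector_mult coord_metric_invertible[OF c])
  then have eq: "(\<lambda>w. ?G y *v (N' w *v p) + ?D w *v u) = (\<lambda>w. 0)"
    by (intro half_space_derivative_unique[OF chart_image_open[OF c] y]) auto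
  have Gu: "?G y *v u = p" by (simp add: u_def matrix_inv_vector_mult coord_metric_invertible[OF c y])
  have "p \<bullet> (N' w *v p) = - (u \<bullet> (?D w *v u))" for w
  proof -
    have "p \<bullet> (N' w *v p) = (N' w *v p) \<bullet> (?G y *v u)" by (simp add: Gu inner_commute)
    also have "\<dots> = u \<bullet> (?G y *v (N' w *v p))"
      using metric_inner_commute[OF c, of "param c y"] chart_param[OF y] by (simp add: coord_metric_def)
    also have "?G y *v (N' w *v p) = - (?D w *v u)" using fun_cong[OF eq, of w] by (simp add: eq_neg_iff_add_eq_0)
    finally show ?thesis by simp
  qed
  then show ?thesis using has_derivative_inner_right[OF u, of p] by simp
qed

text \<open>The factor 2 comes from the quadratic dependence on the covector. In the second
  component the sign in Hamilton's equations cancels the sign in the derivative of the inverse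
  metric, so only derivatives of the metric itself remain.\<close>

lemma hamiltonian_field_eq:
  fixes p :: "real^'n"
  assumes c: "c \<in> A" and y: "y \<in> snd c ` fst c"
  defines "u \<equiv> matrix_inv (coord_metric c y) *v p"
  shows "hamiltonian_field g c y p =
    (2 *\<^sub>R u, \<chi> i. u \<bullet> (coord_metric_deriv c y (axis i 1) *v u))"
proof -
  let ?N = "matrix_inv (coord_metric c y)"
  have x: "param c y \<in> fst c" using chart_param[OF y] by simp
  have Nc: "a \<bullet> (?N *v b) = b \<bullet> (?N *v a)" for a b
    using inverse_metric_inner_commute[OF c x] by (simp add: coord_metric_def)
  have "((\<lambda>q. q \<bullet> (?N *v q)) has_derivative (\<lambda>w. p \<bullet> (?N *v w) + w \<bullet> (?N *v p))) (at p)"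
    by (intro has_derivative_inner has_derivative_ident bounded_linear.has_derivative[OF
          bounded_bilinear.bounded_linear_right[OF bounded_bilinear_matrix_vector_mult]])
  then have 1: "frechet_derivative (\<lambda>q. q \<bullet> (?N *v q)) (at p) = (\<lambda>w. 2 * (w \<bullet> u))"
    by (subst frechet_derivative_at[symmetric]) (auto simp: Nc[of p] u_def)
  have 2: "frechet_derivative (\<lambda>z. p \<bullet> (matrix_inv (coord_metric c z) *v p)) (at y within snd c ` fst c)
      = (\<lambda>w. - (u \<bullet> (coord_metric_deriv c y w *v u)))"
    unfolding u_def
    by (rule half_space_frechet_derivative[OF chart_image_open[OF c] y
          inverse_coord_metric_form_has_derivative[OF c y]])
  show ?thesis
    unfolding hamiltonian_field_def hamiltonian_def
    using 1 2 by (simp add: coord_metric_def vec_eq_iff inner_axis' )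
qed

lemma loc_lipschitz_on_inverse_coord_metric:
  "c \<in> A \<Longrightarrow> loc_lipschitz_on (snd c ` fst c) (\<lambda>y. matrix_inv (coord_metric c y) $ i $ j)"
  by (intro loc_lipschitz_on_matrix_inv loc_lipschitz_on_nth loc_lipschitz_on_coord_metric coord_metric_invertible)

text \<open>Supplies uniqueness of Hamiltonian curves, over boundary points too. The field is
  polynomial in the covector, the inverse metric and the derivatives of the metric.\<close>

lemma loc_lipschitz_on_hamiltonian_field:
  assumes c: "c \<in> A"
  shows "loc_lipschitz_on (snd c ` fst c \<times> UNIV) (\<lambda>z. hamiltonian_field g c (fst z) (snd z))"
proof -
  let ?N = "\<lambda>z::(real^'n) \<times> (real^'n). matrix_inv (coord_metric c (fst z))"
  let ?u = "\<lambda>z. \<chi> i. \<Sum>j\<in>UNIV. ?N z $ i $ j * snd z $ j"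
  have D: "loc_lipschitz_on (snd c ` fst c \<times> UNIV) (\<lambda>z. coord_metric_deriv c (fst z) w $ i $ j)" for w i j
    by (intro loc_lipschitz_on_nth loc_lipschitz_on_fst[OF loc_lipschitz_on_coord_metric_deriv[OF c]])
  have "loc_lipschitz_on (snd c ` fst c \<times> UNIV) (\<lambda>z. (2 *\<^sub>R ?u z,
      \<chi> i. \<Sum>j\<in>UNIV. \<Sum>m\<in>UNIV. ?u z $ j * ?u z $ m * coord_metric_deriv c (fst z) (axis i 1) $ j $ m))"
    unfolding vec_lambda_beta
    by (intro loc_lipschitz_intros loc_lipschitz_on_linear_compose[OF bounded_linear_scaleR_right] D
        loc_lipschitz_on_snd loc_lipschitz_on_fst[OF loc_lipschitz_on_inverse_coord_metric[OF c]])
  then show ?thesis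
  proof (rule loc_lipschitz_on_cong)
    fix z assume z: "z \<in> snd c ` fst c \<times> (UNIV :: (real^'n) set)"
    have "?u z = ?N z *v snd z" by (simp add: matrix_vector_mult_def)
    then show "(2 *\<^sub>R ?u z, \<chi> i. \<Sum>j\<in>UNIV. \<Sum>m\<in>UNIV. ?u z $ j * ?u z $ m * coord_metric_deriv c (fst z) (axis i 1) $ j $ m)
        = hamiltonian_field g c (fst z) (snd z)"
      using z by (simp only: inner_matrix_vector_sum hamiltonian_field_eq[OF c] mem_Times_iff)
  qed
qed

text \<open>The geodesic equation as a first-order system in position and velocity, prepared for the
  existence theorem.\<close>

lemma loc_lipschitz_on_geodesic_field:
  assumes c: "c \<in> A"
  shows "loc_lipschitz_on (snd c ` fst c \<times> UNIV)
    (\<lambda>z. (snd z, - christoffel_form g c (param c (fst z)) (snd z) (snd z)))"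
proof -
  have D: "loc_lipschitz_on (snd c ` fst c \<times> UNIV) (\<lambda>z::(real^'n) \<times> (real^'n). coord_metric_deriv c (fst z) w $ i $ j)" for w i j
    by (intro loc_lipschitz_on_nth loc_lipschitz_on_fst[OF loc_lipschitz_on_coord_metric_deriv[OF c]])
  have C: "loc_lipschitz_on (snd c ` fst c \<times> UNIV) (\<lambda>z::(real^'n) \<times> (real^'n). christoffel g c (param c (fst z)) l i j)" for l i j
  proof -
    have "loc_lipschitz_on (snd c ` fst c \<times> UNIV) (\<lambda>z::(real^'n) \<times> (real^'n).
      (\<Sum>m\<in>UNIV. matrix_inv (coord_metric c (fst z)) $ l $ m *
       (coord_metric_deriv c (fst z) (axis i 1) $ j $ m + coord_metric_deriv c (fst z) (axis j 1) $ i $ m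
         - coord_metric_deriv c (fst z) (axis m 1) $ i $ j)) * (1/2))"
      by (intro loc_lipschitz_intros D loc_lipschitz_on_fst[OF loc_lipschitz_on_inverse_coord_metric[OF c]])
    then show ?thesis
    proof (rule loc_lipschitz_on_cong)
      fix z assume z: "z \<in> snd c ` fst c \<times> (UNIV :: (real^'n) set)"
      then have "param c (fst z) \<in> fst c \<and> snd c (param c (fst z)) = fst z" by (intro chart_param) auto
      then show "(\<Sum>m\<in>UNIV. matrix_inv (coord_metric c (fst z)) $ l $ m *
       (coord_metric_deriv c (fst z) (axis i 1) $ j $ m + coord_metric_deriv c (fst z) (axis j 1) $ i $ m
         - coord_metric_deriv c (fst z) (axis m 1) $ i $ j)) * (1/2) = christoffel g c (param c (fst z)) l i j"
        by (simp add: christoffel_def partial_metric[OF c] coord_metric_def)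
    qed
  qed
  show ?thesis
    unfolding christoffel_form_def
    by (intro loc_lipschitz_intros C loc_lipschitz_on_snd)
qed

lemma coord_metric_deriv_form_linear:
  assumes "c \<in> A" "y \<in> snd c ` fst c"
  shows "linear (\<lambda>w. u \<bullet> (coord_metric_deriv c y w *v v))"
  using has_derivative_linear[OF coord_metric_deriv_inner[OF assms]] .

text \<open>Along a curve the base point and the covector vary together, so a derivative of the
  matrix itself is needed; of its values, only the quadratic form matters.\<close>

lemma inverse_coord_metric_has_derivative:
  assumes c: "c \<in> A" and y: "y \<in> snd c ` fst c"
  obtains N' where "((\<lambda>z. matrix_inv (coord_metric c z)) has_derivative N') (at y within snd c ` fst c)"
    "\<And>p w. p \<bullet> (N' w *v p) = - ((matrix_inv (coord_metric c y) *v p) \<bullet>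
        (coord_metric_deriv c y w *v (matrix_inv (coord_metric c y) *v p)))"
proof -
  obtain N' where N': "((\<lambda>z. matrix_inv (coord_metric c z)) has_derivative N') (at y within snd c ` fst c)"
    by (rule inverse_coord_metric_differentiable[OF c y])
  have "((\<lambda>z. p \<bullet> (matrix_inv (coord_metric c z) *v p)) has_derivative (\<lambda>w. p \<bullet> (N' w *v p)))
      (at y within snd c ` fst c)" for p
    by (intro has_derivative_inner_right bounded_linear.has_derivative[OF
          bounded_bilinear.bounded_linear_left[OF bounded_bilinear_matrix_vector_mult] N'])
  from half_space_derivative_unique[OF chart_image_open[OF c] y this
      inverse_coord_metric_form_has_derivative[OF c y]]
  show ?thesis using that[OF N'] by metis
qed

section \<open>The kinetic energy\<close>

text \<open>The Hamiltonian as a function on the cotangent bundle, evaluated in an arbitrary chart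
  around the point.\<close>

definition energy :: "'a \<times> ('a, 'n) covector \<Rightarrow> real" where
  "energy p = (let c = (SOME c. c \<in> A \<and> fst p \<in> fst c)
     in snd p c \<bullet> (inverse_metric g c (fst p) *v snd p c))"

text \<open>Raising the index turns the covector into vectors \<open>u\<close> and \<open>w\<close>
  in the two charts. The transformation of the metric gives J u = w, so no law for the inverse
  matrices has to be derived.\<close>

lemma inverse_metric_form_transform:
  assumes c: "c \<in> A" "x \<in> fst c" and d: "d \<in> A" "x \<in> fst d" and \<xi>: "\<xi> \<in> cotangent_space A x"
  shows "\<xi> c \<bullet> (inverse_metric g c x *v \<xi> c) = \<xi> d \<bullet> (inverse_metric g d x *v \<xi> d)"
proof -
  let ?J = "jacobian_at c d x" and ?K = "jacobian_at d c x"
  define u where "u = inverse_metric g c x *v \<xi> c"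
  define w where "w = inverse_metric g d x *v \<xi> d"
  have gu: "g c x *v u = \<xi> c" and gw: "g d x *v w = \<xi> d"
    using c d by (auto simp: u_def w_def matrix_inv_vector_mult metric_invertible)
  have JK: "?J *v (?K *v b) = b" for b
    using jacobian_inverse[OF d(1) c(1) d(2) c(2)] by (simp add: matrix_vector_mul_assoc)
  have \<xi>c: "\<xi> c \<bullet> b = \<xi> d \<bullet> (?J *v b)" for b
    by (simp only: covector_transform[OF \<xi> c(1) d(1) c(2) d(2)] inner_matrix_transpose[of "\<xi> d"])
  have "b \<bullet> (g d x *v (?J *v u)) = b \<bullet> \<xi> d" for b
    using metric_transform_inner[OF c(1) d(1) c(2) d(2), of "?K *v b" u] \<xi>c[of "?K *v b"]
    by (simp add: JK gu inner_commute)
  then have "g d x *v (?J *v u) = \<xi> d" by (metis vector_eq_ldot)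
  then have "?J *v u = w"
    using matrix_inv_vector_mult(2)[OF metric_invertible[OF d], of "?J *v u"] by (simp add: w_def)
  then show ?thesis using \<xi>c[of u] by (simp add: u_def w_def)
qed

lemma energy_chart:
  assumes c: "c \<in> A" "x \<in> fst c" and \<xi>: "\<xi> \<in> cotangent_space A x"
  shows "energy (x, \<xi>) = \<xi> c \<bullet> (inverse_metric g c x *v \<xi> c)"
proof -
  have "(SOME c. c \<in> A \<and> x \<in> fst c) \<in> A \<and> x \<in> fst (SOME c. c \<in> A \<and> x \<in> fst c)"
    by (rule someI[of _ c]) (use c in auto)
  then show ?thesis unfolding energy_def fst_conv snd_conv Let_def
    by (intro inverse_metric_form_transform c \<xi>) auto
qed

lemma energy_pos:
  assumes c: "c \<in> A" "x \<in> fst c" and \<xi>: "\<xi> \<in> cotangent_space A x" "\<xi> c \<noteq> 0"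
  shows "energy (x, \<xi>) > 0"
proof -
  define u where "u = inverse_metric g c x *v \<xi> c"
  have gu: "g c x *v u = \<xi> c" using c by (simp add: u_def matrix_inv_vector_mult metric_invertible)
  have "u \<noteq> 0" using gu \<xi>(2) by auto
  then have "0 < u \<bullet> (g c x *v u)" by (rule metric_pos[OF c])
  then show ?thesis using energy_chart[OF c \<xi>(1)] gu by (simp add: u_def inner_commute)
qed

section \<open>Hamiltonian curves\<close>

lemma hamiltonian_curve_chart:
  assumes "hamiltonian_curve_on M A g I \<gamma>" "t \<in> I"
  shows "snd (\<gamma> t) \<in> cotangent_space A (fst (\<gamma> t))" "\<exists>c\<in>A. fst (\<gamma> t) \<in> fst c"
proof -
  have *: "\<gamma> t \<in> cotangent_bundle M A" using assms unfolding hamiltonian_curve_on_def by blast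
  then show "snd (\<gamma> t) \<in> cotangent_space A (fst (\<gamma> t))"
    by (cases "\<gamma> t") (simp add: cotangent_bundle_def)
  show "\<exists>c\<in>A. fst (\<gamma> t) \<in> fst c"
    using * by (intro chart_cover) (auto simp: cotangent_bundle_def)
qed

lemma hamiltonian_curve_continuous:
  "hamiltonian_curve_on M A g I \<gamma> \<Longrightarrow> continuous_map (top_of_set I) M (\<lambda>s. fst (\<gamma> s))"
  unfolding hamiltonian_curve_on_def o_def by blast

lemma hamiltonian_curve_eventually_in_chart:
  assumes "hamiltonian_curve_on M A g I \<gamma>" "t \<in> I" "c \<in> A" "fst (\<gamma> t) \<in> fst c"
  shows "\<forall>\<^sub>F s in at t within I. fst (\<gamma> s) \<in> fst c"
  by (rule eventually_in_chart[OF hamiltonian_curve_continuous[OF assms(1)] assms(2-4)])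

lemma hamiltonian_curve_derivative:
  assumes "hamiltonian_curve_on M A g I \<gamma>" "t \<in> I" "c \<in> A" "fst (\<gamma> t) \<in> fst c"
  shows "((\<lambda>s. (snd c (fst (\<gamma> s)), snd (\<gamma> s) c)) has_vector_derivative
    hamiltonian_field g c (snd c (fst (\<gamma> t))) (snd (\<gamma> t) c)) (at t within I)"
  using assms unfolding hamiltonian_curve_on_def by blast

lemma hamiltonian_curve_component_derivatives:
  assumes \<gamma>: "hamiltonian_curve_on M A g I \<gamma>" "t \<in> I" and c: "c \<in> A" "fst (\<gamma> t) \<in> fst c"
  defines "u \<equiv> inverse_metric g c (fst (\<gamma> t)) *v snd (\<gamma> t) c"
  shows "((\<lambda>s. snd c (fst (\<gamma> s))) has_vector_derivative 2 *\<^sub>R u) (at t within I)"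
    and "((\<lambda>s. snd (\<gamma> s) c) has_vector_derivative
      (\<chi> i. u \<bullet> (coord_metric_deriv c (snd c (fst (\<gamma> t))) (axis i 1) *v u))) (at t within I)"
proof -
  have y: "snd c (fst (\<gamma> t)) \<in> snd c ` fst c" using c by auto
  have "((\<lambda>s. (snd c (fst (\<gamma> s)), snd (\<gamma> s) c)) has_vector_derivative
     (2 *\<^sub>R u, \<chi> i. u \<bullet> (coord_metric_deriv c (snd c (fst (\<gamma> t))) (axis i 1) *v u))) (at t within I)"
    using hamiltonian_curve_derivative[OF \<gamma> c]
    by (simp only: hamiltonian_field_eq[OF c(1) y] coord_metric_chart[OF c] u_def)
  from bounded_linear.has_vector_derivative[OF bounded_linear_fst this]
    bounded_linear.has_vector_derivative[OF bounded_linear_snd this]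
  show "((\<lambda>s. snd c (fst (\<gamma> s))) has_vector_derivative 2 *\<^sub>R u) (at t within I)"
    and "((\<lambda>s. snd (\<gamma> s) c) has_vector_derivative
      (\<chi> i. u \<bullet> (coord_metric_deriv c (snd c (fst (\<gamma> t))) (axis i 1) *v u))) (at t within I)"
    by simp_all
qed

text \<open>With u = G^{-1} p the base point moves with velocity 2u, which contributes -2 u . (D_u
  G) u; the change of the covector contributes +2 u . (D_u G) u.\<close>

lemma energy_has_derivative_zero:
  assumes \<gamma>: "hamiltonian_curve_on M A g I \<gamma>" and t: "t \<in> I"
  shows "((\<lambda>s. energy (\<gamma> s)) has_vector_derivative 0) (at t within I)"
proof -
  obtain c where c: "c \<in> A" "fst (\<gamma> t) \<in> fst c" using hamiltonian_curve_chart[OF \<gamma> t] by blast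
  let ?y = "\<lambda>s. snd c (fst (\<gamma> s))" and ?p = "\<lambda>s. snd (\<gamma> s) c"
  let ?N = "\<lambda>z. matrix_inv (coord_metric c z)" and ?D = "coord_metric_deriv c (?y t)"
  define u where "u = inverse_metric g c (fst (\<gamma> t)) *v ?p t"
  have Nt: "?N (?y t) = inverse_metric g c (fst (\<gamma> t))" by (simp add: coord_metric_chart c)
  define p' where "p' = (\<chi> i. u \<bullet> (?D (axis i 1) *v u))"
  have y: "?y t \<in> snd c ` fst c" using c by auto
  note ev = hamiltonian_curve_eventually_in_chart[OF \<gamma> t c]
  have dy: "(?y has_vector_derivative 2 *\<^sub>R u) (at t within I)" and dp: "(?p has_vector_derivative p') (at t within I)"
    using hamiltonian_curve_component_derivatives[OF \<gamma> t c] by (simp_all add: u_def p'_def)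
  obtain N' where N': "(?N has_derivative N') (at (?y t) within snd c ` fst c)"
    and N'p: "\<And>p w. p \<bullet> (N' w *v p) = - ((?N (?y t) *v p) \<bullet> (?D w *v (?N (?y t) *v p)))"
    by (rule inverse_coord_metric_has_derivative[OF c(1) y]) blast
  have "\<forall>\<^sub>F s in at t within I. ?y s \<in> snd c ` fst c" using ev by eventually_elim auto
  from has_vector_derivative_compose_eventually[OF dy N' this t y]
  have "((\<lambda>s. ?N (?y s)) has_vector_derivative N' (2 *\<^sub>R u)) (at t within I)" .
  from has_vector_derivative_matrix_vector_mult[OF this dp]
  have "((\<lambda>s. ?N (?y s) *v ?p s) has_vector_derivative (N' (2 *\<^sub>R u) *v ?p t + ?N (?y t) *v p')) (at t within I)" .
  from bounded_bilinear.has_vector_derivative[OF bounded_bilinear_inner dp this]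
  have "((\<lambda>s. ?p s \<bullet> (?N (?y s) *v ?p s)) has_vector_derivative
      (?p t \<bullet> (N' (2 *\<^sub>R u) *v ?p t + ?N (?y t) *v p') + p' \<bullet> (?N (?y t) *v ?p t))) (at t within I)" .
  moreover have "?p t \<bullet> (N' (2 *\<^sub>R u) *v ?p t + ?N (?y t) *v p') + p' \<bullet> (?N (?y t) *v ?p t) = 0"
  proof -
    have 1: "?p t \<bullet> (N' (2 *\<^sub>R u) *v ?p t) = - (u \<bullet> (?D (2 *\<^sub>R u) *v u))"
      using N'p[of "?p t" "2 *\<^sub>R u"] by (simp add: Nt u_def)
    have 2: "?p t \<bullet> (?N (?y t) *v p') = p' \<bullet> u"
      using inverse_metric_inner_commute[OF c, of "?p t" p'] by (simp add: Nt u_def)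
    have lin: "linear (\<lambda>w. u \<bullet> (?D w *v u))" by (rule coord_metric_deriv_form_linear[OF c(1) y])
    have "p' \<bullet> u = u \<bullet> (?D u *v u)" unfolding p'_def by (rule linear_real_expansion[OF lin])
    moreover have "u \<bullet> (?D (2 *\<^sub>R u) *v u) = 2 * (u \<bullet> (?D u *v u))"
      using linear_scale[OF lin, of 2 u] by simp
    ultimately show ?thesis using 1 2 by (simp add: inner_add_right Nt u_def[symmetric])
  qed
  ultimately have "((\<lambda>s. ?p s \<bullet> (?N (?y s) *v ?p s)) has_vector_derivative 0) (at t within I)" by simp
  moreover have eq: "?p s \<bullet> (?N (?y s) *v ?p s) = energy (\<gamma> s)" if "s \<in> I" "fst (\<gamma> s) \<in> fst c" for s
    using energy_chart[OF c(1) that(2) hamiltonian_curve_chart(1)[OF \<gamma> that(1)]] that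
    by (simp add: coord_metric_chart c)
  have "\<forall>\<^sub>F s in at t within I. s \<in> I" by (simp add: eventually_at_topological) blast
  with ev have "\<forall>\<^sub>F s in at t within I. ?p s \<bullet> (?N (?y s) *v ?p s) = energy (\<gamma> s)"
    by eventually_elim (rule eq)
  ultimately show ?thesis
    unfolding has_vector_derivative_def
    by (rule has_derivative_transform_eventually) (use t c eq in auto)
qed

lemma energy_constant:
  assumes \<gamma>: "hamiltonian_curve_on M A g I \<gamma>" and "s \<in> I" "t \<in> I"
  shows "energy (\<gamma> s) = energy (\<gamma> t)"
proof -
  have "convex I" using \<gamma> by (simp add: hamiltonian_curve_on_def is_interval_convex)
  from has_vector_derivative_zero_constant[OF this energy_has_derivative_zero[OF \<gamma>]]
  show ?thesis using assms by metis
qed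

text \<open>The velocity is 2u with u = G^{-1} p, and the metric evaluated on \<open>u\<close> is
  the energy. Nontriviality of the filter makes the \<open>vector_derivative\<close> in
  \<open>curve_speed\<close> the actual velocity.\<close>

lemma hamiltonian_curve_speed:
  assumes \<gamma>: "hamiltonian_curve_on M A g I \<gamma>" and t: "t \<in> I" and bot: "at t within I \<noteq> bot"
  shows "curve_speed A g I (fst \<circ> \<gamma>) t = 2 * sqrt (energy (\<gamma> t))"
proof -
  \<comment> \<open>The chart has to be the very choice made in \<open>curve_speed\<close>.\<close>
  define c where "c = (SOME c. c \<in> A \<and> fst (\<gamma> t) \<in> fst c)"
  have c: "c \<in> A" "fst (\<gamma> t) \<in> fst c"
    using someI_ex[of "\<lambda>c. c \<in> A \<and> fst (\<gamma> t) \<in> fst c"] hamiltonian_curve_chart(2)[OF \<gamma> t]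
    unfolding c_def by blast+
  define u where "u = inverse_metric g c (fst (\<gamma> t)) *v snd (\<gamma> t) c"
  have gu: "g c (fst (\<gamma> t)) *v u = snd (\<gamma> t) c"
    by (simp add: u_def matrix_inv_vector_mult metric_invertible[OF c])
  have "vector_derivative (snd c \<circ> (fst \<circ> \<gamma>)) (at t within I) = 2 *\<^sub>R u"
    unfolding o_def u_def
    by (rule vector_derivative_within[OF bot hamiltonian_curve_component_derivatives(1)[OF \<gamma> t c]])
  then have "curve_speed A g I (fst \<circ> \<gamma>) t = sqrt ((2 *\<^sub>R u) \<bullet> (g c (fst (\<gamma> t)) *v (2 *\<^sub>R u)))"
    unfolding curve_speed_def Let_def o_apply c_def[symmetric] by simp
  also have "\<dots> = sqrt (2\<^sup>2 * (u \<bullet> (g c (fst (\<gamma> t)) *v u)))"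
    by (simp add: matrix_vector_mult_scaleR power2_eq_square)
  also have "\<dots> = 2 * sqrt (u \<bullet> (g c (fst (\<gamma> t)) *v u))" by (simp only: real_sqrt_mult real_sqrt_abs)
  also have "u \<bullet> (g c (fst (\<gamma> t)) *v u) = energy (\<gamma> t)"
    using energy_chart[OF c hamiltonian_curve_chart(1)[OF \<gamma> t]] unfolding gu
    by (simp add: u_def inner_commute)
  finally show ?thesis .
qed

text \<open>Energy is conserved, so the speed is constant and the signed length is proportional to
  the time; for negative \<open>t\<close> the factor \<open>sgn t\<close> restores the sign.\<close>

lemma hamiltonian_curve_length:
  assumes \<gamma>: "hamiltonian_curve_on M A g (closed_segment 0 t) \<gamma>"
  shows "sgn t * curve_length A g (closed_segment 0 t) (fst \<circ> \<gamma>) = 2 * t * sqrt (energy (\<gamma> 0))"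
\<comment> \<open>For \<open>t = 0\<close> the segment is a point, where velocities are not
  determined, but \<open>sgn 0 = 0\<close> settles the claim.\<close>
proof (cases "t = 0")
  case False
  have "at s within closed_segment 0 t \<noteq> bot" if "s \<in> closed_segment 0 t" for s
    using False by (intro at_within_interval_neq_bot[OF _ that] bexI[of _ 0] bexI[of _ t])
      (auto simp: is_interval_convex_1)
  then have "curve_speed A g (closed_segment 0 t) (fst \<circ> \<gamma>) s = 2 * sqrt (energy (\<gamma> 0))"
    if "s \<in> closed_segment 0 t" for s
    using hamiltonian_curve_speed[OF \<gamma> that] energy_constant[OF \<gamma> that ends_in_segment(1)] that by simp
  then have "curve_length A g (closed_segment 0 t) (fst \<circ> \<gamma>)
      = integral (closed_segment 0 t) (\<lambda>s. 2 * sqrt (energy (\<gamma> 0)))"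
    unfolding curve_length_def
    by (intro Henstock_Kurzweil_Integration.integral_cong)
  also have "\<dots> = \<bar>t\<bar> * (2 * sqrt (energy (\<gamma> 0)))"
    by (simp add: closed_segment_eq_real_ivl content_real abs_if)
  finally show ?thesis by (simp add: sgn_if)
qed simp

text \<open>On the connected parameter interval the set of agreement is open by local uniqueness for
  the differential equation in a chart. It is closed because covectors can be separated: distinct
  base points by the Hausdorff property, distinct covectors over one point by their continuous
  components in a common chart.\<close>

lemma hamiltonian_curve_unique:
  assumes \<gamma>1: "hamiltonian_curve_on M A g I \<gamma>1" and \<gamma>2: "hamiltonian_curve_on M A g I \<gamma>2"
    and s0: "s0 \<in> I" "\<gamma>1 s0 = \<gamma>2 s0" and s: "s \<in> I"
  shows "\<gamma>1 s = \<gamma>2 s"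
proof -
  let ?E = "{s \<in> I. \<gamma>1 s = \<gamma>2 s}"
  have I: "is_interval I" using \<gamma>1 by (simp add: hamiltonian_curve_on_def)
  have evI: "\<forall>\<^sub>F s in at t within I. s \<in> I" for t by (simp add: eventually_at_topological) blast
  have op: "openin (top_of_set I) ?E"
  proof (rule openin_eventually_at)
    fix t assume "t \<in> ?E"
    then have t: "t \<in> I" "\<gamma>1 t = \<gamma>2 t" by auto
    obtain c where c1: "c \<in> A" "fst (\<gamma>1 t) \<in> fst c" using hamiltonian_curve_chart[OF \<gamma>1 t(1)] by blast
    then have c2: "fst (\<gamma>2 t) \<in> fst c" using t by simp
    let ?z = "\<lambda>\<gamma> s. (snd c (fst (\<gamma> s)), snd (\<gamma> s) c)"
    let ?F = "\<lambda>z. hamiltonian_field g c (fst z) (snd z)"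
    have ev: "\<forall>\<^sub>F s in at t within I. s \<in> I \<and> fst (\<gamma> s) \<in> fst c \<and> ?z \<gamma> s \<in> snd c ` fst c \<times> UNIV
        \<and> (?z \<gamma> has_vector_derivative ?F (?z \<gamma> s)) (at s within I)"
      if "hamiltonian_curve_on M A g I \<gamma>" "fst (\<gamma> t) \<in> fst c" for \<gamma>
      using evI hamiltonian_curve_eventually_in_chart[OF that(1) t(1) c1(1) that(2)]
      by eventually_elim (use hamiltonian_curve_derivative[OF that(1) _ c1(1)] in auto)
    have "\<forall>\<^sub>F s in at t within I. ?z \<gamma>1 s = ?z \<gamma>2 s"
    proof (rule ode_local_uniqueness[OF I t(1) loc_lipschitz_on_hamiltonian_field[OF c1(1)]])
      show "\<forall>\<^sub>F s in at t within I. ?z \<gamma>1 s \<in> snd c ` fst c \<times> UNIV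
        \<and> (?z \<gamma>1 has_vector_derivative ?F (?z \<gamma>1 s)) (at s within I)"
        using ev[OF \<gamma>1 c1(2)] by eventually_elim blast
      show "\<forall>\<^sub>F s in at t within I. ?z \<gamma>2 s \<in> snd c ` fst c \<times> UNIV
        \<and> (?z \<gamma>2 has_vector_derivative ?F (?z \<gamma>2 s)) (at s within I)"
        using ev[OF \<gamma>2 c2] by eventually_elim blast
      show "(?z \<gamma>1 has_vector_derivative ?F (?z \<gamma>1 t)) (at t within I)"
        using hamiltonian_curve_derivative[OF \<gamma>1 t(1) c1] by simp
      show "(?z \<gamma>2 has_vector_derivative ?F (?z \<gamma>2 t)) (at t within I)"
        using hamiltonian_curve_derivative[OF \<gamma>2 t(1) c1(1) c2] by simp
    qed (use c1 t in auto)
    with ev[OF \<gamma>1 c1(2)] ev[OF \<gamma>2 c2] show "\<forall>\<^sub>F s in at t within I. s \<in> ?E"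
    proof eventually_elim
      case (elim s)
      have "fst (\<gamma>1 s) = fst (\<gamma>2 s)" using elim chart_inj[OF c1(1)] by (auto dest: inj_onD)
      moreover have "snd (\<gamma>1 s) = snd (\<gamma>2 s)"
        using elim calculation hamiltonian_curve_chart(1)[OF \<gamma>1, of s] hamiltonian_curve_chart(1)[OF \<gamma>2, of s]
        by (intro covector_eqI[OF _ _ c1(1), of _ "fst (\<gamma>1 s)"]) auto
      ultimately show ?case using elim by (simp add: prod_eq_iff)
    qed
  qed auto
  have "openin (top_of_set I) (I - ?E)"
  proof (rule openin_eventually_at)
    fix t assume "t \<in> I - ?E"
    then have t: "t \<in> I" "\<gamma>1 t \<noteq> \<gamma>2 t" by auto
    show "\<forall>\<^sub>F s in at t within I. s \<in> I - ?E"
    proof (cases "fst (\<gamma>1 t) = fst (\<gamma>2 t)")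
      case False
      have "fst (\<gamma>1 t) \<in> topspace M" "fst (\<gamma>2 t) \<in> topspace M"
        using hamiltonian_curve_chart(2)[OF \<gamma>1 t(1)] hamiltonian_curve_chart(2)[OF \<gamma>2 t(1)] chart_topspace by blast+
      then obtain U V where UV: "openin M U" "openin M V" "fst (\<gamma>1 t) \<in> U" "fst (\<gamma>2 t) \<in> V" "disjnt U V"
        using Hausdorff False unfolding Hausdorff_space_def by blast
      have "\<forall>\<^sub>F s in at t within I. fst (\<gamma>1 s) \<in> U" "\<forall>\<^sub>F s in at t within I. fst (\<gamma>2 s) \<in> V"
        using eventually_continuous_map_at[OF hamiltonian_curve_continuous[OF \<gamma>1] t(1) UV(1,3)]
          eventually_continuous_map_at[OF hamiltonian_curve_continuous[OF \<gamma>2] t(1) UV(2,4)] .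
      with evI show ?thesis by eventually_elim (use UV(5) in \<open>auto simp: disjnt_iff\<close>)
    next
      case True
      obtain c where c: "c \<in> A" "fst (\<gamma>1 t) \<in> fst c" using hamiltonian_curve_chart[OF \<gamma>1 t(1)] by blast
      have "snd (\<gamma>1 t) c \<noteq> snd (\<gamma>2 t) c"
        using covector_eqI[OF hamiltonian_curve_chart(1)[OF \<gamma>1 t(1)] _ c] hamiltonian_curve_chart(1)[OF \<gamma>2 t(1)] True t(2)
        by (auto simp: prod_eq_iff)
      moreover have "((\<lambda>s. snd (\<gamma>1 s) c - snd (\<gamma>2 s) c) \<longlongrightarrow> snd (\<gamma>1 t) c - snd (\<gamma>2 t) c) (at t within I)"
        using has_vector_derivative_continuous[OF hamiltonian_curve_component_derivatives(2)[OF \<gamma>1 t(1) c]]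
          has_vector_derivative_continuous[OF hamiltonian_curve_component_derivatives(2)[OF \<gamma>2 t(1) c(1)]] c True
        by (intro tendsto_diff) (auto simp: continuous_within)
      ultimately have "\<forall>\<^sub>F s in at t within I. snd (\<gamma>1 s) c - snd (\<gamma>2 s) c \<noteq> 0"
        by (intro tendsto_imp_eventually_ne) auto
      with evI show ?thesis by eventually_elim auto
    qed
  qed auto
  then have "closedin (top_of_set I) ?E" by (simp add: closedin_def)
  with op s0 have "?E = I"
    using is_interval_connected[OF I] unfolding connected_clopen by blast
  then show ?thesis using s by auto
qed

section \<open>The flow parametrized by length\<close>

lemma flows_to_energy:
  assumes "flows_to M A g p l q"
  shows "energy p = energy q"
  using assms energy_constant unfolding flows_to_def by (metis ends_in_segment)

text \<open>Positive energy lets the length determine the time, and uniqueness of curves then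
  determines the end; this justifies the definite description.\<close>

lemma length_flow_eq:
  assumes p: "energy p > 0" and q: "flows_to M A g p l q"
  shows "length_flow M A g p l = q"
  unfolding length_flow_def
proof (rule the_equality, rule q)
  \<comment> \<open>The time obtained by solving the proportionality between signed length and
    time.\<close>
  let ?t = "l / (2 * sqrt (energy p))"
  have *: "\<exists>\<gamma>. hamiltonian_curve_on M A g (closed_segment 0 ?t) \<gamma> \<and> \<gamma> 0 = p \<and> \<gamma> ?t = q'"
    if q': "flows_to M A g p l q'" for q'
  proof -
    obtain t \<gamma> where \<gamma>: "hamiltonian_curve_on M A g (closed_segment 0 t) \<gamma>" "\<gamma> 0 = p" "\<gamma> t = q'"
      and l: "l = sgn t * curve_length A g (closed_segment 0 t) (fst \<circ> \<gamma>)"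
      using q' unfolding flows_to_def by blast
    have "l = 2 * t * sqrt (energy p)" using hamiltonian_curve_length[OF \<gamma>(1)] l \<gamma>(2) by simp
    then have "t = ?t" using p by simp
    then show ?thesis using \<gamma> by metis
  qed
  fix q' assume "flows_to M A g p l q'"
  then obtain \<gamma>1 \<gamma>2 where
    1: "hamiltonian_curve_on M A g (closed_segment 0 ?t) \<gamma>1" "\<gamma>1 0 = p" "\<gamma>1 ?t = q'" and
    2: "hamiltonian_curve_on M A g (closed_segment 0 ?t) \<gamma>2" "\<gamma>2 0 = p" "\<gamma>2 ?t = q"
    using * q by blast
  have "\<gamma>1 ?t = \<gamma>2 ?t"
    by (rule hamiltonian_curve_unique[OF 1(1) 2(1), of 0]) (simp_all add: 1 2)
  then show "q' = q" by (simp only: 1 2)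
qed

section \<open>The Hamiltonian lift of a geodesic\<close>

text \<open>The factor 1/2 inverts y' = 2 G^{-1} p. For velocity w the derivative of G w / 2 is
  ((D_w G) w - G \<Gamma>(w, w)) / 2, and the Koszul formula reduces its pairing with a to w . (D_a
  G) w / 4, which is Hamilton's second equation for u = w/2. The last conclusion speaks of an
  arbitrary velocity because \<open>geodesic_on\<close> only asserts that a velocity exists.\<close>

lemma geodesic_lift:
  assumes geo: "geodesic_on M A g I x" and nd: "\<exists>a\<in>I. \<exists>b\<in>I. a \<noteq> b"
  obtains \<gamma> where "hamiltonian_curve_on M A g I \<gamma>" "\<And>t. fst (\<gamma> t) = x t"
    "\<And>t c v. t \<in> I \<Longrightarrow> c \<in> A \<Longrightarrow> x t \<in> fst c \<Longrightarrow> ((\<lambda>s. snd c (x s)) has_vector_derivative v) (at t within I) \<Longrightarrow>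
      snd (\<gamma> t) c = (1/2) *\<^sub>R (g c (x t) *v v)"
proof -
  have I: "is_interval I" and x: "continuous_map (top_of_set I) M x" using geo by (auto simp: geodesic_on_def)
  have bot: "at t within I \<noteq> bot" if "t \<in> I" for t by (rule at_within_interval_neq_bot[OF I that nd])
  obtain v where v: "\<And>c t. c \<in> A \<Longrightarrow> t \<in> I \<Longrightarrow> x t \<in> fst c \<Longrightarrow> ((\<lambda>s. snd c (x s)) has_vector_derivative v c t) (at t within I)"
    and v': "\<And>c t. c \<in> A \<Longrightarrow> t \<in> I \<Longrightarrow> x t \<in> fst c \<Longrightarrow>
        (v c has_vector_derivative - christoffel_form g c (x t) (v c t) (v c t)) (at t within I)"
    using geo unfolding geodesic_on_def by blast
  \<comment> \<open>The zeros for other charts are what membership in \<open>cotangent_space\<close>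
    demands.\<close>
  define \<gamma> where "\<gamma> s = (x s, \<lambda>c. if c \<in> A \<and> x s \<in> fst c then (1/2) *\<^sub>R (g c (x s) *v v c s) else 0)" for s
  have \<gamma>1: "fst (\<gamma> s) = x s" for s by (simp add: \<gamma>_def)
  have \<gamma>2: "snd (\<gamma> s) c = (1/2) *\<^sub>R (g c (x s) *v v c s)" if "c \<in> A" "x s \<in> fst c" for s c
    using that by (simp add: \<gamma>_def)
  have "snd (\<gamma> t) \<in> cotangent_space A (x t)" if t: "t \<in> I" for t
    unfolding cotangent_space_def mem_Collect_eq
  proof (intro conjI ballI allI impI)
    fix c d assume c: "c \<in> A" and d: "d \<in> A" and "x t \<in> fst c \<inter> fst d"
    then have xc: "x t \<in> fst c" and xd: "x t \<in> fst d" by auto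
    have vd: "v d t = jacobian_at c d (x t) *v v c t"
      by (rule vector_derivative_unique_within[OF bot[OF t] v[OF d t xd]
            chart_change_velocity[OF x t c xc d xd v[OF c t xc]]])
    have "g c (x t) *v v c t = transpose (jacobian_at c d (x t)) *v (g d (x t) *v v d t)"
      by (simp only: metric_transform[OF c d xc xd] vd matrix_vector_mul_assoc matrix_mul_assoc)
    then show "snd (\<gamma> t) c = transpose (jacobian_at c d (x t)) *v snd (\<gamma> t) d"
      by (simp only: \<gamma>2 c d xc xd matrix_vector_mult_scaleR)
  next
    fix c assume "c \<notin> A \<or> x t \<notin> fst c"
    then show "snd (\<gamma> t) c = 0" by (auto simp: \<gamma>_def)
  qed
  moreover have "x t \<in> topspace M" if "t \<in> I" for t
    using continuous_map_image_subset_topspace[OF x] that by auto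
  ultimately have cot: "\<gamma> t \<in> cotangent_bundle M A" if "t \<in> I" for t
    using that by (simp add: cotangent_bundle_def \<gamma>_def)
  have der: "((\<lambda>s. (snd c (fst (\<gamma> s)), snd (\<gamma> s) c)) has_vector_derivative
           hamiltonian_field g c (snd c (fst (\<gamma> t))) (snd (\<gamma> t) c)) (at t within I)"
    if c: "c \<in> A" and t: "t \<in> I" and xc: "x t \<in> fst c" for c t
  proof -
    let ?y = "\<lambda>s. snd c (x s)" and ?D = "coord_metric_deriv c (snd c (x t))"
    let ?w = "v c t"
    have y: "?y t \<in> snd c ` fst c" using xc by auto
    define u where "u = (1/2) *\<^sub>R ?w"
    have Np: "matrix_inv (coord_metric c (?y t)) *v snd (\<gamma> t) c = u"
      by (simp add: \<gamma>2 c xc coord_metric_chart matrix_vector_mult_scaleR matrix_inv_vector_mult metric_invertible u_def)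
    note ev = eventually_in_chart[OF x t c xc]
    have "\<forall>\<^sub>F s in at t within I. ?y s \<in> snd c ` fst c" using ev by eventually_elim auto
    from has_vector_derivative_compose_eventually[OF v[OF c t xc] coord_metric_has_derivative[OF c y] this t y]
    have "((\<lambda>s. coord_metric c (?y s)) has_vector_derivative ?D ?w) (at t within I)" .
    from has_vector_derivative_matrix_vector_mult[OF this v'[OF c t xc]]
    have "((\<lambda>s. (1/2) *\<^sub>R (coord_metric c (?y s) *v v c s)) has_vector_derivative
       (1/2) *\<^sub>R (?D ?w *v ?w + coord_metric c (?y t) *v (- christoffel_form g c (x t) ?w ?w))) (at t within I)"
      by (rule bounded_linear.has_vector_derivative[OF bounded_linear_scaleR_right])
    moreover have "(1/2) *\<^sub>R (?D ?w *v ?w + coord_metric c (?y t) *v (- christoffel_form g c (x t) ?w ?w))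
       = (\<chi> i. u \<bullet> (?D (axis i 1) *v u))" (is "?l = ?r")
    proof -
      have "a \<bullet> ?l = a \<bullet> ?r" for a
      proof -
        have "a \<bullet> ?r = u \<bullet> (?D a *v u)"
          using linear_real_expansion[OF coord_metric_deriv_form_linear[OF c y], of u u a]
          by (simp add: inner_commute)
        also have "\<dots> = (?w \<bullet> (?D a *v ?w)) / 4" by (simp add: u_def matrix_vector_mult_scaleR)
        finally have r: "a \<bullet> ?r = (?w \<bullet> (?D a *v ?w)) / 4" .
        have "a \<bullet> ?l = (a \<bullet> (?D ?w *v ?w) - a \<bullet> (g c (x t) *v christoffel_form g c (x t) ?w ?w)) / 2"
          by (simp add: coord_metric_chart c xc inner_add_right bounded_bilinear.minus_right[OF bounded_bilinear_matrix_vector_mult] inner_diff_right)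
        also have "\<dots> = (?w \<bullet> (?D a *v ?w)) / 4"
          unfolding christoffel_form_inner[OF c xc] coord_metric_deriv_commute[OF c y, of a] by (simp add: field_simps)
        finally show ?thesis using r by simp
      qed
      then show ?thesis by (metis vector_eq_ldot)
    qed
    ultimately have "((\<lambda>s. (1/2) *\<^sub>R (coord_metric c (?y s) *v v c s)) has_vector_derivative
       (\<chi> i. u \<bullet> (?D (axis i 1) *v u))) (at t within I)" by simp
    moreover have "\<forall>\<^sub>F s in at t within I. (1/2) *\<^sub>R (coord_metric c (?y s) *v v c s) = snd (\<gamma> s) c"
      using ev by eventually_elim (simp add: \<gamma>2 c coord_metric_chart)
    ultimately have p': "((\<lambda>s. snd (\<gamma> s) c) has_vector_derivative (\<chi> i. u \<bullet> (?D (axis i 1) *v u))) (at t within I)"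
      unfolding has_vector_derivative_def
      by (rule has_derivative_transform_eventually) (use t xc in \<open>auto simp: \<gamma>2 c coord_metric_chart\<close>)
    have "(?y has_vector_derivative 2 *\<^sub>R u) (at t within I)" using v[OF c t xc] by (simp add: u_def)
    from has_vector_derivative_Pair[OF this p'] show ?thesis
      by (simp only: hamiltonian_field_eq[OF c y] Np \<gamma>1)
  qed
  have "hamiltonian_curve_on M A g I \<gamma>"
    unfolding hamiltonian_curve_on_def
    using I x cot der by (auto simp: o_def \<gamma>1)
  moreover have "snd (\<gamma> t) c = (1/2) *\<^sub>R (g c (x t) *v w)"
    if "t \<in> I" "c \<in> A" "x t \<in> fst c" "((\<lambda>s. snd c (x s)) has_vector_derivative w) (at t within I)" for t c w
    using vector_derivative_unique_within[OF bot[OF that(1)] v[OF that(2,1,3)] that(4)] \<gamma>2[OF that(2,3)] by simp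
  ultimately show ?thesis using that \<gamma>1 by blast
qed

end

section \<open>Local existence of geodesics\<close>

context manifold_with_boundary
begin

lemma param_continuous:
  assumes c: "c \<in> A"
  shows "continuous_map (top_of_set (snd c ` fst c)) M (param c)"
proof -
  obtain f where f: "homeomorphic_maps (subtopology M (fst c)) (top_of_set (snd c ` fst c)) (snd c) f"
    using chart_homeomorphic[OF c] by (auto simp: homeomorphic_map_maps)
  then have "continuous_map (top_of_set (snd c ` fst c)) M f"
    by (auto simp: homeomorphic_maps_def intro: continuous_map_into_fulltopology)
  moreover have "f y = param c y" if "y \<in> snd c ` fst c" for y
  proof -
    have "\<forall>x\<in>topspace M \<inter> fst c. f (snd c x) = x" using f by (simp add: homeomorphic_maps_def)
    then have "f (snd c (param c y)) = param c y" using chart_param[OF that] chart_topspace[OF c] by blast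
    then show ?thesis using chart_param[OF that] by simp
  qed
  ultimately show ?thesis by (rule continuous_map_eq) simp
qed

text \<open>Off the boundary the image is open in the whole space, so unrestricted derivatives and
  the existence theorem become available.\<close>

lemma interior_image_open:
  assumes c: "c \<in> A" and U: "openin M U" "U \<subseteq> fst c"
  shows "open (snd c ` U \<inter> {y. 0 < y $ k})"
proof -
  obtain W where W: "open W" "snd c ` U = half_space k \<inter> W"
    using chart_subset_image_open[OF c U] by (auto simp: openin_open)
  have "snd c ` U \<inter> {y. 0 < y $ k} = W \<inter> {y. 0 < y $ k}"
    using W by (auto simp: half_space_def)
  then show ?thesis using W by (simp add: open_Int open_halfspace_component_gt_cart)
qed

text \<open>The derivative of the Jacobian is the second derivative of the transition map, and its
  symmetry is Schwarz's theorem for a smooth extension. Positivity of coordinate \<open>k\<close>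
  gives an open set on which extension and transition map coincide.\<close>

lemma jacobian_has_derivative:
  assumes c: "c \<in> A" "x \<in> fst c" and d: "d \<in> A" "x \<in> fst d" and pos: "0 < snd c x $ k"
  obtains J' where "((\<lambda>y. jacobian_at c d (param c y)) has_derivative J') (at (snd c x))"
    "\<And>a b. J' a *v b = J' b *v a"
proof -
  let ?S = "snd c ` (fst c \<inter> fst d)"
  let ?O = "?S \<inter> {y. 0 < y $ k}"
  let ?J = "\<lambda>y. jacobian_at c d (param c y)"
  have xS: "snd c x \<in> ?S" using c d by auto
  have S: "openin (top_of_set (half_space k)) ?S" by (rule overlap_image_open[OF c(1) d(1)])
  obtain U F F' where U: "open U" "snd c x \<in> U"
    "\<And>y. y \<in> U \<Longrightarrow> (F has_derivative F' y) (at y)" "\<And>w. C_k_on (Suc 0) U (\<lambda>y. F' y w)"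
    "\<And>y. y \<in> U \<inter> ?S \<Longrightarrow> (transition c d has_derivative F' y) (at y within ?S)"
    by (rule smooth_on_local_extension[OF transition_smooth[OF c(1) d(1)] xS]) blast
  \<comment> \<open>The second layer of \<open>C_k_on\<close>: \<open>Q w y\<close> is the
    derivative at \<open>y\<close> of the first derivative in direction \<open>w\<close>.\<close>
  obtain Q where Q: "\<And>w y. y \<in> U \<Longrightarrow> ((\<lambda>y. F' y w) has_derivative Q w y) (at y)"
    and Qc: "\<And>w v. continuous_on U (\<lambda>y. Q w y v)"
    using U(4) unfolding C_k_on.simps by metis
  have sym: "Q v y w = Q w y v" if "y \<in> U" for y v w
    by (rule symmetric_second_derivative[OF U(1) that U(3) Q Qc])
  have O: "open ?O" using c d by (intro interior_image_open openin_Int chart_open) auto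
  have J: "?J y *v a = F' y a" if y: "y \<in> U \<inter> ?O" for y a
  proof -
    have x: "param c y \<in> fst c \<inter> fst d" "snd c (param c y) = y" using y c by auto
    have "(transition c d has_derivative (*v) (?J y)) (at y within ?S)"
      using transition_has_derivative[OF c(1) d(1) x(1)] x(2) by simp
    from half_space_derivative_unique[OF S _ this U(5)] show ?thesis using y by (auto dest: fun_cong)
  qed
  have der: "((\<lambda>y. ?J y *v a) has_derivative Q a (snd c x)) (at (snd c x))" for a
  proof (rule has_derivative_transform_within_open[OF Q[OF U(2)]])
    show "open (U \<inter> ?O)" using U(1) O by (rule open_Int)
    show "snd c x \<in> U \<inter> ?O" using U(2) xS pos by auto
  qed (simp add: J)
  \<comment> \<open>So far each column has its own derivative; the entries assemble them into one
    derivative of the matrix.\<close>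
  have "?J differentiable (at (snd c x))"
  proof (rule differentiable_matrixI)
    fix i j
    have "((\<lambda>y. (?J y *v axis j 1) $ i) has_derivative (\<lambda>h. Q (axis j 1) (snd c x) h $ i)) (at (snd c x))"
      by (rule bounded_linear.has_derivative[OF bounded_linear_vec_nth der])
    then show "(\<lambda>y. ?J y $ i $ j) differentiable at (snd c x)"
      by (auto simp: matrix_vector_mul_component inner_axis differentiable_def)
  qed
  then obtain J' where J': "(?J has_derivative J') (at (snd c x))" by (auto simp: differentiable_def)
  have "((\<lambda>y. ?J y *v a) has_derivative (\<lambda>h. J' h *v a)) (at (snd c x))" for a
    by (rule bounded_linear.has_derivative[OF
          bounded_bilinear.bounded_linear_left[OF bounded_bilinear_matrix_vector_mult] J'])
  from has_derivative_unique[OF this der] have "J' h *v a = Q a (snd c x) h" for h a by metis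
  then show ?thesis using that[OF J'] sym[OF U(2)] by simp
qed

end

context riemannian_manifold
begin

text \<open>The transformation law of the Christoffel symbols: differentiating
  \<open>g\<^sub>c(a, b) = g\<^sub>d(J a, J b)\<close> expresses \<open>J \<Gamma>\<^sub>c\<close> through \<open>\<Gamma>\<^sub>d\<close> and \<open>J'\<close>, where the symmetry
  of \<open>J'\<close> cancels the remaining terms.\<close>

lemma christoffel_transform:
  assumes c: "c \<in> A" "x \<in> fst c" and d: "d \<in> A" "x \<in> fst d" and pos: "0 < snd c x $ k"
    and J': "((\<lambda>y. jacobian_at c d (param c y)) has_derivative J') (at (snd c x))"
    and sym: "\<And>a b. J' a *v b = J' b *v a"
  defines "J \<equiv> jacobian_at c d x"
  shows "J *v christoffel_form g c x w w = J' w *v w + christoffel_form g d x (J *v w) (J *v w)"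
proof -
  let ?S = "snd c ` (fst c \<inter> fst d)"
  let ?O = "?S \<inter> {y. 0 < y $ k}"
  let ?J = "\<lambda>y. jacobian_at c d (param c y)"
  let ?y = "snd c x" and ?T = "transition c d"
  define D where "D = coord_metric_deriv c ?y"
  define E where "E = coord_metric_deriv d (snd d x)"
  have O: "open ?O" using c d by (intro interior_image_open openin_Int chart_open) auto
  have yO: "?y \<in> ?O" using c d pos by auto
  have Jy: "?J ?y = J" using c by (simp add: J_def)
  have yd: "snd d x \<in> snd d ` fst d" and yc: "?y \<in> snd c ` fst c" using c d by auto
  note gd_sym = metric_inner_commute[OF d]
  have T: "(?T has_derivative (*v) J) (at ?y)"
  proof -
    have "(?T has_derivative (*v) J) (at ?y within ?O)"
      unfolding J_def by (rule has_derivative_subset[OF transition_has_derivative]) (use c d in auto)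
    then show ?thesis using at_within_open[OF yO O] by simp
  qed
  have Ty: "?T ?y = snd d x" using c by (simp add: transition_chart)
  have evO: "\<forall>\<^sub>F y in at ?y. y \<in> ?O" using O yO by (auto simp: eventually_at_topological)
  then have "\<forall>\<^sub>F y in at ?y. ?T y \<in> snd d ` fst d"
    by eventually_elim (use c in \<open>auto simp: transition_chart\<close>)
  then have GT: "((\<lambda>y. coord_metric d (?T y)) has_derivative (\<lambda>z. E (J *v z))) (at ?y)"
    using has_derivative_compose_eventually[OF T, of "coord_metric d" E "snd d ` fst d"]
      coord_metric_has_derivative[OF d(1) yd] yd unfolding Ty E_def by auto
  have Ja: "((\<lambda>y. ?J y *v a) has_derivative (\<lambda>z. J' z *v a)) (at ?y)" for a
    by (rule bounded_linear.has_derivative[OF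
          bounded_bilinear.bounded_linear_left[OF bounded_bilinear_matrix_vector_mult] J'])
  have key: "a \<bullet> (D z *v b) = (J *v a) \<bullet> (g d x *v (J' z *v b) + E (J *v z) *v (J *v b))
      + (J' z *v a) \<bullet> (g d x *v (J *v b))" for a b z
  proof -
    have "((\<lambda>y. a \<bullet> (coord_metric c y *v b)) has_derivative (\<lambda>z. a \<bullet> (D z *v b))) (at ?y within ?O)"
      unfolding D_def by (rule has_derivative_subset[OF coord_metric_deriv_inner[OF c(1) yc]]) auto
    then have 1: "((\<lambda>y. a \<bullet> (coord_metric c y *v b)) has_derivative (\<lambda>z. a \<bullet> (D z *v b))) (at ?y)"
      using at_within_open[OF yO O] by simp
    have "((\<lambda>y. (?J y *v a) \<bullet> (coord_metric d (?T y) *v (?J y *v b))) has_derivative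
        (\<lambda>z. (?J ?y *v a) \<bullet> (coord_metric d (?T ?y) *v (J' z *v b) + E (J *v z) *v (?J ?y *v b))
         + (J' z *v a) \<bullet> (coord_metric d (?T ?y) *v (?J ?y *v b)))) (at ?y)"
      by (intro has_derivative_inner bounded_bilinear.FDERIV[OF bounded_bilinear_matrix_vector_mult] GT Ja)
    then have "((\<lambda>y. a \<bullet> (coord_metric c y *v b)) has_derivative
        (\<lambda>z. (?J ?y *v a) \<bullet> (coord_metric d (?T ?y) *v (J' z *v b) + E (J *v z) *v (?J ?y *v b))
         + (J' z *v a) \<bullet> (coord_metric d (?T ?y) *v (?J ?y *v b)))) (at ?y)"
    proof (rule has_derivative_transform_within_open[OF _ O yO])
      fix y assume "y \<in> ?O"
      then obtain x' where x': "x' \<in> fst c" "x' \<in> fst d" "y = snd c x'" by auto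
      then show "(?J y *v a) \<bullet> (coord_metric d (?T y) *v (?J y *v b)) = a \<bullet> (coord_metric c y *v b)"
        using metric_transform_inner[OF c(1) d(1) x'(1,2), of a b] c d
        by (simp add: transition_chart coord_metric_chart)
    qed
    from has_derivative_unique[OF 1 this] show ?thesis
      using d by (simp add: Jy Ty coord_metric_chart fun_eq_iff)
  qed
  have main: "(J *v e) \<bullet> (g d x *v (J *v christoffel_form g c x w w))
      = (J *v e) \<bullet> (g d x *v (J' w *v w + christoffel_form g d x (J *v w) (J *v w)))" for e
  proof -
    have "(J *v e) \<bullet> (g d x *v (J *v christoffel_form g c x w w)) = e \<bullet> (g c x *v christoffel_form g c x w w)"
      unfolding J_def by (rule metric_transform_inner[OF c(1) d(1) c(2) d(2), symmetric])
    also have "\<dots> = (2 * (w \<bullet> (D w *v e)) - w \<bullet> (D e *v w)) / 2"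
      unfolding christoffel_form_inner[OF c] D_def by simp
    \<comment> \<open>Both derivatives of the metric contain 2 g(J w, J' w e), once written with
      \<open>J' e *v w\<close>. These cancel by symmetry, and g(J' w w, J e) survives.\<close>
    also have "\<dots> = (J' w *v w) \<bullet> (g d x *v (J *v e)) +
        (2 * ((J *v w) \<bullet> (E (J *v w) *v (J *v e))) - (J *v w) \<bullet> (E (J *v e) *v (J *v w))) / 2"
      using key[of w w e] key[of w e w] sym[of e w] gd_sym[of "J' w *v e" "J *v w"]
      by (simp add: inner_add_right)
    also have "(2 * ((J *v w) \<bullet> (E (J *v w) *v (J *v e))) - (J *v w) \<bullet> (E (J *v e) *v (J *v w))) / 2
        = (J *v e) \<bullet> (g d x *v christoffel_form g d x (J *v w) (J *v w))"
      unfolding christoffel_form_inner[OF d] E_def by simp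
    finally show ?thesis
      using gd_sym[of "J' w *v w" "J *v e"] by (simp add: matrix_vector_right_distrib inner_add_right)
  qed
  \<comment> \<open>\<open>J\<close> is onto, so testing against the vectors \<open>J *v e\<close>
    is testing against all vectors.\<close>
  have JK: "J *v (jacobian_at d c x *v b) = b" for b
    using jacobian_inverse[OF d(1) c(1) d(2) c(2)] by (simp add: J_def matrix_vector_mul_assoc)
  have "b \<bullet> (g d x *v (J *v christoffel_form g c x w w))
      = b \<bullet> (g d x *v (J' w *v w + christoffel_form g d x (J *v w) (J *v w)))" for b
    using main[of "jacobian_at d c x *v b"] by (simp only: JK)
  then have "g d x *v (J *v christoffel_form g c x w w)
      = g d x *v (J' w *v w + christoffel_form g d x (J *v w) (J *v w))" by (metis vector_eq_ldot)
  then show ?thesis by (metis matrix_inv_vector_mult(2)[OF metric_invertible[OF d]])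
qed

text \<open>The system is solved over the interior part of one chart. The curve may meet any number
  of other charts, and \<open>geodesic_on\<close> demands the equation in each of them; the
  transformation law of the Christoffel form provides it.\<close>

lemma local_geodesic:
  assumes c: "c \<in> A" "x0 \<in> fst c" and pos: "0 < snd c x0 $ k"
  obtains h x where "h > 0" "x 0 = x0" "geodesic_on M A g {0..h} x"
    "((\<lambda>s. snd c (x s)) has_vector_derivative v0) (at 0 within {0..h})"
proof -
  let ?O = "snd c ` fst c \<inter> {y. 0 < y $ k}"
  let ?F = "\<lambda>z. (snd z, - christoffel_form g c (param c (fst z)) (snd z) (snd z))"
  have "open ?O" using c by (intro interior_image_open chart_open) auto
  then have W: "open (?O \<times> (UNIV :: (real^'n) set))" by (intro open_Times) auto
  have lip: "loc_lipschitz_on (?O \<times> UNIV) ?F"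
    by (rule loc_lipschitz_on_subset[OF loc_lipschitz_on_geodesic_field[OF c(1)]]) auto
  have z0: "(snd c x0, v0) \<in> ?O \<times> UNIV" using c pos by auto
  obtain h z where h: "h > 0" and z0: "z 0 = (snd c x0, v0)"
    and z: "\<And>t. t \<in> {0..h} \<Longrightarrow> z t \<in> ?O \<times> UNIV \<and> (z has_vector_derivative ?F (z t)) (at t within {0..h})"
    by (rule picard_local_existence[OF W z0 lip]) blast
  define y where "y t = fst (z t)" for t
  define w where "w t = snd (z t)" for t
  define x where "x t = param c (y t)" for t
  have yO: "y t \<in> ?O" if "t \<in> {0..h}" for t using z[OF that] by (auto simp: y_def)
  have xc: "x t \<in> fst c" and sx: "snd c (x t) = y t" if "t \<in> {0..h}" for t
    using chart_param[of "y t" c] yO[OF that] by (auto simp: x_def)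
  have dy: "(y has_vector_derivative w t) (at t within {0..h})" if t: "t \<in> {0..h}" for t
    using bounded_linear.has_vector_derivative[OF bounded_linear_fst conjunct2[OF z[OF t]]] by (simp add: y_def[abs_def] w_def)
  have dw: "(w has_vector_derivative - christoffel_form g c (x t) (w t) (w t)) (at t within {0..h})" if t: "t \<in> {0..h}" for t
    using bounded_linear.has_vector_derivative[OF bounded_linear_snd conjunct2[OF z[OF t]]] by (simp add: y_def w_def[abs_def] x_def)
  have cont: "continuous_map (top_of_set {0..h}) M x"
  proof -
    have "continuous_on {0..h} y"
      unfolding continuous_on_eq_continuous_within using has_vector_derivative_continuous[OF dy] by blast
    then have "continuous_map (top_of_set {0..h}) (top_of_set (snd c ` fst c)) y"
      using yO by auto
    from continuous_map_compose[OF this param_continuous[OF c(1)]] show ?thesis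
      by (simp add: o_def x_def[abs_def])
  qed
  have dx: "((\<lambda>s. snd c (x s)) has_vector_derivative w t) (at t within {0..h})" if t: "t \<in> {0..h}" for t
    by (rule has_vector_derivative_transform[OF t _ dy[OF t]]) (simp add: sx)
  \<comment> \<open>One formula gives the velocity in every chart. Its derivative has a term in
    \<open>J'\<close> from the moving Jacobian, which the transformation law absorbs.\<close>
  define v where "v d t = jacobian_at c d (x t) *v w t" for d t
  have "((\<lambda>s. snd d (x s)) has_vector_derivative v d t) (at t within {0..h}) \<and>
      (v d has_vector_derivative - christoffel_form g d (x t) (v d t) (v d t)) (at t within {0..h})"
    if d: "d \<in> A" and t: "t \<in> {0..h}" and xd: "x t \<in> fst d" for d t
  proof
    show "((\<lambda>s. snd d (x s)) has_vector_derivative v d t) (at t within {0..h})"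
      unfolding v_def by (rule chart_change_velocity[OF cont t c(1) xc[OF t] d xd dx[OF t]])
    have p: "0 < snd c (x t) $ k" using yO[OF t] by (simp add: sx[OF t])
    obtain J' where J': "((\<lambda>y. jacobian_at c d (param c y)) has_derivative J') (at (snd c (x t)))"
      and sym: "\<And>a b. J' a *v b = J' b *v a"
      by (rule jacobian_has_derivative[OF c(1) xc[OF t] d xd p]) blast
    have "((\<lambda>s. jacobian_at c d (param c (y s))) has_vector_derivative J' (w t)) (at t within {0..h})"
      by (rule has_vector_derivative_compose_eventually[OF dy[OF t], where S=UNIV])
         (use J' t in \<open>auto simp: sx\<close>)
    from has_vector_derivative_matrix_vector_mult[OF this dw[OF t]]
    have "(v d has_vector_derivative (J' (w t) *v w t
        + jacobian_at c d (x t) *v (- christoffel_form g c (x t) (w t) (w t)))) (at t within {0..h})"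
      by (simp add: v_def[abs_def] x_def)
    also have "J' (w t) *v w t + jacobian_at c d (x t) *v (- christoffel_form g c (x t) (w t) (w t))
        = - christoffel_form g d (x t) (v d t) (v d t)"
      unfolding bounded_bilinear.minus_right[OF bounded_bilinear_matrix_vector_mult]
        christoffel_transform[OF c(1) xc[OF t] d xd p J' sym] v_def by simp
    finally show "(v d has_vector_derivative - christoffel_form g d (x t) (v d t) (v d t)) (at t within {0..h})" .
  qed
  then have "geodesic_on M A g {0..h} x"
    unfolding geodesic_on_def using cont by (intro conjI exI[of _ v]) (auto simp: is_interval_cc)
  moreover have "x 0 = x0" using c by (simp add: x_def y_def z0)
  moreover have "((\<lambda>s. snd c (x s)) has_vector_derivative v0) (at 0 within {0..h})"
    using dx[of 0] h by (simp add: w_def z0)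
  ultimately show ?thesis using that h by blast
qed

section \<open>Maximal geodesics\<close>

text \<open>Being a geodesic is a local property. Neighbourhoods are relative to \<open>I\<close>,
  so endpoints are included; this is what makes the union of a chain of geodesics a
  geodesic.\<close>

lemma geodesic_on_locally:
  assumes I: "is_interval I" and nd: "\<exists>a\<in>I. \<exists>b\<in>I. a \<noteq> b"
    and loc: "\<And>t. t \<in> I \<Longrightarrow> \<exists>J y \<epsilon>. geodesic_on M A g J y \<and> (\<forall>s\<in>J. y s = x s) \<and> t \<in> J \<and> J \<subseteq> I \<and>
        \<epsilon> > 0 \<and> I \<inter> ball t \<epsilon> \<subseteq> J"
  shows "geodesic_on M A g I x"
proof -
  have bot: "at t within I \<noteq> bot" if "t \<in> I" for t by (rule at_within_interval_neq_bot[OF I that nd])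
  have at_eq: "at s within I = at s within J" if "J \<subseteq> I" "I \<inter> ball t \<epsilon> \<subseteq> J" "s \<in> ball t \<epsilon>" for s t \<epsilon> J
    by (rule at_within_nhd[OF that(3)]) (use that in auto)
  have cont: "continuous_map (top_of_set I) M x"
  proof (rule continuous_map_at_withinI)
    fix t assume t: "t \<in> I"
    obtain J y \<epsilon> where J: "geodesic_on M A g J y" "\<forall>s\<in>J. y s = x s" "t \<in> J" "J \<subseteq> I" "\<epsilon> > 0" "I \<inter> ball t \<epsilon> \<subseteq> J"
      using loc[OF t] by blast
    have y: "continuous_map (top_of_set J) M y" using J(1) by (simp add: geodesic_on_def)
    show "x t \<in> topspace M"
      using continuous_map_image_subset_topspace[OF y] J(2,3) by force
    fix U assume U: "openin M U" "x t \<in> U"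
    have "\<forall>\<^sub>F s in at t within J. y s \<in> U"
      using J(2,3) U by (intro eventually_continuous_map_at[OF y J(3)]) auto
    moreover have "\<forall>\<^sub>F s in at t within J. s \<in> J" by (simp add: eventually_at_topological) blast
    ultimately have "\<forall>\<^sub>F s in at t within J. x s \<in> U" by eventually_elim (use J(2) in auto)
    then show "\<forall>\<^sub>F s in at t within I. x s \<in> U" using at_eq[OF J(4,6), of t] J(5) by simp
  qed
  \<comment> \<open>\<open>geodesic_on\<close> wants one velocity function per chart on all of
    \<open>I\<close>. Derivatives within \<open>I\<close> are unique, so this choice agrees with
    every local velocity.\<close>
  define v :: "('a, 'n) chart \<Rightarrow> real \<Rightarrow> real^'n" where "v c t = vector_derivative (\<lambda>s. snd c (x s)) (at t within I)" for c t
  have "((\<lambda>s. snd c (x s)) has_vector_derivative v c t) (at t within I) \<and>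
      (v c has_vector_derivative - christoffel_form g c (x t) (v c t) (v c t)) (at t within I)"
    if c: "c \<in> A" and t: "t \<in> I" and xc: "x t \<in> fst c" for c t
  proof -
    obtain J y \<epsilon> where J: "geodesic_on M A g J y" "\<forall>s\<in>J. y s = x s" "t \<in> J" "J \<subseteq> I" "\<epsilon> > 0" "I \<inter> ball t \<epsilon> \<subseteq> J"
      using loc[OF t] by blast
    obtain u where u: "\<And>s. s \<in> J \<Longrightarrow> y s \<in> fst c \<Longrightarrow> ((\<lambda>r. snd c (y r)) has_vector_derivative u s) (at s within J)"
      and u': "\<And>s. s \<in> J \<Longrightarrow> y s \<in> fst c \<Longrightarrow> (u has_vector_derivative - christoffel_form g c (y s) (u s) (u s)) (at s within J)"
      using J(1) c unfolding geodesic_on_def by blast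
    have d: "((\<lambda>r. snd c (x r)) has_vector_derivative u s) (at s within I)"
      if s: "s \<in> I" "s \<in> ball t \<epsilon>" "x s \<in> fst c" for s
    proof -
      have sJ: "s \<in> J" using s J(6) by auto
      then have "((\<lambda>r. snd c (x r)) has_vector_derivative u s) (at s within J)"
        using u[OF sJ] s(3) J(2) by (intro has_vector_derivative_transform[OF sJ _ u[OF sJ]]) auto
      then show ?thesis using at_eq[OF J(4,6) s(2)] by simp
    qed
    have vu: "v c s = u s" if s: "s \<in> I" "s \<in> ball t \<epsilon>" "x s \<in> fst c" for s
      unfolding v_def by (rule vector_derivative_within[OF bot[OF s(1)] d[OF s]])
    have tb: "t \<in> ball t \<epsilon>" using J(5) by simp
    have "\<forall>\<^sub>F s in at t within I. s \<in> I \<and> s \<in> ball t \<epsilon>"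
      unfolding eventually_at_topological using tb by (intro exI[of _ "ball t \<epsilon>"]) auto
    with eventually_in_chart[OF cont t c xc] have ev: "\<forall>\<^sub>F s in at t within I. u s = v c s"
      by eventually_elim (simp add: vu)
    have "(u has_vector_derivative - christoffel_form g c (x t) (u t) (u t)) (at t within I)"
      using u'[OF J(3)] J(2,3) xc at_eq[OF J(4,6) tb] by simp
    then have "(v c has_vector_derivative - christoffel_form g c (x t) (u t) (u t)) (at t within I)"
      unfolding has_vector_derivative_def
      by (rule has_derivative_transform_eventually[OF _ ev]) (use t vu[OF t tb xc] in auto)
    then show ?thesis using d[OF t tb xc] vu[OF t tb xc] by simp
  qed
  then show ?thesis unfolding geodesic_on_def using I cont by blast
qed

text \<open>Zorn's lemma for the graphs of geodesics ordered by inclusion. A function on the reals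
  has arbitrary values off its interval; the graph forgets them, and inclusion of graphs is exactly
  extension as in \<open>maximal_geodesic_on\<close>.\<close>

lemma geodesic_maximal_extension:
  assumes geo: "geodesic_on M A g I0 x0" and nd: "\<exists>a\<in>I0. \<exists>b\<in>I0. a \<noteq> b"
  obtains I x where "maximal_geodesic_on M A g I x" "I0 \<subseteq> I" "\<And>t. t \<in> I0 \<Longrightarrow> x t = x0 t"
proof -
  define graph :: "real set \<Rightarrow> (real \<Rightarrow> 'a) \<Rightarrow> (real \<times> 'a) set" where "graph I x = (\<lambda>t. (t, x t)) ` I" for I x
  have graph_iff: "(t, p) \<in> graph I x \<longleftrightarrow> t \<in> I \<and> p = x t" for t p I x by (auto simp: graph_def)
  have graph_subset: "graph I x \<subseteq> graph J y \<longleftrightarrow> I \<subseteq> J \<and> (\<forall>t\<in>I. y t = x t)" for I x J y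
    by (auto simp: graph_def)
  let ?\<A> = "{G. \<exists>I x. G = graph I x \<and> geodesic_on M A g I x \<and> graph I0 x0 \<subseteq> G}"
  have "\<exists>G\<in>?\<A>. \<forall>X\<in>?\<A>. G \<subseteq> X \<longrightarrow> X = G"
  proof (rule subset_Zorn_nonempty)
    show "?\<A> \<noteq> {}" using geo by auto
    fix \<C> assume ne: "\<C> \<noteq> {}" and chain: "subset.chain ?\<A> \<C>"
    have sub: "\<C> \<subseteq> ?\<A>" and tot: "\<And>X Y. X \<in> \<C> \<Longrightarrow> Y \<in> \<C> \<Longrightarrow> X \<subseteq> Y \<or> Y \<subseteq> X"
      using chain unfolding subset_chain_def by blast+
    define I where "I = fst ` \<Union>\<C>"
    define x where "x t = (SOME p. (t, p) \<in> \<Union>\<C>)" for t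
    have dir: "\<exists>Z\<in>\<C>. X \<subseteq> Z \<and> Y \<subseteq> Z" if "X \<in> \<C>" "Y \<in> \<C>" for X Y using tot[OF that] that by auto
    have single: "p = q" if pq: "(t, p) \<in> \<Union>\<C>" "(t, q) \<in> \<Union>\<C>" for t p q
    proof -
      obtain X Y where "X \<in> \<C>" "(t, p) \<in> X" "Y \<in> \<C>" "(t, q) \<in> Y" using pq by auto
      then obtain Z where Z: "Z \<in> \<C>" "(t, p) \<in> Z" "(t, q) \<in> Z" using dir by (meson subsetD)
      then obtain J y where "Z = graph J y" using sub by auto
      then show ?thesis using Z by (simp add: graph_iff)
    qed
    have xU: "x t = p" if "(t, p) \<in> \<Union>\<C>" for t p
      unfolding x_def using someI[of "\<lambda>p. (t, p) \<in> \<Union>\<C>", OF that] that by (rule single)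
    have U: "\<Union>\<C> = graph I x"
    proof (intro set_eqI iffI)
      fix z assume z: "z \<in> \<Union>\<C>"
      then show "z \<in> graph I x" using xU[of "fst z" "snd z"] by (cases z) (force simp: graph_iff I_def)
    next
      fix z assume "z \<in> graph I x"
      then obtain t where t: "t \<in> I" "z = (t, x t)" by (auto simp: graph_def)
      then obtain p where "(t, p) \<in> \<Union>\<C>" unfolding I_def by (metis imageE prod.collapse)
      then show "z \<in> \<Union>\<C>" using xU t by metis
    qed
    have mem: "\<exists>J y. Z = graph J y \<and> geodesic_on M A g J y \<and> I0 \<subseteq> J \<and> J \<subseteq> I \<and> (\<forall>s\<in>J. y s = x s)"
      if Z: "Z \<in> \<C>" for Z
    proof -
      obtain J y where J: "Z = graph J y" "geodesic_on M A g J y" "graph I0 x0 \<subseteq> Z" using Z sub by auto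
      moreover have "graph J y \<subseteq> graph I x" using Z J(1) U by auto
      ultimately show ?thesis unfolding graph_subset by (intro exI[of _ J] exI[of _ y]) (auto simp: graph_subset)
    qed
    \<comment> \<open>A chain is directed, so finitely many parameters already lie in the domain of
      a single member.\<close>
    have cover: "\<exists>Z\<in>\<C>. S \<subseteq> fst ` Z" if "finite S" "S \<subseteq> I" for S
      using that
    proof (induction S)
      case empty
      then show ?case using ne by auto
    next
      case (insert t S)
      then obtain X where X: "X \<in> \<C>" "S \<subseteq> fst ` X" by auto
      obtain Y where Y: "Y \<in> \<C>" "t \<in> fst ` Y" using insert.prems by (auto simp: I_def)
      obtain Z where Z: "Z \<in> \<C>" "X \<subseteq> Z" "Y \<subseteq> Z" using dir[OF X(1) Y(1)] by blast
      have "insert t S \<subseteq> fst ` Z" using X(2) Y(2) image_mono[OF Z(2), of fst] image_mono[OF Z(3), of fst] by blast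
      then show ?case using Z(1) by blast
    qed
    have cover': "\<exists>J y. geodesic_on M A g J y \<and> I0 \<subseteq> J \<and> J \<subseteq> I \<and> (\<forall>s\<in>J. y s = x s) \<and> S \<subseteq> J"
      if S: "finite S" "S \<subseteq> I" for S
    proof -
      obtain Z where Z: "Z \<in> \<C>" "S \<subseteq> fst ` Z" using cover[OF S] by blast
      obtain J y where J: "Z = graph J y" "geodesic_on M A g J y" "I0 \<subseteq> J" "J \<subseteq> I" "\<forall>s\<in>J. y s = x s"
        using mem[OF Z(1)] by blast
      have "S \<subseteq> J" using Z(2) J(1) by (simp add: graph_def image_image)
      then show ?thesis using J(2-5) by (intro exI[of _ J] exI[of _ y] conjI)
    qed
    have I0I: "I0 \<subseteq> I" using cover'[of "{}"] by auto
    have I: "is_interval I"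
      unfolding is_interval_1
    proof (intro ballI allI impI)
      fix a b t assume ab: "a \<in> I" "b \<in> I" "a \<le> t \<and> t \<le> b"
      then obtain J y where "geodesic_on M A g J y" "J \<subseteq> I" "{a, b} \<subseteq> J" using cover'[of "{a, b}"] by auto
      then show "t \<in> I" using ab unfolding geodesic_on_def is_interval_1 by blast
    qed
    have "geodesic_on M A g I x"
    proof (rule geodesic_on_locally[OF I])
      show "\<exists>a\<in>I. \<exists>b\<in>I. a \<noteq> b" using nd I0I by blast
      fix t assume t: "t \<in> I"
      \<comment> \<open>\<open>r1\<close> and \<open>r2\<close> lie strictly on either side of
        \<open>t\<close> whenever \<open>I\<close> extends there. A member of the chain defined at
        both contains a relative neighbourhood of \<open>t\<close>.\<close>
      obtain r1 where r1: "r1 \<in> I" "r1 \<le> t" "(\<exists>s\<in>I. s < t) \<Longrightarrow> r1 < t" using t by (metis le_less)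
      obtain r2 where r2: "r2 \<in> I" "t \<le> r2" "(\<exists>s\<in>I. t < s) \<Longrightarrow> t < r2" using t by (metis le_less)
      obtain J y where J: "geodesic_on M A g J y" "J \<subseteq> I" "\<forall>s\<in>J. y s = x s" "{r1, t, r2} \<subseteq> J"
        using cover'[of "{r1, t, r2}"] r1 r2 t by auto
      have Ji: "s \<in> J" if "r1 \<le> s" "s \<le> r2" for s
        using J(1,4) that unfolding geodesic_on_def is_interval_1 by blast
      \<comment> \<open>The value 1 stands in where \<open>t\<close> is an end of \<open>I\<close>,
        so that nothing has to be covered on that side.\<close>
      define \<epsilon> where "\<epsilon> = min (if r1 < t then t - r1 else 1) (if t < r2 then r2 - t else 1)"
      have "\<epsilon> > 0" by (auto simp: \<epsilon>_def)
      moreover have "I \<inter> ball t \<epsilon> \<subseteq> J"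
      proof
        fix s assume s: "s \<in> I \<inter> ball t \<epsilon>"
        then have ds: "\<bar>t - s\<bar> < \<epsilon>" by (simp add: dist_real_def)
        have "r1 \<le> s"
        proof (cases "s < t")
          case True
          then have "r1 < t" using r1(3) s by blast
          then show ?thesis using ds by (auto simp: \<epsilon>_def)
        qed (use r1(2) in auto)
        moreover have "s \<le> r2"
        proof (cases "t < s")
          case True
          then have "t < r2" using r2(3) s by blast
          then show ?thesis using ds by (auto simp: \<epsilon>_def)
        qed (use r2(2) in auto)
        ultimately show "s \<in> J" by (rule Ji)
      qed
      ultimately show "\<exists>J y \<epsilon>. geodesic_on M A g J y \<and> (\<forall>s\<in>J. y s = x s) \<and> t \<in> J \<and> J \<subseteq> I \<and>
        \<epsilon> > 0 \<and> I \<inter> ball t \<epsilon> \<subseteq> J" using J by blast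
    qed
    moreover have "graph I0 x0 \<subseteq> \<Union>\<C>" using ne sub by blast
    ultimately show "\<Union>\<C> \<in> ?\<A>" using U by blast
  qed
  then obtain G where G: "G \<in> ?\<A>" and Gmax: "\<forall>X\<in>?\<A>. G \<subseteq> X \<longrightarrow> X = G" by (rule bexE)
  then obtain I x where I: "G = graph I x" "geodesic_on M A g I x" "graph I0 x0 \<subseteq> graph I x" by auto
  have "maximal_geodesic_on M A g I x"
    unfolding maximal_geodesic_on_def
  proof (intro conjI allI impI I(2))
    fix J y assume J: "geodesic_on M A g J y \<and> I \<subseteq> J \<and> (\<forall>t\<in>I. y t = x t)"
    then have "graph I x \<subseteq> graph J y" by (simp add: graph_subset)
    moreover from this I(3) J have "graph J y \<in> ?\<A>" by blast
    ultimately have "graph J y = graph I x" using Gmax I(1) by simp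
    then have "graph J y \<subseteq> graph I x" by simp
    then have "J \<subseteq> I" by (simp add: graph_subset)
    then show "J = I" using J by blast
  qed
  then show ?thesis using that I(3) by (simp add: graph_subset)
qed

section \<open>Reaching interior covectors from the boundary\<close>

text \<open>Hamilton's equations are autonomous; the shift moves the exit point to parameter 0, as
  \<open>flows_to\<close> requires.\<close>

lemma hamiltonian_curve_shift:
  assumes \<gamma>: "hamiltonian_curve_on M A g I \<gamma>" and J: "is_interval J" "\<And>s. s \<in> J \<Longrightarrow> s + b \<in> I"
  shows "hamiltonian_curve_on M A g J (\<lambda>s. \<gamma> (s + b))"
proof -
  have sub: "(\<lambda>s. s + b) ` J \<subseteq> I" using J by auto
  have "continuous_map (top_of_set J) (top_of_set I) (\<lambda>s. s + b)"
    using sub by (auto intro!: continuous_intros)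
  from continuous_map_compose[OF this hamiltonian_curve_continuous[OF \<gamma>]]
  have cont: "continuous_map (top_of_set J) M (\<lambda>s. fst (\<gamma> (s + b)))" by (simp add: o_def)
  have "((\<lambda>s. (snd c (fst (\<gamma> (s + b))), snd (\<gamma> (s + b)) c)) has_vector_derivative
      hamiltonian_field g c (snd c (fst (\<gamma> (t + b)))) (snd (\<gamma> (t + b)) c)) (at t within J)"
    if "c \<in> A" "t \<in> J" "fst (\<gamma> (t + b)) \<in> fst c" for c t
  proof -
    have 1: "((\<lambda>s. s + b) has_vector_derivative 1) (at t within J)"
      by (auto intro!: derivative_eq_intros)
    have 2: "((\<lambda>s. (snd c (fst (\<gamma> s)), snd (\<gamma> s) c)) has_vector_derivative
      hamiltonian_field g c (snd c (fst (\<gamma> (t + b)))) (snd (\<gamma> (t + b)) c)) (at (t + b) within (\<lambda>s. s + b) ` J)"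
      by (rule has_vector_derivative_within_subset[OF hamiltonian_curve_derivative[OF \<gamma> _ that(1,3)] sub])
         (rule J(2)[OF that(2)])
    show ?thesis using vector_diff_chain_within[OF 1 2] by (simp add: o_def)
  qed
  then show ?thesis
    using \<gamma> J cont unfolding hamiltonian_curve_on_def o_def by blast
qed

lemma boundary_energy_pos:
  assumes "p \<in> boundary_cotangent_nonzero k A"
  shows "energy p > 0"
proof -
  obtain x \<xi> where p: "p = (x, \<xi>)" "x \<in> manifold_boundary k A" "\<xi> \<in> cotangent_space A x" "\<xi> \<noteq> (\<lambda>_. 0)"
    using assms by (auto simp: boundary_cotangent_nonzero_def)
  then obtain c where c: "c \<in> A" "x \<in> fst c" by (auto simp: manifold_boundary_def)
  show ?thesis unfolding p(1) by (rule energy_pos[OF c p(3) covector_nonzero[OF p(3,4) c]])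
qed

text \<open>The maximal geodesic whose lift passes through the covector is followed forwards to its
  end on the boundary; the flow is then run backwards from there. The length obtained is therefore
  negative, which \<open>flows_to\<close> admits.\<close>

lemma interior_covector_reached:
  assumes nt: "non_trapping M k A g" and c: "c \<in> A" "x \<in> fst c" and int: "x \<notin> manifold_boundary k A"
    and \<xi>: "\<xi> \<in> cotangent_space A x" "\<xi> c \<noteq> 0"
  obtains p l where "p \<in> boundary_cotangent_nonzero k A" "flows_to M A g p l (x, \<xi>)"
proof -
  have "snd c x \<in> half_space k" using chart_image_open[OF c(1)] openin_subset c(2) by fastforce
  moreover have "snd c x $ k \<noteq> 0" using int c by (auto simp: manifold_boundary_def)
  ultimately have pos: "0 < snd c x $ k" by (simp add: half_space_def)
  \<comment> \<open>The factor 2 compensates the 1/2 in the lift, whose covector at \<open>x\<close>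
    is then \<open>\<xi>\<close>.\<close>
  define v where "v = 2 *\<^sub>R (inverse_metric g c x *v \<xi> c)"
  have gv: "(1/2) *\<^sub>R (g c x *v v) = \<xi> c"
    by (simp add: v_def matrix_vector_mult_scaleR matrix_inv_vector_mult metric_invertible[OF c])
  have v0: "v \<noteq> 0" using gv \<xi>(2) by auto
  obtain h y where h: "h > 0" and y0: "y 0 = x" and geo: "geodesic_on M A g {0..h} y"
    and dy: "((\<lambda>s. snd c (y s)) has_vector_derivative v) (at 0 within {0..h})"
    by (rule local_geodesic[OF c pos])
  have "\<exists>a\<in>{0..h}. \<exists>b\<in>{0..h}. a \<noteq> b" using h by (intro bexI[of _ 0] bexI[of _ h]) auto
  then obtain I z where max: "maximal_geodesic_on M A g I z" and hI: "{0..h} \<subseteq> I"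
    and zy: "\<And>t. t \<in> {0..h} \<Longrightarrow> z t = y t"
    by (rule geodesic_maximal_extension[OF geo]) blast
  have geoz: "geodesic_on M A g I z" using max by (simp add: maximal_geodesic_on_def)
  have z0: "z 0 = x" using zy[of 0] h y0 by simp
  have 0: "0 \<in> I" "h \<in> I" using hI h by auto
  have bot: "at 0 within {0..h} \<noteq> bot"
    using h by (intro at_within_interval_neq_bot bexI[of _ 0] bexI[of _ h]) (auto simp: is_interval_cc)
  \<comment> \<open>The maximal interval may extend to both sides of 0. Restricting its velocity to
    \<open>{0..h}\<close> identifies it with the prescribed \<open>v\<close>.\<close>
  have "\<exists>w. ((\<lambda>s. snd c (z s)) has_vector_derivative w) (at 0 within I)"
    using geoz c 0 z0 unfolding geodesic_on_def by blast
  then obtain w where w: "((\<lambda>s. snd c (z s)) has_vector_derivative w) (at 0 within I)" by blast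
  have "((\<lambda>s. snd c (y s)) has_vector_derivative w) (at 0 within {0..h})"
    using h zy by (intro has_vector_derivative_transform[OF _ _ has_vector_derivative_within_subset[OF w hI]]) auto
  from vector_derivative_unique_within[OF bot this dy] have wv: "w = v" .
  \<comment> \<open>Non-trapping excludes constant curves; here the initial velocity
    \<open>v\<close> is nonzero.\<close>
  have "\<not> z constant_on I"
  proof
    assume "z constant_on I"
    then have "\<forall>t\<in>{0..h}. y t = x" using zy z0 0 hI unfolding constant_on_def by (metis subsetD)
    then have "((\<lambda>s. snd c (y s)) has_vector_derivative 0) (at 0 within {0..h})"
      using h by (intro has_vector_derivative_transform[OF _ _ has_vector_derivative_const[of "snd c x"]]) auto
    from vector_derivative_unique_within[OF bot this dy] show False using v0 by simp
  qed
  then obtain a b where I: "I = {a..b}" and zb: "z b \<in> manifold_boundary k A"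
    using nt max unfolding non_trapping_def by blast
  obtain \<gamma> where \<gamma>: "hamiltonian_curve_on M A g I \<gamma>" and \<gamma>1: "\<And>t. fst (\<gamma> t) = z t"
    and \<gamma>2: "\<And>t c v. t \<in> I \<Longrightarrow> c \<in> A \<Longrightarrow> z t \<in> fst c \<Longrightarrow> ((\<lambda>s. snd c (z s)) has_vector_derivative v) (at t within I) \<Longrightarrow>
      snd (\<gamma> t) c = (1/2) *\<^sub>R (g c (z t) *v v)"
    using geodesic_lift[OF geoz] 0 h by (metis less_irrefl)
  have "snd (\<gamma> 0) c = \<xi> c" using \<gamma>2[OF 0(1) c(1) _ w] c z0 gv wv by simp
  then have "snd (\<gamma> 0) = \<xi>"
    using hamiltonian_curve_chart(1)[OF \<gamma> 0(1)] \<gamma>1 z0 by (intro covector_eqI[OF _ \<xi>(1) c]) auto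
  then have \<gamma>0: "\<gamma> 0 = (x, \<xi>)" using \<gamma>1[of 0] z0 by (simp add: prod_eq_iff)
  have ab: "a \<le> 0" "0 < b" "b \<in> I" using 0 h I by auto
  have seg: "closed_segment 0 (- b) = {-b..0}" using ab by (simp add: closed_segment_eq_real_ivl)
  have H: "hamiltonian_curve_on M A g (closed_segment 0 (- b)) (\<lambda>s. \<gamma> (s + b))"
    by (rule hamiltonian_curve_shift[OF \<gamma>]) (use ab I seg in \<open>auto simp: is_interval_cc\<close>)
  have "flows_to M A g (\<gamma> b) (sgn (- b) * curve_length A g (closed_segment 0 (- b)) (fst \<circ> (\<lambda>s. \<gamma> (s + b)))) (x, \<xi>)"
    unfolding flows_to_def by (intro exI[of _ "- b"] exI[of _ "\<lambda>s. \<gamma> (s + b)"]) (use H \<gamma>0 in auto)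
  moreover have "\<gamma> b \<in> boundary_cotangent_nonzero k A"
  proof -
    have cot: "snd (\<gamma> b) \<in> cotangent_space A (z b)" using hamiltonian_curve_chart(1)[OF \<gamma> ab(3)] \<gamma>1 by simp
    \<comment> \<open>A zero covector at the exit would have energy zero, but energy is conserved
      and positive at \<open>(x, \<xi>)\<close>.\<close>
    have "snd (\<gamma> b) \<noteq> (\<lambda>_. 0)"
    proof
      assume zero: "snd (\<gamma> b) = (\<lambda>_. 0)"
      obtain d where d: "d \<in> A" "z b \<in> fst d" using zb by (auto simp: manifold_boundary_def)
      have "\<gamma> b = (z b, snd (\<gamma> b))" using \<gamma>1[of b] by (simp add: prod_eq_iff)
      then have "energy (\<gamma> b) = 0" using energy_chart[OF d cot] zero by simp
      then show False using energy_constant[OF \<gamma> 0(1) ab(3)] energy_pos[OF c \<xi>] \<gamma>0 by simp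
    qed
    then show ?thesis using zb cot \<gamma>1[of b] by (cases "\<gamma> b") (simp add: boundary_cotangent_nonzero_def)
  qed
  ultimately show ?thesis using that by blast
qed

end

section \<open>Comparison of the two Hamiltonians through the collision relation\<close>

theorem theorem4p3:
  fixes M :: "'a topology" and k :: "'n::finite" and A :: "('a, 'n) chart set"
    and gP gS gS' :: "('a, 'n) metric_tensor"
  assumes "smooth_manifold_with_boundary M k A" and "compact_space M"
    and "riemannian_metric A gP" and "riemannian_metric A gS" and "riemannian_metric A gS'"
    and "strictly_convex_boundary k A gP" and "strictly_convex_boundary k A gS"
    and "strictly_convex_boundary k A gS'"
    and "non_trapping M k A gP" and "non_trapping M k A gS" and "non_trapping M k A gS'"
    and "\<forall>c\<in>A. \<forall>x\<in>fst c \<inter> manifold_boundary k A. inverse_metric gS c x = inverse_metric gS' c x"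
    and "directional_collision_relation M k A gP gS = directional_collision_relation M k A gP gS'"
  shows "\<forall>c\<in>A. \<forall>x\<in>fst c. gS c x = gS' c x"
proof (intro ballI)
  interpret P: riemannian_manifold M k A gP using assms by unfold_locales
  interpret S: riemannian_manifold M k A gS using assms by unfold_locales
  interpret S': riemannian_manifold M k A gS' using assms by unfold_locales
  fix c x assume c: "c \<in> A" "x \<in> fst c"
  have "p \<bullet> (inverse_metric gS c x *v p) = p \<bullet> (inverse_metric gS' c x *v p)"
    if int: "x \<notin> manifold_boundary k A" and p: "p \<noteq> 0" for p
  proof -
    obtain \<xi> where \<xi>: "\<xi> \<in> cotangent_space A x" "\<xi> c = p" by (rule P.covector_exists[OF c])
    then have \<xi>c: "\<xi> c \<noteq> 0" using p by simp
    obtain pP lP where P: "pP \<in> boundary_cotangent_nonzero k A" "flows_to M A gP pP lP (x, \<xi>)"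
      by (rule P.interior_covector_reached[OF assms(9) c int \<xi>(1) \<xi>c])
    obtain pS lS where S: "pS \<in> boundary_cotangent_nonzero k A" "flows_to M A gS pS lS (x, \<xi>)"
      by (rule S.interior_covector_reached[OF assms(10) c int \<xi>(1) \<xi>c])
    have lP: "length_flow M A gP pP lP = (x, \<xi>)"
      by (rule P.length_flow_eq[OF P.boundary_energy_pos[OF P(1)] P(2)])
    have lS: "length_flow M A gS pS lS = (x, \<xi>)"
      by (rule S.length_flow_eq[OF S.boundary_energy_pos[OF S(1)] S(2)])
    have "(fst pP, snd pP, lP, fst pS, snd pS, lS) \<in> directional_collision_relation M k A gP gS"
      using P S lP lS by (auto simp: directional_collision_relation_def flow_domain_def)
    then have "(fst pP, snd pP, lP, fst pS, snd pS, lS) \<in> directional_collision_relation M k A gP gS'"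
      using assms(13) by simp
    \<comment> \<open>Membership in the domain gives some covector \<open>q\<close> reached by the
      second flow; uniqueness identifies it with the value of \<open>length_flow\<close>, which is
      \<open>(x, \<xi>)\<close>.\<close>
    then have "lS \<in> flow_domain M A gS' pS" "length_flow M A gS' pS lS = (x, \<xi>)"
      using lP by (auto simp: directional_collision_relation_def)
    then obtain q where q: "flows_to M A gS' pS lS q" "length_flow M A gS' pS lS = (x, \<xi>)"
      by (auto simp: flow_domain_def)
    then have S': "flows_to M A gS' pS lS (x, \<xi>)"
      using S'.length_flow_eq[OF S'.boundary_energy_pos[OF S(1)] q(1)] by simp
    obtain xS \<xi>S where pS: "pS = (xS, \<xi>S)" "xS \<in> manifold_boundary k A" "\<xi>S \<in> cotangent_space A xS"
      using S(1) by (auto simp: boundary_cotangent_nonzero_def)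
    then obtain d where d: "d \<in> A" "xS \<in> fst d" by (auto simp: manifold_boundary_def)
    \<comment> \<open>This is where the known boundary values of the inverse metric enter.\<close>
    have "S.energy pS = S'.energy pS"
      using S.energy_chart[OF d pS(3)] S'.energy_chart[OF d pS(3)] assms(12) d pS by simp
    then have "S.energy (x, \<xi>) = S'.energy (x, \<xi>)"
      using S.flows_to_energy[OF S(2)] S'.flows_to_energy[OF S'] by simp
    then show ?thesis
      using S.energy_chart[OF c \<xi>(1)] S'.energy_chart[OF c \<xi>(1)] \<xi>(2) by simp
  qed
  \<comment> \<open>Over the boundary the inverse metrics agree by hypothesis, and for the zero
    covector both sides vanish.\<close>
  then have "p \<bullet> (inverse_metric gS c x *v p) = p \<bullet> (inverse_metric gS' c x *v p)" for p
    using assms(12) c by (cases "x \<in> manifold_boundary k A"; cases "p = 0") auto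
  then have eq: "inverse_metric gS c x = inverse_metric gS' c x"
    by (rule symmetric_matrix_eqI[OF
          matrix_inv_symmetric[OF S.metric_invertible[OF c] S.metric_symmetric[OF c]]
          matrix_inv_symmetric[OF S'.metric_invertible[OF c] S'.metric_symmetric[OF c]]])
  have "gS c x = gS c x ** (inverse_metric gS' c x ** gS' c x)"
    by (simp add: matrix_inv_mult(2)[OF S'.metric_invertible[OF c]])
  also have "\<dots> = (gS c x ** inverse_metric gS c x) ** gS' c x" by (simp only: eq matrix_mul_assoc)
  also have "\<dots> = gS' c x" by (simp only: matrix_inv_mult(1)[OF S.metric_invertible[OF c]] matrix_mul_lid)
  finally show "gS c x = gS' c x" .
qed

end
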